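(* Let $U\subseteq G$ and $V\subseteq H$ be open subsets of topological groups $G$ and $H$, and let $E$ be a locally convex space. Suppose that $U\times V\times\mathfrak{L}(G)^i\times\mathfrak{L}(H)^j$ is a $k_{\mathbb{R}}$-space for all $i,j\in\mathbb{N}_0$. Then the map $$\Phi: C^\infty(U\times V,E)\to C^\infty(U,C^\infty(V,E)),\quad f\mapsto f^\vee,$$ where $f^\vee(x):=f(x,\bullet)$ for $x\in U$, is (well defined and) an isomorphism of topological vector spaces, i.e. a linear bijection that is a homeomorphism.
   Context: Conventions: all topological spaces (in particular topological groups and locally convex spaces) are Hausdorff; a locally convex space is a Hausdorff locally convex real topological vector space. $\mathbb{N}=\{1,2,\dots\}$, $\mathbb{N}_0=\mathbb{N}\cup\{0\}$. A Hausdorff space $X$ is a $k_{\mathbb{R}}$-space if a function $f:X\to\mathbb{R}$ is continuous if and only if $f|_K$ is continuous for each compact $K\subseteq X$. For a topological group $G$, $\mathfrak{L}(G)$ is the set of continuous group homomorphisms $\gamma:\mathbb{R}\to G$, with the compact-open topology. Let $U\subseteq G$ be open and $F$ a locally convex space. For $f:U\to F$, $x\in U$, $\gamma\in\mathfrak{L}(G)$ put $D_\gamma f(x):=\lim_{t\to0}\frac1t\big(f(x\cdot\gamma(t))-f(x)\big)$ if the limit exists. The map $f$ is $C^\infty$ if $f$ is continuous and, for each $i\in\mathbb{N}$, the iterated derivatives $d^{(i)}f(x,\gamma_1,\dots,\gamma_i):=(D_{\gamma_i}\cdots D_{\gamma_1}f)(x)$ exist for all $x\in U$, $\gamma_1,\dots,\gamma_i\in\mathfrak{L}(G)$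 and define a continuous map $d^{(i)}f:U\times\mathfrak{L}(G)^i\to F$. Put $d^{(0)}f:=f$. The space $C^\infty(U,F)$ of all $C^\infty$-maps carries the initial topology with respect to the maps $d^{(i)}:C^\infty(U,F)\to C(U\times\mathfrak{L}(G)^i,F)$, $f\mapsto d^{(i)}f$, $i\in\mathbb{N}_0$, where the targets carry the compact-open topology; it is a Hausdorff locally convex space. The set $U\times V$ is regarded as an open subset of the topological group $G\times H$. *)

theory Defs
  imports "HOL-Analysis.Analysis" "HOL-Library.Function_Algebras"
begin

text \<open>
  Topological groups are types of class \<^class>\<open>topological_group_add\<close> and \<^class>\<open>t2_space\<close>. This class
  extends \<^class>\<open>group_add\<close>, so the group is written additively but need not be commutative;
  the order of summands in \<open>x + \<gamma> t\<close> matters.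

  Locally convex spaces cannot be types here, because \<open>C\<^sup>\<infinity>(V,E)\<close> depends on the set \<open>V\<close>
  and must itself serve as a coefficient space. They are abstract topologies whose
  underlying set is a linear subspace of a real vector space. A function on \<open>U\<close> with values in
  a vector space is represented by its extension by zero, so that function spaces are again linear
  subspaces of a real vector space, namely of a full function type. Under this convention
  \<open>x \<mapsto> f(x, \<bullet>)\<close> for \<open>f\<close> on \<open>U \<times> V\<close> is plain currying: it is \<open>0\<close> off \<open>U\<close>, and each of
  its values is \<open>0\<close> off \<open>V\<close>.
\<close>

instantiation "fun" :: (type, real_vector) real_vector
begin

definition scaleR_fun :: "real \<Rightarrow> ('a \<Rightarrow> 'b) \<Rightarrow> 'a \<Rightarrow> 'b"
  where "scaleR_fun r f = (\<lambda>x. r *\<^sub>R f x)"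

instance
  by standard (simp_all add: scaleR_fun_def fun_eq_iff scaleR_add_right scaleR_add_left)

end

instance prod :: (topological_monoid_add, topological_monoid_add) topological_monoid_add
proof
  fix a b :: "'a \<times> 'b"
  have "((\<lambda>x. (fst (fst x) + fst (snd x), snd (fst x) + snd (snd x)))
          \<longlongrightarrow> (fst a + fst b, snd a + snd b)) (nhds a \<times>\<^sub>F nhds b)"
    by (intro tendsto_intros filterlim_fst filterlim_snd)
  then show "((\<lambda>x. fst x + snd x) \<longlongrightarrow> a + b) (nhds a \<times>\<^sub>F nhds b)"
    by (simp add: plus_prod_def case_prod_beta)
qed

instance prod :: (topological_group_add, topological_group_add) topological_group_add
proof
  fix a :: "'a \<times> 'b"
  have "((\<lambda>x. (- fst x, - snd x)) \<longlongrightarrow> (- fst a, - snd a)) (nhds a)"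
    by (intro tendsto_intros filterlim_ident)
  then show "(uminus \<longlongrightarrow> - a) (nhds a)"
    by (simp add: uminus_prod_def[abs_def])
qed

definition locally_convex_space :: "'e::real_vector topology \<Rightarrow> bool"
  where "locally_convex_space F \<longleftrightarrow>
    subspace (topspace F) \<and>
    Hausdorff_space F \<and>
    continuous_map (prod_topology F F) F (\<lambda>(x, y). x + y) \<and>
    continuous_map (prod_topology euclideanreal F) F (\<lambda>(r, x). r *\<^sub>R x) \<and>
    neighbourhood_base_of convex F"

definition tvs_isomorphism ::
    "'a::real_vector topology \<Rightarrow> 'b::real_vector topology \<Rightarrow> ('a \<Rightarrow> 'b) \<Rightarrow> bool"
  where "tvs_isomorphism X Y \<phi> \<longleftrightarrow>
    (\<forall>f\<in>topspace X. \<forall>g\<in>topspace X. \<phi> (f + g) = \<phi> f + \<phi> g) \<and>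
    (\<forall>r. \<forall>f\<in>topspace X. \<phi> (r *\<^sub>R f) = r *\<^sub>R \<phi> f) \<and>
    bij_betw \<phi> (topspace X) (topspace Y) \<and>
    homeomorphic_map X Y \<phi>"

definition kR_space :: "'a topology \<Rightarrow> bool"
  where "kR_space X \<longleftrightarrow>
    Hausdorff_space X \<and>
    (\<forall>f. continuous_map X euclideanreal f \<longleftrightarrow>
         (\<forall>K. compactin X K \<longrightarrow> continuous_map (subtopology X K) euclideanreal f))"

definition compact_open_topology :: "'a topology \<Rightarrow> 'b topology \<Rightarrow> ('a \<Rightarrow> 'b) topology"
  where "compact_open_topology X Y =
    topology_generated_by
      {{f \<in> extensional (topspace X). continuous_map X Y f \<and> f ` K \<subseteq> W} | K W.
        compactin X K \<and> openin Y W}"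

definition one_param_subgroups :: "(real \<Rightarrow> 'g::topological_group_add) set" ("\<LL>")
  where "\<LL> = {\<gamma>. continuous_on UNIV \<gamma> \<and> (\<forall>s t. \<gamma> (s + t) = \<gamma> s + \<gamma> t)}"

definition one_param_topology :: "(real \<Rightarrow> 'g::topological_group_add) topology"
  where "one_param_topology = subtopology (compact_open_topology euclidean euclidean) \<LL>"

text \<open>The power \<open>\<LL>(G)\<^sup>i\<close>; the directions \<open>\<gamma>\<^sub>1, \<dots>, \<gamma>\<^sub>i\<close> are indexed by \<open>0, \<dots>, i - 1\<close>.\<close>

definition one_param_power :: "nat \<Rightarrow> (nat \<Rightarrow> real \<Rightarrow> 'g::topological_group_add) topology"
  where "one_param_power i = product_topology (\<lambda>_. one_param_topology) {..<i}"

definition has_dir_deriv ::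
    "'f::real_vector topology \<Rightarrow> (real \<Rightarrow> 'g::topological_group_add) \<Rightarrow> ('g \<Rightarrow> 'f) \<Rightarrow> 'g \<Rightarrow> 'f \<Rightarrow> bool"
  where "has_dir_deriv F \<gamma> f x l \<longleftrightarrow>
    limitin F (\<lambda>t. (1 / t) *\<^sub>R (f (x + \<gamma> t) - f x)) l (at 0)"

definition dir_deriv ::
    "'f::real_vector topology \<Rightarrow> (real \<Rightarrow> 'g::topological_group_add) \<Rightarrow> ('g \<Rightarrow> 'f) \<Rightarrow> 'g \<Rightarrow> 'f"
  where "dir_deriv F \<gamma> f x = (THE l. has_dir_deriv F \<gamma> f x l)"

primrec iter_deriv ::
    "'f::real_vector topology \<Rightarrow> ('g \<Rightarrow> 'f) \<Rightarrow> (nat \<Rightarrow> real \<Rightarrow> 'g::topological_group_add) \<Rightarrow> nat \<Rightarrow> 'g \<Rightarrow> 'f"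
  where
    "iter_deriv F f \<gamma>s 0 = f"
  | "iter_deriv F f \<gamma>s (Suc i) = dir_deriv F (\<gamma>s i) (iter_deriv F f \<gamma>s i)"

definition deriv_domain ::
    "'g::topological_group_add set \<Rightarrow> nat \<Rightarrow> ('g \<times> (nat \<Rightarrow> real \<Rightarrow> 'g)) topology"
  where "deriv_domain U i = prod_topology (top_of_set U) (one_param_power i)"

definition deriv_map ::
    "'g::topological_group_add set \<Rightarrow> 'f::real_vector topology \<Rightarrow> nat \<Rightarrow> ('g \<Rightarrow> 'f)
      \<Rightarrow> 'g \<times> (nat \<Rightarrow> real \<Rightarrow> 'g) \<Rightarrow> 'f"
  where "deriv_map U F i f =
    restrict (\<lambda>(x, \<gamma>s). iter_deriv F f \<gamma>s i x) (topspace (deriv_domain U i))"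

text \<open>The clause for \<open>i\<close> requires that the derivative of order \<open>i + 1\<close> exists and is continuous.\<close>

definition smooth_maps ::
    "'g::topological_group_add set \<Rightarrow> 'f::real_vector topology \<Rightarrow> ('g \<Rightarrow> 'f) set"
  where "smooth_maps U F =
    {f. (\<forall>x. x \<notin> U \<longrightarrow> f x = 0) \<and>
        continuous_map (top_of_set U) F f \<and>
        (\<forall>i. (\<forall>x\<in>U. \<forall>\<gamma>s\<in>topspace (one_param_power (Suc i)).
                \<exists>l. has_dir_deriv F (\<gamma>s i) (iter_deriv F f \<gamma>s i) x l) \<and>
             continuous_map (deriv_domain U (Suc i)) F (deriv_map U F (Suc i) f))}"

definition smooth_topology ::
    "'g::topological_group_add set \<Rightarrow> 'f::real_vector topology \<Rightarrow> ('g \<Rightarrow> 'f) topology"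
  where "smooth_topology U F =
    topology_generated_by
      {{f \<in> smooth_maps U F. deriv_map U F i f \<in> W} | i W.
        openin (compact_open_topology (deriv_domain U i) F) W}"

lemma topspace_compact_open_topology:
  "topspace (compact_open_topology X Y) = {f \<in> extensional (topspace X). continuous_map X Y f}"
  unfolding compact_open_topology_def topology_generated_by_topspace
  by (auto intro!: exI[of _ "{}"])

lemma continuous_deriv_map_0:
  assumes "continuous_map (top_of_set U) F f"
  shows "continuous_map (deriv_domain U 0) F (deriv_map U F 0 f)"
proof -
  have "continuous_map (deriv_domain U 0) F (f \<circ> fst)"
    unfolding deriv_domain_def using assms continuous_map_fst by (rule continuous_map_compose[rotated])
  then show ?thesis
    by (rule continuous_map_eq) (auto simp: deriv_map_def)
qed

lemma topspace_smooth_topology [simp]: "topspace (smooth_topology U F) = smooth_maps U F"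
proof -
  let ?T = "compact_open_topology (deriv_domain U 0) F"
  have "deriv_map U F 0 f \<in> topspace ?T" if "f \<in> smooth_maps U F" for f
    using that continuous_deriv_map_0[of U F f]
    by (auto simp: topspace_compact_open_topology deriv_map_def smooth_maps_def)
  then have "smooth_maps U F = {f \<in> smooth_maps U F. deriv_map U F 0 f \<in> topspace ?T}"
    by blast
  then have "smooth_maps U F \<in> {{f \<in> smooth_maps U F. deriv_map U F i f \<in> W} | i W.
        openin (compact_open_topology (deriv_domain U i) F) W}"
    using openin_topspace by blast
  then show ?thesis
    unfolding smooth_topology_def topology_generated_by_topspace by blast
qed

end

theory Submission
  imports Defs
begin

text \<open>
  Everything is reduced to estimates with continuous seminorms, which replace convex
  neighbourhoods and Hahn--Banach arguments; in particular no completeness is needed.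

  For smooth \<open>f\<close> on \<open>U \<times> V\<close>, the derivative \<open>D\<^bsub>\<eta>\<^esub>\<dots>D\<^bsub>\<gamma>\<^esub>\<dots>\<close> of \<open>f\<^sup>\<or>\<close>, taken first in \<open>U\<close> and then
  in \<open>V\<close>, is the iterated derivative of \<open>f\<close> in the directions \<open>(\<gamma>, 0)\<close> and then \<open>(0, \<eta>)\<close>. That the difference
  quotients of \<open>f\<^sup>\<or>\<close> converge in \<open>C\<^sup>\<infinity>(V, E)\<close>, i.e. uniformly on compact sets with all derivatives,
  follows from the mean value estimate, the tube lemma and Schwarz' theorem for the
  commuting subgroups \<open>(\<gamma>, 0)\<close> and \<open>(0, \<eta>)\<close>.

  Conversely, for smooth \<open>g : U \<rightarrow> C\<^sup>\<infinity>(V, E)\<close> the maps \<open>(x, y, \<gamma>, \<eta>) \<mapsto> d\<^sup>(\<^sup>j\<^sup>)(d\<^sup>(\<^sup>i\<^sup>)g(x, \<gamma>))(y, \<eta>)\<close> are continuous on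
  compact sets, hence continuous by the \<open>k\<^bsub>\<real>\<^esub>\<close>-hypothesis. As \<open>D\<^bsub>(\<gamma>,\<eta>)\<^esub> = D\<^bsub>(\<gamma>,0)\<^esub> + D\<^bsub>(0,\<eta>)\<^esub>\<close> whenever the
  partial derivatives are continuous, the derivatives of the uncurried map are finite sums of these
  maps. Both identities also bound the defining seminorms of each space by those of the other.
\<close>

section \<open>Continuous seminorms\<close>

text \<open>Since \<open>smooth_topology V E\<close> must itself be a coefficient space, the
  calculus is developed for a class of spaces closed under passing to smooth maps.
  \<open>seminorm_space\<close> is such a class, so every lemma on smooth maps applies to
  \<open>E\<close> and to \<open>smooth_topology V E\<close> alike. The obstacle in currying is the
  order of differentiation. The curried map is differentiated along \<open>G\<close> after its
  values may already have been differentiated along \<open>H\<close>, so the new direction comes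
  last. Smoothness on the product supplies the derivative in that order, and Schwarz' theorem brings
  it back to the normal form with \<open>G\<close> first. In uncurrying, the same rearrangement
  comes from the fact that evaluating a derivative at a point is continuous and linear on
  \<open>smooth_topology V E\<close>. As \<open>dir_deriv\<close> is a definite description,
  iterated derivatives are not computed: an explicit family is proposed and verified to be the
  family of derivatives. The k_R property speaks of real functions and is therefore applied to
  \<open>\<lambda>y. p (f y - f x)\<close>, one function for each point and seminorm.\<close>

definition seminorm_on :: "'a::real_vector set \<Rightarrow> ('a \<Rightarrow> real) \<Rightarrow> bool"
  where "seminorm_on S p \<longleftrightarrow>
    (\<forall>x\<in>S. \<forall>y\<in>S. p (x + y) \<le> p x + p y) \<and> (\<forall>r. \<forall>x\<in>S. p (r *\<^sub>R x) = \<bar>r\<bar> * p x)"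

text \<open>Open balls about all points, instead of continuity at \<open>0\<close>, so that continuity of the translations of
  \<open>F\<close> never has to be shown.\<close>

definition continuous_seminorm :: "'a::real_vector topology \<Rightarrow> ('a \<Rightarrow> real) \<Rightarrow> bool"
  where "continuous_seminorm F p \<longleftrightarrow>
    seminorm_on (topspace F) p \<and>
    (\<forall>x\<in>topspace F. \<forall>e>0. openin F {y \<in> topspace F. p (y - x) < e})"

text \<open>Unit balls of continuous seminorms form a neighbourhood base at every point (radius 1
  suffices, since seminorms can be rescaled), and the seminorms separate points. The last clause is
  the source of uniqueness of limits.\<close>

definition seminorm_space :: "'a::real_vector topology \<Rightarrow> bool"
  where "seminorm_space F \<longleftrightarrow>
    subspace (topspace F) \<and>
    (\<forall>T x. openin F T \<longrightarrow> x \<in> T \<longrightarrow>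
      (\<exists>p. continuous_seminorm F p \<and> {y \<in> topspace F. p (y - x) < 1} \<subseteq> T)) \<and>
    (\<forall>x\<in>topspace F. (\<forall>p. continuous_seminorm F p \<longrightarrow> p x = 0) \<longrightarrow> x = 0)"

lemma seminorm_space_subspace: "seminorm_space F \<Longrightarrow> subspace (topspace F)"
  by (simp add: seminorm_space_def)

lemma seminorm_space_nbhd:
  assumes "seminorm_space F" "openin F T" "x \<in> T"
  obtains p where "continuous_seminorm F p" "{y \<in> topspace F. p (y - x) < 1} \<subseteq> T"
  using that assms(1)[unfolded seminorm_space_def, THEN conjunct2, THEN conjunct1, rule_format, OF assms(2,3)]
  by blast

lemma seminorm_on_add: "seminorm_on S p \<Longrightarrow> x \<in> S \<Longrightarrow> y \<in> S \<Longrightarrow> p (x + y) \<le> p x + p y"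
  and seminorm_on_scaleR: "seminorm_on S p \<Longrightarrow> x \<in> S \<Longrightarrow> p (r *\<^sub>R x) = \<bar>r\<bar> * p x"
  by (auto simp: seminorm_on_def)

lemma seminorm_on_zero: "seminorm_on S p \<Longrightarrow> subspace S \<Longrightarrow> p 0 = 0"
  using seminorm_on_scaleR[of S p 0 0] by (simp add: subspace_0)

lemma seminorm_on_minus: "seminorm_on S p \<Longrightarrow> x \<in> S \<Longrightarrow> p (- x) = p x"
  using seminorm_on_scaleR[of S p x "-1"] by simp

lemma seminorm_on_nonneg:
  assumes "seminorm_on S p" "subspace S" "x \<in> S"
  shows "0 \<le> p x"
  using seminorm_on_add[of S p x "- x"] seminorm_on_zero[of S p] seminorm_on_minus[of S p x] assms
  by (simp add: subspace_neg)

lemma seminorm_on_diff: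
  assumes "seminorm_on S p" "subspace S" "x \<in> S" "y \<in> S"
  shows "p (x - y) \<le> p x + p y"
  using seminorm_on_add[of S p x "- y"] seminorm_on_minus[of S p y] assms
  by (simp add: subspace_neg)

lemma seminorm_on_commute:
  assumes "seminorm_on S p" "subspace S" "x \<in> S" "y \<in> S"
  shows "p (x - y) = p (y - x)"
  using seminorm_on_minus[of S p "x - y"] assms by (simp add: subspace_diff)

lemma seminorm_on_triangle:
  assumes "seminorm_on S p" "subspace S" "x \<in> S" "y \<in> S" "z \<in> S"
  shows "p (x - z) \<le> p (x - y) + p (y - z)"
  using seminorm_on_add[of S p "x - y" "y - z"] assms by (simp add: subspace_diff)

lemma continuous_seminorm_on: "continuous_seminorm F p \<Longrightarrow> seminorm_on (topspace F) p"
  by (simp add: continuous_seminorm_def)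

text \<open>Stated with a slack \<open>e\<close>, so that two candidates can be compared through a
  common approximation whose error is only known to be small.\<close>

lemma seminorm_space_eqI:
  assumes F: "seminorm_space F" and xy: "x \<in> topspace F" "y \<in> topspace F"
    and le: "\<And>p e. continuous_seminorm F p \<Longrightarrow> 0 < e \<Longrightarrow> p (x - y) \<le> e"
  shows "x = y"
proof -
  have d: "x - y \<in> topspace F" by (rule subspace_diff[OF seminorm_space_subspace[OF F] xy])
  have "p (x - y) = 0" if p: "continuous_seminorm F p" for p
  proof (rule antisym)
    show "p (x - y) \<le> 0"
      using le[OF p] by (rule field_le_epsilon[of _ 0, simplified])
    show "0 \<le> p (x - y)"
      by (rule seminorm_on_nonneg[OF continuous_seminorm_on[OF p] seminorm_space_subspace[OF F] d])
  qed
  then have "x - y = 0"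
    using F[unfolded seminorm_space_def, THEN conjunct2, THEN conjunct2, rule_format, OF d] by blast
  then show ?thesis by simp
qed

lemma openin_seminorm_ball:
  "continuous_seminorm F p \<Longrightarrow> x \<in> topspace F \<Longrightarrow> 0 < e \<Longrightarrow> openin F {y \<in> topspace F. p (y - x) < e}"
  by (simp add: continuous_seminorm_def)

lemma continuous_seminormI:
  assumes S: "subspace (topspace F)" and p: "seminorm_on (topspace F) p"
    and nb: "\<And>x e. x \<in> topspace F \<Longrightarrow> 0 < e \<Longrightarrow>
      \<exists>T. openin F T \<and> x \<in> T \<and> (\<forall>y\<in>T. p (y - x) < e)"
  shows "continuous_seminorm F p"
  unfolding continuous_seminorm_def
proof (intro conjI p ballI allI impI)
  fix x and e :: real assume x: "x \<in> topspace F" and "0 < e"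
  show "openin F {y \<in> topspace F. p (y - x) < e}"
  proof (subst openin_subopen, safe)
    fix y assume y: "y \<in> topspace F" "p (y - x) < e"
    \<comment> \<open>The radius \<open>e - p (y - x)\<close> is what the triangle inequality leaves
      for a ball about \<open>y\<close> inside the ball about \<open>x\<close>.\<close>
    then obtain T where T: "openin F T" "y \<in> T" "\<And>z. z \<in> T \<Longrightarrow> p (z - y) < e - p (y - x)"
      using nb[of y "e - p (y - x)"] by auto
    have "T \<subseteq> {z \<in> topspace F. p (z - x) < e}"
    proof
      fix z assume z: "z \<in> T"
      then have "z \<in> topspace F"
        using T(1) openin_subset by blast
      then show "z \<in> {z \<in> topspace F. p (z - x) < e}"
        using T(3)[OF z] seminorm_on_triangle[OF p S, of z y x] x y by force
    qed
    then show "\<exists>T. openin F T \<and> y \<in> T \<and> T \<subseteq> {z \<in> topspace F. p (z - x) < e}"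
      using T by blast
  qed
qed

lemma continuous_seminorm_zero: "continuous_seminorm F (\<lambda>_. 0)"
  by (auto simp: continuous_seminorm_def seminorm_on_def)

lemma continuous_seminorm_add:
  assumes S: "subspace (topspace F)" and p: "continuous_seminorm F p" and q: "continuous_seminorm F q"
  shows "continuous_seminorm F (\<lambda>x. p x + q x)"
proof (rule continuous_seminormI[OF S])
  show "seminorm_on (topspace F) (\<lambda>x. p x + q x)"
    using continuous_seminorm_on[OF p] continuous_seminorm_on[OF q]
    unfolding seminorm_on_def by (smt (verit) distrib_left)
next
  fix x and e :: real assume x: "x \<in> topspace F" "0 < e"
  let ?T = "{y \<in> topspace F. p (y - x) < e / 2} \<inter> {y \<in> topspace F. q (y - x) < e / 2}"
  have "openin F ?T"
    using x by (intro openin_Int openin_seminorm_ball p q) auto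
  moreover have "x \<in> ?T"
    using x seminorm_on_zero[OF continuous_seminorm_on[OF p] S]
      seminorm_on_zero[OF continuous_seminorm_on[OF q] S] by simp
  moreover have "\<forall>y\<in>?T. p (y - x) + q (y - x) < e"
    by auto
  ultimately show "\<exists>T. openin F T \<and> x \<in> T \<and> (\<forall>y\<in>T. p (y - x) + q (y - x) < e)"
    by blast
qed

lemma continuous_seminorm_scale:
  assumes S: "subspace (topspace F)" and p: "continuous_seminorm F p" and c: "0 < c"
  shows "continuous_seminorm F (\<lambda>x. c * p x)"
proof (rule continuous_seminormI[OF S])
  show "seminorm_on (topspace F) (\<lambda>x. c * p x)"
    using continuous_seminorm_on[OF p] c unfolding seminorm_on_def
    by (metis distrib_left mult.left_commute mult_le_cancel_left_pos)
next
  fix x and e :: real assume x: "x \<in> topspace F" "0 < e"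
  let ?T = "{y \<in> topspace F. p (y - x) < e / c}"
  have "openin F ?T"
    using x c by (intro openin_seminorm_ball p) auto
  moreover have "x \<in> ?T"
    using x c seminorm_on_zero[OF continuous_seminorm_on[OF p] S] by auto
  ultimately show "\<exists>T. openin F T \<and> x \<in> T \<and> (\<forall>y\<in>T. c * p (y - x) < e)"
    using c by (intro exI[of _ ?T]) (auto simp: field_simps)
qed

lemma continuous_seminorm_sum:
  assumes "subspace (topspace F)" "finite I" "\<And>i. i \<in> I \<Longrightarrow> continuous_seminorm F (p i)"
  shows "continuous_seminorm F (\<lambda>x. \<Sum>i\<in>I. p i x)"
  using assms(2,3)
  by (induction I rule: finite_induct)
    (auto intro: continuous_seminorm_zero continuous_seminorm_add[OF assms(1)])

section \<open>Convergence and continuity in terms of seminorms\<close>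

lemma limitin_seminorm:
  assumes F: "seminorm_space F"
  shows "limitin F h l net \<longleftrightarrow>
    l \<in> topspace F \<and> eventually (\<lambda>t. h t \<in> topspace F) net \<and>
    (\<forall>p e. continuous_seminorm F p \<longrightarrow> 0 < e \<longrightarrow> eventually (\<lambda>t. p (h t - l) < e) net)"
    (is "?L \<longleftrightarrow> ?R")
proof
  assume L: ?L
  then have l: "l \<in> topspace F" by (simp add: limitin_def)
  have "eventually (\<lambda>t. p (h t - l) < e) net" if "continuous_seminorm F p" "0 < e" for p e
  proof -
    have "l \<in> {y \<in> topspace F. p (y - l) < e}"
      using that l seminorm_on_zero[OF continuous_seminorm_on[OF that(1)] seminorm_space_subspace[OF F]]
      by simp
    from limitinD[OF L openin_seminorm_ball[OF that(1) l that(2)] this] show ?thesis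
      by (rule eventually_mono) simp
  qed
  then show ?R
    using l limitinD[OF L openin_topspace] by blast
next
  assume R: ?R
  show ?L
    unfolding limitin_def
  proof (intro conjI allI impI)
    show "l \<in> topspace F" using R by blast
    fix T assume "openin F T \<and> l \<in> T"
    then obtain p where p: "continuous_seminorm F p" "{y \<in> topspace F. p (y - l) < 1} \<subseteq> T"
      using seminorm_space_nbhd[OF F] by metis
    have "eventually (\<lambda>t. h t \<in> topspace F \<and> p (h t - l) < 1) net"
      using R p(1) by (simp add: eventually_conj)
    then show "eventually (\<lambda>t. h t \<in> T) net"
      by (rule eventually_mono) (use p in auto)
  qed
qed

lemma limitin_seminormD:
  assumes F: "seminorm_space F" and "limitin F f l net" "continuous_seminorm F p" "0 < e"
  shows "eventually (\<lambda>t. f t \<in> topspace F \<and> p (f t - l) < e) net"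
  using assms(2-) unfolding limitin_seminorm[OF F] by (intro eventually_conj) blast+

lemma continuous_map_seminorm:
  assumes F: "seminorm_space F"
  shows "continuous_map X F f \<longleftrightarrow>
    f \<in> topspace X \<rightarrow> topspace F \<and>
    (\<forall>x\<in>topspace X. \<forall>p e. continuous_seminorm F p \<longrightarrow> 0 < e \<longrightarrow>
      (\<exists>N. openin X N \<and> x \<in> N \<and> (\<forall>y\<in>N. p (f y - f x) < e)))"
    (is "?L \<longleftrightarrow> ?R")
proof
  assume L: ?L
  then have f: "f \<in> topspace X \<rightarrow> topspace F"
    by (rule continuous_map_funspace)
  have "\<exists>N. openin X N \<and> x \<in> N \<and> (\<forall>y\<in>N. p (f y - f x) < e)"
    if "x \<in> topspace X" "continuous_seminorm F p" "0 < e" for x p e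
  proof -
    have "f x \<in> topspace F" using f that by auto
    then have "openin X {z \<in> topspace X. f z \<in> {y \<in> topspace F. p (y - f x) < e}}"
      by (intro openin_continuous_map_preimage[OF L] openin_seminorm_ball that)
    then show ?thesis
      using that \<open>f x \<in> topspace F\<close>
        seminorm_on_zero[OF continuous_seminorm_on[OF that(2)] seminorm_space_subspace[OF F]]
      by (intro exI[of _ "{z \<in> topspace X. f z \<in> {y \<in> topspace F. p (y - f x) < e}}"]) auto
  qed
  then show ?R using f by blast
next
  assume R: ?R
  show ?L
    unfolding continuous_map_alt
  proof (intro conjI allI impI)
    show "f \<in> topspace X \<rightarrow> topspace F" using R by blast
    fix T assume T: "openin F T"
    show "openin X (f -` T \<inter> topspace X)"
    proof (subst openin_subopen, safe)
      fix x assume x: "f x \<in> T" "x \<in> topspace X"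
      obtain p where p: "continuous_seminorm F p" "{y \<in> topspace F. p (y - f x) < 1} \<subseteq> T"
        using seminorm_space_nbhd[OF F T x(1)] .
      obtain N where N: "openin X N" "x \<in> N" "\<And>y. y \<in> N \<Longrightarrow> p (f y - f x) < 1"
        using R p(1) x(2) by (meson zero_less_one)
      have "N \<subseteq> f -` T \<inter> topspace X"
      proof
        fix y assume y: "y \<in> N"
        then have "y \<in> topspace X" using openin_subset[OF N(1)] by blast
        then show "y \<in> f -` T \<inter> topspace X"
          using N(3)[OF y] p(2) R by auto
      qed
      then show "\<exists>N. openin X N \<and> x \<in> N \<and> N \<subseteq> f -` T \<inter> topspace X"
        using N by blast
    qed
  qed
qed

lemma limitin_add_seminorm:
  assumes F: "seminorm_space F" and f: "limitin F f l net" and g: "limitin F g m net"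
  shows "limitin F (\<lambda>t. f t + g t) (l + m) net"
proof -
  note S = seminorm_space_subspace[OF F]
  have l: "l \<in> topspace F" "m \<in> topspace F"
    and ev: "eventually (\<lambda>t. f t \<in> topspace F \<and> g t \<in> topspace F) net"
    using f g by (auto simp: limitin_seminorm[OF F] eventually_conj)
  have "eventually (\<lambda>t. p (f t + g t - (l + m)) < e) net" if p: "continuous_seminorm F p" "0 < e" for p e
  proof -
    have "eventually (\<lambda>t. (f t \<in> topspace F \<and> g t \<in> topspace F) \<and> p (f t - l) < e/2 \<and> p (g t - m) < e/2) net"
      using limitin_seminormD[OF F f p(1) half_gt_zero[OF p(2)]]
        limitin_seminormD[OF F g p(1) half_gt_zero[OF p(2)]]
      by eventually_elim simp
    then show ?thesis
    proof (rule eventually_mono)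
      fix t assume t: "(f t \<in> topspace F \<and> g t \<in> topspace F) \<and> p (f t - l) < e/2 \<and> p (g t - m) < e/2"
      have "p ((f t - l) + (g t - m)) \<le> p (f t - l) + p (g t - m)"
        using t l by (intro seminorm_on_add[OF continuous_seminorm_on[OF p(1)]] subspace_diff[OF S]) auto
      moreover have eq: "f t + g t - (l + m) = (f t - l) + (g t - m)" by simp
      ultimately show "p (f t + g t - (l + m)) < e"
        unfolding eq using t by linarith
    qed
  qed
  moreover have "eventually (\<lambda>t. f t + g t \<in> topspace F) net"
    using ev by (rule eventually_mono) (simp add: subspace_add[OF S])
  ultimately show ?thesis
    using l by (simp add: limitin_seminorm[OF F] subspace_add[OF S])
qed

lemma limitin_scaleR_seminorm:
  assumes F: "seminorm_space F" and f: "limitin F f l net"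
  shows "limitin F (\<lambda>t. c *\<^sub>R f t) (c *\<^sub>R l) net"
proof (cases "c = 0")
  case True
  then show ?thesis
    using subspace_0[OF seminorm_space_subspace[OF F]] by (simp add: limitin_const_iff)
next
  case False
  note S = seminorm_space_subspace[OF F]
  have l: "l \<in> topspace F" and ev: "eventually (\<lambda>t. f t \<in> topspace F) net"
    using f by (auto simp: limitin_seminorm[OF F])
  have "eventually (\<lambda>t. p (c *\<^sub>R f t - c *\<^sub>R l) < e) net" if p: "continuous_seminorm F p" "0 < e" for p e
  proof -
    have "0 < e / \<bar>c\<bar>" using p(2) False by simp
    then have "eventually (\<lambda>t. f t \<in> topspace F \<and> p (f t - l) < e / \<bar>c\<bar>) net"
      using f p(1) ev by (intro eventually_conj) (auto simp: limitin_seminorm[OF F])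
    then show ?thesis
    proof (rule eventually_mono)
      fix t assume t: "f t \<in> topspace F \<and> p (f t - l) < e / \<bar>c\<bar>"
      have "p (c *\<^sub>R (f t - l)) = \<bar>c\<bar> * p (f t - l)"
        using t l by (intro seminorm_on_scaleR[OF continuous_seminorm_on[OF p(1)]] subspace_diff[OF S]) auto
      then show "p (c *\<^sub>R f t - c *\<^sub>R l) < e"
        using t False by (simp add: field_simps scaleR_diff_right)
    qed
  qed
  moreover have "eventually (\<lambda>t. c *\<^sub>R f t \<in> topspace F) net"
    using ev by (rule eventually_mono) (simp add: subspace_scale[OF S])
  ultimately show ?thesis
    using l by (simp add: limitin_seminorm[OF F] subspace_scale[OF S])
qed

lemma limitin_unique_seminorm:
  assumes F: "seminorm_space F" and l: "limitin F f l net" and m: "limitin F f m net" and "net \<noteq> bot"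
  shows "l = m"
proof (rule seminorm_space_eqI[OF F])
  note S = seminorm_space_subspace[OF F]
  show lm: "l \<in> topspace F" "m \<in> topspace F"
    using l m by (auto simp: limitin_def)
  fix p and e :: real assume p: "continuous_seminorm F p" and e: "0 < e"
  have "eventually (\<lambda>t. f t \<in> topspace F \<and> p (f t - l) < e/2 \<and> p (f t - m) < e/2) net"
    using limitin_seminormD[OF F l p half_gt_zero[OF e]] limitin_seminormD[OF F m p half_gt_zero[OF e]]
    by eventually_elim simp
  then obtain t where t: "f t \<in> topspace F" "p (f t - l) < e/2" "p (f t - m) < e/2"
    using \<open>net \<noteq> bot\<close> eventually_happens' by blast
  then show "p (l - m) \<le> e"
    using seminorm_on_triangle[OF continuous_seminorm_on[OF p] S, of l "f t" m] lm
      seminorm_on_commute[OF continuous_seminorm_on[OF p] S, of l "f t"] by auto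
qed

lemma continuous_map_add_seminorm:
  assumes F: "seminorm_space F" and f: "continuous_map X F f" and g: "continuous_map X F g"
  shows "continuous_map X F (\<lambda>x. f x + g x)"
  using f g unfolding continuous_map_atin
  by (auto intro: limitin_add_seminorm[OF F])

lemma continuous_map_scaleR_seminorm:
  assumes F: "seminorm_space F" and f: "continuous_map X F f"
  shows "continuous_map X F (\<lambda>x. c *\<^sub>R f x)"
  using f unfolding continuous_map_atin
  by (auto intro: limitin_scaleR_seminorm[OF F])

lemma continuous_map_sum_list_seminorm:
  assumes F: "seminorm_space F" and "\<And>w. w \<in> set ws \<Longrightarrow> continuous_map X F (f w)"
  shows "continuous_map X F (\<lambda>x. \<Sum>w\<leftarrow>ws. f w x)"
  using assms(2)
proof (induction ws)
  case Nil
  then show ?case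
    using subspace_0[OF seminorm_space_subspace[OF F]] by simp
next
  case (Cons w ws)
  then show ?case
    using continuous_map_add_seminorm[OF F, of X "f w" "\<lambda>x. \<Sum>w\<leftarrow>ws. f w x"] by simp
qed

lemma seminorm_on_sum_list:
  assumes "seminorm_on S p" "subspace S" "\<And>w. w \<in> set ws \<Longrightarrow> f w \<in> S"
  shows "(\<Sum>w\<leftarrow>ws. f w) \<in> S \<and> p (\<Sum>w\<leftarrow>ws. f w) \<le> (\<Sum>w\<leftarrow>ws. p (f w))"
  using assms(3)
proof (induction ws)
  case Nil
  then show ?case
    using assms(1,2) by (simp add: subspace_0 seminorm_on_zero)
next
  case (Cons w ws)
  then show ?case
    using seminorm_on_add[OF assms(1), of "f w" "\<Sum>w\<leftarrow>ws. f w"]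
      subspace_add[OF assms(2), of "f w" "\<Sum>w\<leftarrow>ws. f w"] by simp
qed

section \<open>Locally convex spaces\<close>

lemma locally_convex_space_subspace: "locally_convex_space E \<Longrightarrow> subspace (topspace E)"
  by (simp add: locally_convex_space_def)

lemma continuous_map_affine_lcs:
  assumes E: "locally_convex_space E" and b: "b \<in> topspace E"
  shows "continuous_map E E (\<lambda>y. c *\<^sub>R y + b)"
proof -
  have sc: "continuous_map (prod_topology euclideanreal E) E (\<lambda>(r, x). r *\<^sub>R x)"
    and ad: "continuous_map (prod_topology E E) E (\<lambda>(x, y). x + y)"
    using E by (auto simp: locally_convex_space_def)
  have "continuous_map E E ((\<lambda>(r, x). r *\<^sub>R x) \<circ> (\<lambda>y. (c, y)))"
    by (rule continuous_map_compose[OF _ sc]) (simp add: continuous_map_paired)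
  then have "continuous_map E E (\<lambda>y. c *\<^sub>R y)"
    by (simp add: o_def)
  then have "continuous_map E E ((\<lambda>(x, y). x + y) \<circ> (\<lambda>y. (c *\<^sub>R y, b)))"
    by (intro continuous_map_compose[OF _ ad]) (simp add: continuous_map_paired b)
  then show ?thesis
    by (simp add: o_def)
qed

lemma continuous_map_scaleR_right_lcs:
  assumes E: "locally_convex_space E" and x: "x \<in> topspace E"
  shows "continuous_map euclideanreal E (\<lambda>r. r *\<^sub>R x)"
proof -
  have sc: "continuous_map (prod_topology euclideanreal E) E (\<lambda>(r, x). r *\<^sub>R x)"
    using E by (auto simp: locally_convex_space_def)
  have "continuous_map euclideanreal E ((\<lambda>(r, x). r *\<^sub>R x) \<circ> (\<lambda>r. (r, x)))"
    by (rule continuous_map_compose[OF _ sc]) (simp add: continuous_map_paired x)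
  then show ?thesis
    by (simp add: o_def)
qed

text \<open>\<open>p\<close> is the gauge of \<open>B\<close>. The open set \<open>N\<close> makes
  \<open>B\<close> absorbing and \<open>p\<close> continuous, convexity gives subadditivity, and
  symmetry gives homogeneity for negative scalars. Only the inclusion of \<open>{p < 1}\<close> in
  \<open>B\<close> is claimed, so \<open>B\<close> may be any symmetric convex neighbourhood of
  \<open>0\<close>, open or not.\<close>

lemma Minkowski_functional:
  assumes E: "locally_convex_space E" and N: "openin E N" "0 \<in> N" "N \<subseteq> B"
    and B: "convex B" "\<And>x. x \<in> B \<Longrightarrow> - x \<in> B"
  obtains p where "continuous_seminorm E p" "\<And>x. x \<in> topspace E \<Longrightarrow> p x < 1 \<Longrightarrow> x \<in> B"
proof -
  note S = locally_convex_space_subspace[OF E]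
  define A where "A x = {r. 0 < r \<and> (1 / r) *\<^sub>R x \<in> B}" for x
  define p where "p x = Inf (A x)" for x
  have B0: "0 \<in> B" using N by blast
  have ne: "A x \<noteq> {}" if x: "x \<in> topspace E" for x
  proof -
    have "open {r \<in> UNIV. r *\<^sub>R x \<in> N}"
      using openin_continuous_map_preimage[OF continuous_map_scaleR_right_lcs[OF E x] N(1)] by simp
    then obtain e where e: "e > 0" "ball 0 e \<subseteq> {r \<in> UNIV. r *\<^sub>R x \<in> N}"
      using N(2) by (elim openE[of _ 0]) auto
    have "e / 2 \<in> ball 0 e" using e(1) by simp
    then have "(e / 2) *\<^sub>R x \<in> N" using e(2) by blast
    then have "2 / e \<in> A x" using e(1) N(3) by (auto simp: A_def)
    then show ?thesis by blast
  qed
  have bdd: "bdd_below (A x)" for x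
    by (rule bdd_belowI[of _ 0]) (simp add: A_def)
  have up: "s \<in> A x" if "r \<in> A x" "r \<le> s" for r s x
  proof -
    have rs: "0 < r" "0 < s" "(1 / r) *\<^sub>R x \<in> B" using that by (auto simp: A_def)
    \<comment> \<open>\<open>x / s\<close> is a convex combination of \<open>x / r\<close> and
      \<open>0\<close>.\<close>
    have "(r / s) *\<^sub>R ((1 / r) *\<^sub>R x) + (1 - r / s) *\<^sub>R 0 \<in> B"
      using rs that by (intro convexD[OF B(1)] B0) auto
    then show ?thesis using rs by (simp add: A_def)
  qed
  have less: "s \<in> A x" if "x \<in> topspace E" "p x < s" for x s
    using cInf_lessD[OF ne[OF that(1)]] that(2) up unfolding p_def by (meson less_imp_le)
  have le: "p x \<le> s" if "s \<in> A x" for x s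
    unfolding p_def by (rule cInf_lower[OF that bdd])
  have nonneg: "0 \<le> p x" if "x \<in> topspace E" for x
    unfolding p_def using ne[OF that] by (rule cInf_greatest) (simp add: A_def)
  have sub: "p (x + y) \<le> p x + p y" if x: "x \<in> topspace E" and y: "y \<in> topspace E" for x y
  proof (rule field_le_epsilon)
    fix e :: real assume e: "0 < e"
    define r s where "r = p x + e / 2" and "s = p y + e / 2"
    have rs: "r \<in> A x" "s \<in> A y"
      using less[OF x, of r] less[OF y, of s] e by (auto simp: r_def s_def)
    then have pos: "0 < r" "0 < s" by (auto simp: A_def)
    \<comment> \<open>\<open>(x + y) / (r + s)\<close> is a convex combination of
      \<open>x / r\<close> and \<open>y / s\<close>.\<close>
    have "(r / (r + s)) *\<^sub>R ((1 / r) *\<^sub>R x) + (s / (r + s)) *\<^sub>R ((1 / s) *\<^sub>R y) \<in> B"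
      using rs pos by (intro convexD[OF B(1)]) (auto simp: A_def add_divide_distrib[symmetric])
    then have "r + s \<in> A (x + y)"
      using pos by (simp add: A_def scaleR_add_right)
    then show "p (x + y) \<le> p x + p y + e"
      using le[of "r + s" "x + y"] by (simp add: r_def s_def)
  qed
  have pos_le: "p (c *\<^sub>R x) \<le> c * p x" if c: "0 < c" and x: "x \<in> topspace E" for c x
  proof (rule field_le_epsilon)
    fix e :: real assume e: "0 < e"
    have "p x + e / c \<in> A x" using less[OF x, of "p x + e / c"] c e by simp
    then have "c * (p x + e / c) \<in> A (c *\<^sub>R x)"
      using c by (simp add: A_def)
    then show "p (c *\<^sub>R x) \<le> c * p x + e"
      using le[of "c * (p x + e / c)" "c *\<^sub>R x"] c by (simp add: distrib_left)
  qed
  have pos_eq: "p (c *\<^sub>R x) = c * p x" if c: "0 < c" and x: "x \<in> topspace E" for c x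
  proof -
    have "p ((1 / c) *\<^sub>R (c *\<^sub>R x)) \<le> (1 / c) * p (c *\<^sub>R x)"
      using c x by (intro pos_le subspace_scale[OF S]) auto
    then have "c * p x \<le> p (c *\<^sub>R x)"
      using c by (simp add: field_simps)
    with pos_le[OF that] show ?thesis by simp
  qed
  have "(1 / r) *\<^sub>R (- x) \<in> B \<longleftrightarrow> (1 / r) *\<^sub>R x \<in> B" for r x
    using B(2)[of "(1 / r) *\<^sub>R x"] B(2)[of "(1 / r) *\<^sub>R (- x)"] by auto
  then have neg: "p (- x) = p x" for x
    unfolding p_def A_def by presburger
  have zero: "p 0 = 0"
  proof -
    have "A 0 = {0<..}" using B0 by (auto simp: A_def)
    then show ?thesis by (simp add: p_def)
  qed
  have scale: "p (c *\<^sub>R x) = \<bar>c\<bar> * p x" if x: "x \<in> topspace E" for c x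
    using pos_eq[OF _ x, of c] pos_eq[OF _ x, of "- c"] neg[of "c *\<^sub>R x"] zero
    by (cases "c = 0"; cases "0 < c") auto
  have "continuous_seminorm E p"
  proof (rule continuous_seminormI[OF S])
    show "seminorm_on (topspace E) p"
      using sub scale by (auto simp: seminorm_on_def)
  next
    fix x and e :: real assume x: "x \<in> topspace E" and e: "0 < e"
    \<comment> \<open>On this set \<open>(2 / e) *\<^sub>R (y - x)\<close> lies in \<open>B\<close>,
      so the gauge of \<open>y - x\<close> is at most \<open>e / 2\<close>. Halving makes the final
      inequality strict.\<close>
    let ?T = "{y \<in> topspace E. (2 / e) *\<^sub>R y + (- (2 / e)) *\<^sub>R x \<in> N}"
    have "openin E ?T"
      by (intro openin_continuous_map_preimage[OF continuous_map_affine_lcs[OF E] N(1)] subspace_scale[OF S] x)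
    moreover have "x \<in> ?T" using x N(2) by simp
    moreover have "p (y - x) < e" if "y \<in> ?T" for y
    proof -
      have "(2 / e) *\<^sub>R (y - x) \<in> N"
        using that by (simp add: scaleR_diff_right)
      then have "e / 2 \<in> A (y - x)" using N(3) e by (auto simp: A_def)
      then show ?thesis using le[of "e / 2" "y - x"] e by linarith
    qed
    ultimately show "\<exists>T. openin E T \<and> x \<in> T \<and> (\<forall>y\<in>T. p (y - x) < e)"
      by blast
  qed
  moreover have "x \<in> B" if "x \<in> topspace E" "p x < 1" for x
    using less[OF that] by (simp add: A_def)
  ultimately show thesis by (rule that)
qed

lemma locally_convex_imp_seminorm_space:
  assumes E: "locally_convex_space E"
  shows "seminorm_space E"
proof -
  note S = locally_convex_space_subspace[OF E]
  have nb: "\<exists>p. continuous_seminorm E p \<and> {y \<in> topspace E. p (y - x) < 1} \<subseteq> T"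
    if T: "openin E T" and xT: "x \<in> T" for T x
  proof -
    have x: "x \<in> topspace E" using openin_subset[OF T] xT by blast
    \<comment> \<open>The translate of \<open>T\<close> by \<open>- x\<close>, a neighbourhood of
      \<open>0\<close>. The factor 1 fits the shape of
      \<open>continuous_map_affine_lcs\<close>.\<close>
    let ?W = "{y \<in> topspace E. 1 *\<^sub>R y + x \<in> T}"
    have "openin E ?W"
      by (rule openin_continuous_map_preimage[OF continuous_map_affine_lcs[OF E x] T])
    moreover have "0 \<in> ?W"
      using xT subspace_0[OF S] by simp
    ultimately have W: "openin E ?W \<and> 0 \<in> ?W" by blast
    have "neighbourhood_base_of convex E"
      using E by (simp add: locally_convex_space_def)
    then obtain N C where N: "openin E N" "convex C" "0 \<in> N" "N \<subseteq> C" "C \<subseteq> ?W"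
      using W unfolding neighbourhood_base_of by (metis (no_types, lifting))
    \<comment> \<open>\<open>C\<close> is convex but perhaps not symmetric. Its intersection with
      \<open>- C\<close> is both, and contains the open set of all points \<open>y\<close> with
      \<open>y\<close> and \<open>- y\<close> in \<open>N\<close>.\<close>
    let ?N = "N \<inter> {y \<in> topspace E. (- 1) *\<^sub>R y + 0 \<in> N}" and ?B = "C \<inter> uminus -` C"
    have 1: "openin E ?N"
      by (intro openin_Int N(1) openin_continuous_map_preimage[OF continuous_map_affine_lcs[OF E]] subspace_0[OF S])
    have 2: "0 \<in> ?N" "?N \<subseteq> ?B"
      using N subspace_0[OF S] by auto
    have "convex (uminus -` C)"
      by (rule convex_linear_vimage[OF _ N(2)]) (simp add: linear_iff)
    then have 3: "convex ?B"
      using N(2) by (intro convex_Int)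
    obtain p where p: "continuous_seminorm E p" "\<And>x. x \<in> topspace E \<Longrightarrow> p x < 1 \<Longrightarrow> x \<in> ?B"
    proof (rule Minkowski_functional[OF E 1 2 3])
      show "- x \<in> ?B" if "x \<in> ?B" for x using that by simp
    qed (rule that)
    have "{y \<in> topspace E. p (y - x) < 1} \<subseteq> T"
    proof safe
      fix y assume y: "y \<in> topspace E" "p (y - x) < 1"
      then have "y - x \<in> ?B" using x by (intro p(2) subspace_diff[OF S])
      then show "y \<in> T" using N(5) by auto
    qed
    with p(1) show ?thesis by blast
  qed
  have "x = 0" if x: "x \<in> topspace E" and z: "\<And>p. continuous_seminorm E p \<Longrightarrow> p x = 0" for x
  proof (rule ccontr)
    assume "x \<noteq> 0"
    moreover have "Hausdorff_space E" using E by (simp add: locally_convex_space_def)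
    ultimately obtain T where T: "openin E T" "0 \<in> T" "x \<notin> T"
      using x subspace_0[OF S] unfolding Hausdorff_space_def disjnt_def by (metis disjoint_iff)
    obtain p where p: "continuous_seminorm E p" "{y \<in> topspace E. p (y - 0) < 1} \<subseteq> T"
      using nb[OF T(1,2)] by blast
    then show False using z[OF p(1)] x T(3) by auto
  qed
  then show ?thesis
    unfolding seminorm_space_def by (intro conjI S allI impI ballI nb) auto
qed

section \<open>The compact-open topology for seminormed targets\<close>

lemma openin_seminorm_less:
  assumes F: "seminorm_space F" and p: "continuous_seminorm F p"
    and f: "continuous_map X F f" and g: "continuous_map X F g" and e: "0 < e"
  shows "openin X {z \<in> topspace X. p (f z - g z) < e}"
proof -
  note S = seminorm_space_subspace[OF F]
  have c: "continuous_map X F (\<lambda>z. f z + (- 1) *\<^sub>R g z)"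
    by (intro continuous_map_add_seminorm[OF F] continuous_map_scaleR_seminorm[OF F] f g)
  have "openin X {z \<in> topspace X. f z + (- 1) *\<^sub>R g z \<in> {y \<in> topspace F. p (y - 0) < e}}"
    by (rule openin_continuous_map_preimage[OF c openin_seminorm_ball[OF p subspace_0[OF S] e]])
  also have "{z \<in> topspace X. f z + (- 1) *\<^sub>R g z \<in> {y \<in> topspace F. p (y - 0) < e}} =
      {z \<in> topspace X. p (f z - g z) < e}"
    using continuous_map_funspace[OF f] continuous_map_funspace[OF g] by (auto intro: subspace_diff[OF S])
  finally show ?thesis .
qed

text \<open>By the reverse triangle inequality. It turns statements about maps into \<open>F\<close>
  into statements about real functions, as needed for closed preimages, for bounds on compact sets
  and for the k_R property.\<close>

lemma continuous_map_seminorm_diff: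
  assumes F: "seminorm_space F" and p: "continuous_seminorm F p" and v: "v \<in> topspace F"
  shows "continuous_map F euclideanreal (\<lambda>y. p (y - v))"
proof -
  note S = seminorm_space_subspace[OF F] and s = continuous_seminorm_on[OF p]
  have "continuous_map F Met_TC.mtopology (\<lambda>y. p (y - v))"
    unfolding Met_TC.continuous_map_to_metric
  proof (intro ballI allI impI)
    fix y and d :: real assume y: "y \<in> topspace F" and d: "0 < d"
    have "p (z - v) \<in> Met_TC.mball (p (y - v)) d" if z: "z \<in> {z \<in> topspace F. p (z - y) < d}" for z
    proof -
      have "p (z - v) \<le> p (z - y) + p (y - v)" "p (y - v) \<le> p (y - z) + p (z - v)"
        "p (y - z) = p (z - y)"
        using y z v by (auto intro!: seminorm_on_triangle[OF s S] seminorm_on_commute[OF s S])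
      then show ?thesis
        using z by (auto simp: dist_real_def)
    qed
    then show "\<exists>U. openin F U \<and> y \<in> U \<and> (\<forall>z\<in>U. p (z - v) \<in> Met_TC.mball (p (y - v)) d)"
      using openin_seminorm_ball[OF p y d] y d seminorm_on_zero[OF s S]
      by (intro exI[of _ "{z \<in> topspace F. p (z - y) < d}"]) auto
  qed
  then show ?thesis by simp
qed

lemma compactin_finite_subcover:
  assumes K: "compactin X K" and N: "\<And>z. z \<in> K \<Longrightarrow> openin X (N z)" "\<And>z. z \<in> K \<Longrightarrow> z \<in> N z"
  obtains I where "finite I" "I \<subseteq> K" "K \<subseteq> \<Union>(N ` I)"
proof -
  obtain \<F> where \<F>: "finite \<F>" "\<F> \<subseteq> N ` K" "K \<subseteq> \<Union>\<F>"
    using compactinD[OF K, of "N ` K"] N by blast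
  then show thesis using finite_subset_image[OF \<F>(1,2)] that by blast
qed

text \<open>A Lebesgue number argument: each point of \<open>K\<close> has its own seminorm,
  finitely many of the corresponding neighbourhoods cover \<open>K\<close>, and the sum of their
  seminorms works for all points at once.\<close>

lemma compact_subset_open_seminorm:
  assumes F: "seminorm_space F" and f: "continuous_map X F f"
    and K: "compactin X K" and W: "openin F W" and fK: "f ` K \<subseteq> W"
  obtains p where "continuous_seminorm F p"
    "\<And>z y. z \<in> K \<Longrightarrow> y \<in> topspace F \<Longrightarrow> p (y - f z) < 1 \<Longrightarrow> y \<in> W"
proof -
  note S = seminorm_space_subspace[OF F]
  have KX: "K \<subseteq> topspace X" by (rule compactin_subset_topspace[OF K])
  have fX: "f z \<in> topspace F" if "z \<in> K" for z
    using continuous_map_funspace[OF f] KX that by blast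
  have "\<exists>p. continuous_seminorm F p \<and> {y \<in> topspace F. p (y - f z) < 1} \<subseteq> W" if "z \<in> K" for z
    using seminorm_space_nbhd[OF F W, of "f z"] fK that by (metis imageI subsetD)
  then obtain p where p: "\<And>z. z \<in> K \<Longrightarrow> continuous_seminorm F (p z)"
    and pW: "\<And>z. z \<in> K \<Longrightarrow> {y \<in> topspace F. p z (y - f z) < 1} \<subseteq> W"
    by metis
  define N where "N z = {z' \<in> topspace X. p z (f z' - f z) < 1 / 2}" for z
  have N: "openin X (N z)" if "z \<in> K" for z
    unfolding N_def using fX[OF that]
    by (intro openin_seminorm_less[OF F p[OF that] f]) (auto simp: continuous_map_const)
  have zN: "z \<in> N z" if "z \<in> K" for z
    using KX that seminorm_on_zero[OF continuous_seminorm_on[OF p[OF that]] S] by (auto simp: N_def)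
  obtain I where I: "finite I" "I \<subseteq> K" "K \<subseteq> \<Union>(N ` I)"
    by (rule compactin_finite_subcover[OF K N zN])
  \<comment> \<open>The factor 2 matches the radius \<open>1 / 2\<close> in \<open>N\<close>: if
    \<open>q (y - f z) < 1\<close>, then \<open>y\<close> is within \<open>1 / 2\<close> of
    \<open>f z\<close>, which is within \<open>1 / 2\<close> of \<open>f i\<close>.\<close>
  define q where "q x = (\<Sum>z\<in>I. 2 * p z x)" for x
  have "continuous_seminorm F q"
    unfolding q_def using I p by (intro continuous_seminorm_sum[OF S] continuous_seminorm_scale[OF S]) auto
  moreover have "y \<in> W" if z: "z \<in> K" and y: "y \<in> topspace F" and less: "q (y - f z) < 1" for z y
  proof -
    obtain i where i: "i \<in> I" "z \<in> N i" using I(3) z by blast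
    then have iK: "i \<in> K" using I by blast
    note s = continuous_seminorm_on[OF p[OF iK]]
    have "2 * p i (y - f z) \<le> q (y - f z)"
      unfolding q_def
    proof (rule member_le_sum[OF i(1) _ I(1)])
      fix j assume "j \<in> I - {i}"
      then have "j \<in> K" using I(2) by blast
      then have "0 \<le> p j (y - f z)"
        by (intro seminorm_on_nonneg[OF continuous_seminorm_on[OF p] S] subspace_diff[OF S] y fX z)
      then show "0 \<le> 2 * p j (y - f z)" by simp
    qed
    moreover have "p i (f z - f i) < 1 / 2"
      using i(2) by (simp add: N_def)
    moreover have "p i (y - f i) \<le> p i (y - f z) + p i (f z - f i)"
      by (intro seminorm_on_triangle[OF s S] y fX z iK)
    ultimately have "p i (y - f i) < 1" using less by linarith
    then show ?thesis using pW[OF iK] y by blast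
  qed
  ultimately show thesis by (rule that)
qed

text \<open>Induction over the generation of \<open>T\<close>. In the uses \<open>P\<close> says
  that a set contains a neighbourhood of \<open>f\<close> of a prescribed form. Such properties are
  stable under intersections and supersets, so only the subbasic sets have to be inspected.\<close>

lemma topology_generated_by_nbhd:
  assumes T: "openin (topology_generated_by \<S>) T" and f: "f \<in> T"
    and basis: "\<And>s. s \<in> \<S> \<Longrightarrow> f \<in> s \<Longrightarrow> P s"
    and int: "\<And>a b. P a \<Longrightarrow> P b \<Longrightarrow> P (a \<inter> b)" and mono: "\<And>a b. P a \<Longrightarrow> a \<subseteq> b \<Longrightarrow> P b"
  shows "P T"
proof -
  have "f \<in> T \<longrightarrow> P T"
    using openin_topology_generated_by[OF T]
  proof (induction rule: generate_topology_on.induct)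
    case (UN \<K>)
    then show ?case using mono by (meson UnionE Union_upper)
  qed (auto intro: basis int)
  then show ?thesis using f by simp
qed

text \<open>One half of the fact that the compact-open topology is that of uniform convergence on
  compact sets. An intersection of two neighbourhoods is handled by the union of the compact sets
  and the sum of the seminorms.\<close>

lemma openin_compact_open_seminorm:
  assumes F: "seminorm_space F" and T: "openin (compact_open_topology X F) T" and fT: "f \<in> T"
  obtains K p where "compactin X K" "continuous_seminorm F p"
    "\<And>g. g \<in> topspace (compact_open_topology X F) \<Longrightarrow> (\<And>z. z \<in> K \<Longrightarrow> p (g z - f z) < 1) \<Longrightarrow> g \<in> T"
proof -
  note S = seminorm_space_subspace[OF F]
  let ?P = "\<lambda>T. \<exists>K p. compactin X K \<and> continuous_seminorm F p \<and>
    (\<forall>g\<in>topspace (compact_open_topology X F). (\<forall>z\<in>K. p (g z - f z) < 1) \<longrightarrow> g \<in> T)"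
  have fC: "f \<in> topspace (compact_open_topology X F)"
    using openin_subset[OF T] fT by blast
  have X: "g \<in> topspace X \<rightarrow> topspace F" if "g \<in> topspace (compact_open_topology X F)" for g
    using that unfolding topspace_compact_open_topology by (auto dest: continuous_map_funspace)
  have "?P T"
  proof (rule topology_generated_by_nbhd[OF T[unfolded compact_open_topology_def] fT, where P = ?P])
    fix s assume "s \<in> {{f \<in> extensional (topspace X). continuous_map X F f \<and> f ` K \<subseteq> W} | K W.
        compactin X K \<and> openin F W}" and fs: "f \<in> s"
    then obtain K W where s: "s = {f \<in> extensional (topspace X). continuous_map X F f \<and> f ` K \<subseteq> W}"
      and K: "compactin X K" and W: "openin F W" by blast
    have cf: "continuous_map X F f" "f ` K \<subseteq> W" using fs unfolding s by blast+
    obtain p where p: "continuous_seminorm F p"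
      "\<And>z y. z \<in> K \<Longrightarrow> y \<in> topspace F \<Longrightarrow> p (y - f z) < 1 \<Longrightarrow> y \<in> W"
      using compact_subset_open_seminorm[OF F cf(1) K W cf(2)] by metis
    show "?P s"
    proof (intro exI conjI ballI impI)
      fix g assume g: "g \<in> topspace (compact_open_topology X F)" and less: "\<forall>z\<in>K. p (g z - f z) < 1"
      have "g ` K \<subseteq> W"
        using p(2) less X[OF g] compactin_subset_topspace[OF K] by blast
      then show "g \<in> s" using g unfolding s topspace_compact_open_topology by blast
    qed (use K p in auto)
  next
    fix a b assume "?P a" "?P b"
    then obtain K p L q where K: "compactin X K" "continuous_seminorm F p"
      "\<forall>g\<in>topspace (compact_open_topology X F). (\<forall>z\<in>K. p (g z - f z) < 1) \<longrightarrow> g \<in> a"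
      and L: "compactin X L" "continuous_seminorm F q"
      "\<forall>g\<in>topspace (compact_open_topology X F). (\<forall>z\<in>L. q (g z - f z) < 1) \<longrightarrow> g \<in> b"
      by metis
    show "?P (a \<inter> b)"
    proof (intro exI conjI ballI impI)
      show "compactin X (K \<union> L)" using K L by (simp add: compactin_Un)
      show "continuous_seminorm F (\<lambda>x. p x + q x)"
        using K L by (intro continuous_seminorm_add[OF S])
      fix g assume g: "g \<in> topspace (compact_open_topology X F)"
        and less: "\<forall>z\<in>K \<union> L. p (g z - f z) + q (g z - f z) < 1"
      have nn: "0 \<le> p (g z - f z) \<and> 0 \<le> q (g z - f z)" if "z \<in> K \<union> L" for z
      proof -
        have "z \<in> topspace X"
          using that K(1) L(1) compactin_subset_topspace by blast
        then have "g z - f z \<in> topspace F" using X[OF g] X[OF fC] by (intro subspace_diff[OF S]) auto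
        then show ?thesis
          by (simp add: seminorm_on_nonneg[OF continuous_seminorm_on[OF K(2)] S]
              seminorm_on_nonneg[OF continuous_seminorm_on[OF L(2)] S])
      qed
      have "\<forall>z\<in>K. p (g z - f z) < 1" "\<forall>z\<in>L. q (g z - f z) < 1"
        using less nn by (metis Un_iff add_increasing add_increasing2 le_less_trans order_refl)+
      then show "g \<in> a \<inter> b" using K(3) L(3) g by simp
    qed
  qed blast
  then show thesis using that by meson
qed

text \<open>The other half. A subbasic set only forces a whole compact set into one open set, so
  \<open>K\<close> is cut into finitely many compact pieces \<open>C z\<close> on which
  \<open>f\<close> deviates from \<open>f z\<close> by at most \<open>e / 3\<close>, and each piece
  is sent into a ball of radius \<open>e / 2\<close>. Together the errors stay below
  \<open>e\<close>. The pieces are defined by a weak inequality so as to be compact, the covering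
  sets \<open>N z\<close> by a strict one so as to be open.\<close>

lemma compact_open_nbhd_seminorm:
  assumes F: "seminorm_space F" and f: "f \<in> topspace (compact_open_topology X F)"
    and K: "compactin X K" and p: "continuous_seminorm F p" and e: "0 < e"
  obtains T where "openin (compact_open_topology X F) T" "f \<in> T"
    "\<And>g z. g \<in> T \<Longrightarrow> z \<in> K \<Longrightarrow> p (g z - f z) < e"
proof -
  note S = seminorm_space_subspace[OF F] and s = continuous_seminorm_on[OF p]
  have cf: "continuous_map X F f" and ext: "f \<in> extensional (topspace X)"
    using f by (auto simp: topspace_compact_open_topology)
  have KX: "K \<subseteq> topspace X" by (rule compactin_subset_topspace[OF K])
  have fX: "f z \<in> topspace F" if "z \<in> topspace X" for z
    using continuous_map_funspace[OF cf] that by blast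
  define N where "N z = {z' \<in> topspace X. p (f z' - f z) < e / 3}" for z
  define C where "C z = K \<inter> {z' \<in> topspace X. p (f z' - f z) \<le> e / 3}" for z
  define W where "W z = {y \<in> topspace F. p (y - f z) < e / 2}" for z
  define B where "B z = {g \<in> extensional (topspace X). continuous_map X F g \<and> g ` C z \<subseteq> W z}" for z
  have N: "openin X (N z)" if "z \<in> K" for z
    unfolding N_def using fX KX that e
    by (intro openin_seminorm_less[OF F p cf]) (auto simp: continuous_map_const)
  have zN: "z \<in> N z" if "z \<in> K" for z
    using KX that seminorm_on_zero[OF s S] e by (auto simp: N_def)
  have C: "compactin X (C z)" if z: "z \<in> K" for z
  proof -
    have "continuous_map X euclideanreal (\<lambda>z'. p (f z' - f z))"
      using continuous_map_compose[OF cf continuous_map_seminorm_diff[OF F p fX]] z KX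
      by (auto simp: o_def)
    from closedin_continuous_map_preimage[OF this, of "{..e / 3}"]
    have "closedin X {z' \<in> topspace X. p (f z' - f z) \<le> e / 3}" by simp
    then show ?thesis
      unfolding C_def by (rule compact_Int_closedin[OF K])
  qed
  have W: "openin F (W z)" if "z \<in> K" for z
    unfolding W_def using e fX KX that by (intro openin_seminorm_ball[OF p]) auto
  have B: "openin (compact_open_topology X F) (B z)" if "z \<in> K" for z
    unfolding compact_open_topology_def
    by (rule topology_generated_by_Basis) (use C[OF that] W[OF that] in \<open>auto simp: B_def\<close>)
  have fB: "f \<in> B z" if "z \<in> K" for z
    using cf ext fX e unfolding B_def W_def C_def by force
  obtain I where I: "finite I" "I \<subseteq> K" "K \<subseteq> \<Union>(N ` I)"
    by (rule compactin_finite_subcover[OF K N zN])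
  \<comment> \<open>If \<open>K\<close>, hence \<open>I\<close>, is empty, the intersection of the
    \<open>B i\<close> is the whole type. Intersecting with the carrier keeps \<open>T\<close> open
    in this case too.\<close>
  define T where "T = topspace (compact_open_topology X F) \<inter> \<Inter>(B ` I)"
  have "openin (compact_open_topology X F) T"
  proof (cases "I = {}")
    case True
    then show ?thesis by (simp add: T_def)
  next
    case False
    then have "openin (compact_open_topology X F) (\<Inter>(B ` I))"
      using I B by (intro openin_Inter) auto
    then show ?thesis unfolding T_def by blast
  qed
  moreover have "f \<in> T" using f fB I by (auto simp: T_def)
  moreover have "p (g z - f z) < e" if g: "g \<in> T" and z: "z \<in> K" for g z
  proof -
    obtain i where i: "i \<in> I" "z \<in> N i" using I(3) z by blast
    then have iK: "i \<in> K" using I by blast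
    have zC: "z \<in> C i" using i(2) z by (auto simp: N_def C_def)
    have "g \<in> B i" using g i by (auto simp: T_def)
    then have gz: "g z \<in> W i" using zC by (auto simp: B_def)
    have "p (g z - f z) \<le> p (g z - f i) + p (f i - f z)" "p (f i - f z) = p (f z - f i)"
      using gz fX KX z iK
      by (auto simp: W_def intro!: seminorm_on_triangle[OF s S] seminorm_on_commute[OF s S])
    moreover have "p (g z - f i) < e / 2" "p (f z - f i) \<le> e / 3"
      using gz zC by (auto simp: W_def C_def)
    ultimately show ?thesis using e by linarith
  qed
  ultimately show thesis by (rule that)
qed

text \<open>The points where \<open>h\<close> differs from its value over \<open>x\<close> by less
  than \<open>e\<close> form an open set containing \<open>{x} \<times> L\<close>, and the tube
  lemma puts a product neighbourhood inside it.\<close>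

lemma continuous_map_uniform_compact:
  assumes F: "seminorm_space F" and h: "continuous_map (prod_topology X Y) F h"
    and L: "compactin Y L" and x: "x \<in> topspace X" and p: "continuous_seminorm F p" and e: "0 < e"
  obtains N where "openin X N" "x \<in> N" "\<And>x' y. x' \<in> N \<Longrightarrow> y \<in> L \<Longrightarrow> p (h (x', y) - h (x, y)) < e"
proof -
  have "continuous_map (prod_topology X Y) F (h \<circ> (\<lambda>z. (x, snd z)))"
    by (rule continuous_map_compose[OF _ h])
      (simp add: continuous_map_paired x continuous_map_snd)
  then have h': "continuous_map (prod_topology X Y) F (\<lambda>z. h (x, snd z))"
    by (simp add: o_def)
  let ?W = "{z \<in> topspace (prod_topology X Y). p (h z - h (x, snd z)) < e}"
  have W: "openin (prod_topology X Y) ?W"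
    by (rule openin_seminorm_less[OF F p h h' e])
  have "{x} \<times> L \<subseteq> ?W"
    using x compactin_subset_topspace[OF L] e
      seminorm_on_zero[OF continuous_seminorm_on[OF p] seminorm_space_subspace[OF F]] by auto
  from tube_lemma_right[OF W L x this] obtain N V where
    N: "openin X N" "openin Y V" "x \<in> N" "L \<subseteq> V" "N \<times> V \<subseteq> ?W"
    by (elim exE conjE)
  show thesis
  proof (rule that[OF N(1,3)])
    fix x' y assume "x' \<in> N" "y \<in> L"
    then have "(x', y) \<in> ?W" using N(4,5) by blast
    then show "p (h (x', y) - h (x, y)) < e" by simp
  qed
qed

section \<open>Continuity on k_R-spaces\<close>

text \<open>For each \<open>x\<close> and each seminorm \<open>p\<close> the real function
  \<open>\<lambda>y. p (f y - f x)\<close> is continuous on compact sets, hence continuous. It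
  vanishes at \<open>x\<close>, which gives continuity of \<open>f\<close> at
  \<open>x\<close>.\<close>

lemma kR_space_continuous_map:
  assumes X: "kR_space X" and F: "seminorm_space F" and f: "f \<in> topspace X \<rightarrow> topspace F"
    and K: "\<And>K. compactin X K \<Longrightarrow> continuous_map (subtopology X K) F f"
  shows "continuous_map X F f"
  unfolding continuous_map_seminorm[OF F]
proof (intro conjI ballI allI impI f)
  fix x and p and e :: real assume x: "x \<in> topspace X" and p: "continuous_seminorm F p" and e: "0 < e"
  note S = seminorm_space_subspace[OF F] and s = continuous_seminorm_on[OF p]
  have fx: "f x \<in> topspace F" using f x by blast
  have "continuous_map (subtopology X K) euclideanreal (\<lambda>y. p (f y - f x))" if "compactin X K" for K
  proof -
    from continuous_map_compose[OF K[OF that] continuous_map_seminorm_diff[OF F p fx]] show ?thesis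
      by (simp add: o_def)
  qed
  then have "continuous_map X euclideanreal (\<lambda>y. p (f y - f x))"
    using X unfolding kR_space_def by blast
  from openin_continuous_map_preimage[OF this, of "{..<e}"]
  have "openin X {y \<in> topspace X. p (f y - f x) < e}" by simp
  moreover have "x \<in> {y \<in> topspace X. p (f y - f x) < e}"
    using x e seminorm_on_zero[OF s S] by simp
  ultimately show "\<exists>N. openin X N \<and> x \<in> N \<and> (\<forall>y\<in>N. p (f y - f x) < e)"
    by (intro exI[of _ "{y \<in> topspace X. p (f y - f x) < e}"]) simp
qed

text \<open>Evaluation of a continuous family of functions may fail to be jointly continuous, but it
  is so on a compact set \<open>K\<close>: the projection of \<open>K\<close> to \<open>Y\<close> is
  compact, \<open>unif\<close> controls the change of the function uniformly there, and
  \<open>h\<close> controls the change of the argument for the fixed function at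
  \<open>x\<close>.\<close>

lemma continuous_on_compact_evaluation:
  assumes F: "seminorm_space F"
    and h: "\<And>x. x \<in> topspace X \<Longrightarrow> continuous_map Y F (\<lambda>y. h (x, y))"
    and unif: "\<And>x L p e. x \<in> topspace X \<Longrightarrow> compactin Y L \<Longrightarrow> continuous_seminorm F p \<Longrightarrow> 0 < e \<Longrightarrow>
      \<exists>N. openin X N \<and> x \<in> N \<and> (\<forall>x'\<in>N. \<forall>y\<in>L. p (h (x', y) - h (x, y)) < e)"
    and K: "compactin (prod_topology X Y) K"
  shows "continuous_map (subtopology (prod_topology X Y) K) F h"
  unfolding continuous_map_seminorm[OF F]
proof (intro conjI ballI allI impI)
  show "h \<in> topspace (subtopology (prod_topology X Y) K) \<rightarrow> topspace F"
    using h by (auto dest: continuous_map_funspace)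
  fix z and p and e :: real
  assume z: "z \<in> topspace (subtopology (prod_topology X Y) K)" and p: "continuous_seminorm F p" and e: "0 < e"
  note S = seminorm_space_subspace[OF F] and s = continuous_seminorm_on[OF p]
  obtain x y where xy: "z = (x, y)" "x \<in> topspace X" "y \<in> topspace Y"
    using z by auto
  have L: "compactin Y (snd ` K)"
    by (rule image_compactin[OF K continuous_map_snd])
  obtain N where N: "openin X N" "x \<in> N" "\<forall>x'\<in>N. \<forall>y\<in>snd ` K. p (h (x', y) - h (x, y)) < e / 2"
    using unif[OF xy(2) L p, of "e / 2"] e by auto
  let ?M = "{y' \<in> topspace Y. p (h (x, y') - h (x, y)) < e / 2}"
  have hx: "h (x', y') \<in> topspace F" if "x' \<in> topspace X" "y' \<in> topspace Y" for x' y'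
    using continuous_map_funspace[OF h[OF that(1)]] that by blast
  have "openin Y ?M"
    using e by (intro openin_seminorm_less[OF F p h[OF xy(2)]])
      (auto simp: continuous_map_const hx xy)
  then have "openin (subtopology (prod_topology X Y) K) (K \<inter> N \<times> ?M)"
    using N by (intro openin_subtopology_Int2) (simp add: openin_prod_Times_iff)
  moreover have "z \<in> K \<inter> N \<times> ?M"
    using z xy N e seminorm_on_zero[OF s S] by auto
  moreover have "p (h w - h z) < e" if w: "w \<in> K \<inter> N \<times> ?M" for w
  proof -
    obtain x' y' where w': "w = (x', y')" "x' \<in> N" "y' \<in> ?M" "y' \<in> snd ` K"
      using w by force
    have x': "x' \<in> topspace X" using w' openin_subset[OF N(1)] by blast
    have "p (h (x', y') - h (x, y)) \<le> p (h (x', y') - h (x, y')) + p (h (x, y') - h (x, y))"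
      using x' w' xy by (intro seminorm_on_triangle[OF s S] hx) auto
    moreover have "p (h (x', y') - h (x, y')) < e / 2" using N(3) w' by blast
    ultimately show ?thesis using w' xy(1) by auto
  qed
  ultimately show "\<exists>N. openin (subtopology (prod_topology X Y) K) N \<and> z \<in> N \<and> (\<forall>w\<in>N. p (h w - h z) < e)"
    by blast
qed

section \<open>Directional derivatives\<close>

lemma one_param_add: "\<gamma> \<in> \<LL> \<Longrightarrow> \<gamma> (s + t) = \<gamma> s + \<gamma> t"
  by (simp add: one_param_subgroups_def)

lemma one_param_0 [simp]: "\<gamma> \<in> \<LL> \<Longrightarrow> \<gamma> 0 = 0"
  using one_param_add[of \<gamma> 0 0] by (metis add.right_neutral add_left_cancel)

lemma one_param_continuous: "\<gamma> \<in> \<LL> \<Longrightarrow> continuous_on A \<gamma>"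
  by (auto simp: one_param_subgroups_def intro: continuous_on_subset)

lemma topspace_one_param_topology [simp]: "topspace one_param_topology = \<LL>"
  by (auto simp: one_param_topology_def topspace_compact_open_topology one_param_subgroups_def)

lemma topspace_one_param_power: "topspace (one_param_power i) = (\<Pi>\<^sub>E k\<in>{..<i}. \<LL>)"
  by (simp add: one_param_power_def)

lemma topspace_deriv_domain: "topspace (deriv_domain U i) = U \<times> (\<Pi>\<^sub>E k\<in>{..<i}. \<LL>)"
  by (simp add: deriv_domain_def topspace_one_param_power)

lemma deriv_domainE:
  assumes "z \<in> topspace (deriv_domain U i)"
  obtains x \<gamma>s where "z = (x, \<gamma>s)" "x \<in> U" "\<gamma>s \<in> topspace (one_param_power i)" "\<forall>k<i. \<gamma>s k \<in> \<LL>"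
  using assms by (auto simp: deriv_domain_def topspace_one_param_power)

lemma one_param_nbhd:
  assumes "\<gamma> \<in> \<LL>" "open U" "x \<in> U"
  obtains d where "0 < d" "\<And>s. \<bar>s\<bar> < d \<Longrightarrow> x + \<gamma> s \<in> U"
proof -
  have "continuous_on UNIV (\<lambda>s. x + \<gamma> s)"
    by (intro continuous_intros one_param_continuous assms)
  then have "open ((\<lambda>s. x + \<gamma> s) -` U)"
    using assms(2) by (simp add: continuous_on_open_vimage)
  moreover have "0 \<in> (\<lambda>s. x + \<gamma> s) -` U" using assms by simp
  ultimately obtain d where "0 < d" "ball 0 d \<subseteq> (\<lambda>s. x + \<gamma> s) -` U"
    by (rule openE)
  then show thesis
    by (intro that[of d]) (auto simp: subset_iff)
qed

lemma one_param_nbhd2: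
  assumes "\<gamma> \<in> \<LL>" "\<eta> \<in> \<LL>" "open U" "x \<in> U"
  obtains d where "0 < d" "\<And>s t. \<bar>s\<bar> < d \<Longrightarrow> \<bar>t\<bar> < d \<Longrightarrow> x + \<gamma> s + \<eta> t \<in> U"
proof -
  let ?f = "\<lambda>z. x + \<gamma> (fst z) + \<eta> (snd z)"
  have "continuous_on UNIV ?f"
    by (intro continuous_intros continuous_on_compose2[OF one_param_continuous[OF assms(1), of UNIV]]
        continuous_on_compose2[OF one_param_continuous[OF assms(2), of UNIV]]) auto
  then have "open (?f -` U)"
    using assms(3) by (simp add: continuous_on_open_vimage)
  moreover have "(0, 0) \<in> ?f -` U" using assms by simp
  ultimately obtain A B where AB: "open A" "open B" "0 \<in> A" "0 \<in> B" "A \<times> B \<subseteq> ?f -` U"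
    by (elim open_prod_elim) auto
  have "open (A \<inter> B)" "0 \<in> A \<inter> B" using AB by auto
  then obtain d where d: "0 < d" "ball 0 d \<subseteq> A \<inter> B" by (rule openE)
  show thesis
  proof (rule that[OF d(1)])
    fix s t :: real assume "\<bar>s\<bar> < d" "\<bar>t\<bar> < d"
    then have "s \<in> ball 0 d" "t \<in> ball 0 d" by auto
    then have "(s, t) \<in> A \<times> B" using d(2) by blast
    then show "x + \<gamma> s + \<eta> t \<in> U" using AB(5) by auto
  qed
qed

lemma eventually_one_param:
  assumes "\<gamma> \<in> \<LL>" "open U" "x \<in> U"
  shows "eventually (\<lambda>t. x + \<gamma> t \<in> U) (at 0)"
proof -
  obtain d where "0 < d" "\<And>s. \<bar>s\<bar> < d \<Longrightarrow> x + \<gamma> s \<in> U"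
    using one_param_nbhd[OF assms] by blast
  then show ?thesis by (auto simp: eventually_at dist_real_def)
qed

text \<open>As \<open>U\<close> is open, \<open>x + \<gamma> t\<close> stays in \<open>U\<close> for
  small \<open>t\<close>. This matters because \<open>iter_deriv\<close> takes uncontrolled values
  off \<open>U\<close>, so two families of derivatives can only be expected to agree on
  \<open>U\<close>.\<close>

lemma has_dir_deriv_transform:
  assumes "open U" "x \<in> U" "\<gamma> \<in> \<LL>" "\<And>y. y \<in> U \<Longrightarrow> f y = g y" "has_dir_deriv F \<gamma> f x l"
  shows "has_dir_deriv F \<gamma> g x l"
  unfolding has_dir_deriv_def
proof (rule limitin_transform_eventually[OF _ assms(5)[unfolded has_dir_deriv_def]])
  show "\<forall>\<^sub>F t in at 0. (1 / t) *\<^sub>R (f (x + \<gamma> t) - f x) = (1 / t) *\<^sub>R (g (x + \<gamma> t) - g x)"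
    using eventually_one_param[OF assms(3,1,2)] by (rule eventually_mono) (simp add: assms(2,4))
qed

lemma dir_deriv_eq:
  assumes F: "seminorm_space F" and l: "has_dir_deriv F \<gamma> f x l"
  shows "dir_deriv F \<gamma> f x = l"
  unfolding dir_deriv_def
proof (rule the_equality[where P = "has_dir_deriv F \<gamma> f x", OF l])
  fix m assume "has_dir_deriv F \<gamma> f x m"
  then show "m = l"
    using l unfolding has_dir_deriv_def by (rule limitin_unique_seminorm[OF F]) simp
qed

lemma has_dir_deriv_add:
  assumes F: "seminorm_space F" and "has_dir_deriv F \<gamma> f x l" "has_dir_deriv F \<gamma> g x m"
  shows "has_dir_deriv F \<gamma> (\<lambda>y. f y + g y) x (l + m)"
  using limitin_add_seminorm[OF F assms(2,3)[unfolded has_dir_deriv_def]]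
  by (simp add: has_dir_deriv_def algebra_simps)

lemma has_dir_deriv_scaleR:
  assumes F: "seminorm_space F" and "has_dir_deriv F \<gamma> f x l"
  shows "has_dir_deriv F \<gamma> (\<lambda>y. c *\<^sub>R f y) x (c *\<^sub>R l)"
  using limitin_scaleR_seminorm[OF F assms(2)[unfolded has_dir_deriv_def], of c]
  by (simp add: has_dir_deriv_def scaleR_diff_right mult.commute)

lemma has_dir_deriv_sum_list:
  assumes F: "seminorm_space F" and "\<And>w. w \<in> set ws \<Longrightarrow> has_dir_deriv F \<gamma> (f w) x (l w)"
  shows "has_dir_deriv F \<gamma> (\<lambda>y. \<Sum>w\<leftarrow>ws. f w y) x (\<Sum>w\<leftarrow>ws. l w)"
  using assms(2)
proof (induction ws)
  case Nil
  then show ?case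
    using subspace_0[OF seminorm_space_subspace[OF F]] by (simp add: has_dir_deriv_def)
next
  case (Cons w ws)
  then show ?case
    using has_dir_deriv_add[OF F, of \<gamma> "f w" x "l w"] by simp
qed

lemma iter_deriv_cong:
  "(\<And>k. k < i \<Longrightarrow> \<gamma>s k = \<gamma>s' k) \<Longrightarrow> iter_deriv F f \<gamma>s i = iter_deriv F f \<gamma>s' i"
  by (induction i) auto

section \<open>Smooth maps\<close>

text \<open>\<open>D i \<gamma>s\<close> is a proposed formula for the derivative of order
  \<open>i\<close>. Uniqueness of limits identifies it, by induction on \<open>i\<close>, with the
  iterated derivative on \<open>U\<close>. All smoothness proofs below consist in naming such a
  family, and the second conclusion returns its meaning.\<close>

lemma smooth_mapsI_family:
  assumes F: "seminorm_space F" and U: "open U" and zero: "\<And>x. x \<notin> U \<Longrightarrow> f x = 0"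
    and D0: "\<And>x \<gamma>s. x \<in> U \<Longrightarrow> D 0 \<gamma>s x = f x"
    and deriv: "\<And>i x \<gamma>s. x \<in> U \<Longrightarrow> (\<And>k. k \<le> i \<Longrightarrow> \<gamma>s k \<in> \<LL>) \<Longrightarrow>
      has_dir_deriv F (\<gamma>s i) (D i \<gamma>s) x (D (Suc i) \<gamma>s x)"
    and cont: "\<And>i. continuous_map (deriv_domain U i) F (\<lambda>(x, \<gamma>s). D i \<gamma>s x)"
  shows "f \<in> smooth_maps U F"
    and "\<And>i x \<gamma>s. x \<in> U \<Longrightarrow> (\<And>k. k < i \<Longrightarrow> \<gamma>s k \<in> \<LL>) \<Longrightarrow> iter_deriv F f \<gamma>s i x = D i \<gamma>s x"
proof -
  have has: "has_dir_deriv F (\<gamma>s i) (iter_deriv F f \<gamma>s i) x (D (Suc i) \<gamma>s x)"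
    if "x \<in> U" "\<And>k. k \<le> i \<Longrightarrow> \<gamma>s k \<in> \<LL>" "\<And>y. y \<in> U \<Longrightarrow> iter_deriv F f \<gamma>s i y = D i \<gamma>s y" for x \<gamma>s i
    by (rule has_dir_deriv_transform[OF U that(1) _ _ deriv]) (use that in auto)
  have eq: "iter_deriv F f \<gamma>s i x = D i \<gamma>s x" if "x \<in> U" "\<And>k. k < i \<Longrightarrow> \<gamma>s k \<in> \<LL>" for x i \<gamma>s
    using that
  proof (induction i arbitrary: x)
    case 0
    then show ?case by (simp add: D0)
  next
    case (Suc i)
    then show ?case
      using dir_deriv_eq[OF F has[of x i \<gamma>s]] by simp
  qed
  then show "\<And>i x \<gamma>s. x \<in> U \<Longrightarrow> (\<And>k. k < i \<Longrightarrow> \<gamma>s k \<in> \<LL>) \<Longrightarrow> iter_deriv F f \<gamma>s i x = D i \<gamma>s x"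
    by blast
  have "continuous_map (top_of_set U) F f"
  proof -
    \<comment> \<open>The power with no factors has exactly one point, the function that is
      \<open>undefined\<close> everywhere.\<close>
    have "continuous_map (top_of_set U) (deriv_domain U 0) (\<lambda>x. (x, \<lambda>_. undefined))"
      by (simp add: deriv_domain_def continuous_map_paired one_param_power_def)
    from continuous_map_compose[OF this cont] show ?thesis
      by (rule continuous_map_eq) (simp add: D0)
  qed
  moreover have "\<exists>l. has_dir_deriv F (\<gamma>s i) (iter_deriv F f \<gamma>s i) x l"
    if "x \<in> U" "\<gamma>s \<in> topspace (one_param_power (Suc i))" for x \<gamma>s i
  proof -
    have mem: "\<gamma>s k \<in> \<LL>" if "k \<le> i" for k
      by (rule PiE_mem[OF \<open>\<gamma>s \<in> topspace (one_param_power (Suc i))\<close>[unfolded topspace_one_param_power]])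
        (use that in simp)
    have "iter_deriv F f \<gamma>s i y = D i \<gamma>s y" if "y \<in> U" for y
      by (rule eq[OF that]) (rule mem, simp)
    with has[of x i \<gamma>s, OF that(1) mem] show ?thesis by blast
  qed
  moreover have "continuous_map (deriv_domain U (Suc i)) F (deriv_map U F (Suc i) f)" for i
  proof (rule continuous_map_eq[OF cont])
    fix z assume "z \<in> topspace (deriv_domain U (Suc i))"
    then obtain x \<gamma>s where z: "z = (x, \<gamma>s)" "x \<in> U" "\<gamma>s \<in> topspace (one_param_power (Suc i))" "\<forall>k<Suc i. \<gamma>s k \<in> \<LL>"
      by (rule deriv_domainE)
    then show "(\<lambda>(x, \<gamma>s). D (Suc i) \<gamma>s x) z = deriv_map U F (Suc i) f z"
      using eq[OF z(2) z(4)[rule_format]] by (simp add: deriv_map_def deriv_domain_def del: iter_deriv.simps)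
  qed
  ultimately show "f \<in> smooth_maps U F"
    unfolding smooth_maps_def by (intro CollectI conjI allI impI ballI zero)
qed

lemma smooth_maps_zero: "f \<in> smooth_maps U F \<Longrightarrow> x \<notin> U \<Longrightarrow> f x = 0"
  by (simp add: smooth_maps_def)

lemma smooth_maps_deriv:
  assumes F: "seminorm_space F" and f: "f \<in> smooth_maps U F" and x: "x \<in> U"
    and \<gamma>s: "\<And>k. k \<le> i \<Longrightarrow> \<gamma>s k \<in> \<LL>"
  shows "has_dir_deriv F (\<gamma>s i) (iter_deriv F f \<gamma>s i) x (iter_deriv F f \<gamma>s (Suc i) x)"
proof -
  \<comment> \<open>\<open>smooth_maps\<close> quantifies over extensional tuples, whereas here any
    sequence of directions is allowed. Derivatives of order \<open>i\<close> read only the first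
    \<open>i\<close> entries.\<close>
  let ?\<gamma>s = "restrict \<gamma>s {..<Suc i}"
  have "?\<gamma>s \<in> topspace (one_param_power (Suc i))"
    using \<gamma>s by (auto simp: topspace_one_param_power)
  then obtain l where "has_dir_deriv F (?\<gamma>s i) (iter_deriv F f ?\<gamma>s i) x l"
    using f x unfolding smooth_maps_def by blast
  moreover have "iter_deriv F f ?\<gamma>s i = iter_deriv F f \<gamma>s i"
    by (rule iter_deriv_cong) simp
  ultimately have "has_dir_deriv F (\<gamma>s i) (iter_deriv F f \<gamma>s i) x l"
    by simp
  with dir_deriv_eq[OF F this] show ?thesis by simp
qed

lemma continuous_map_deriv_map:
  assumes "f \<in> smooth_maps U F"
  shows "continuous_map (deriv_domain U i) F (deriv_map U F i f)"
  using assms continuous_deriv_map_0[of U F f] by (cases i) (auto simp: smooth_maps_def)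

lemma deriv_map_apply:
  "x \<in> U \<Longrightarrow> \<gamma>s \<in> topspace (one_param_power i) \<Longrightarrow> deriv_map U F i f (x, \<gamma>s) = iter_deriv F f \<gamma>s i x"
  by (simp add: deriv_map_def deriv_domain_def)

lemma deriv_map_in_compact_open:
  assumes "f \<in> smooth_maps U F"
  shows "deriv_map U F i f \<in> topspace (compact_open_topology (deriv_domain U i) F)"
  using continuous_map_deriv_map[OF assms]
  by (simp add: topspace_compact_open_topology deriv_map_def)

text \<open>Base point and directions may all depend on a parameter in an arbitrary space
  \<open>X\<close>. The later joint continuity statements for derivatives of maps on
  \<open>U \<times> V\<close> are instances with a suitable \<open>X\<close>.\<close>

lemma continuous_map_iter_deriv:
  assumes f: "f \<in> smooth_maps U F" and a: "continuous_map X (top_of_set U) a"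
    and c: "\<And>k. k < n \<Longrightarrow> continuous_map X one_param_topology (c k)"
  shows "continuous_map X F (\<lambda>z. iter_deriv F f (\<lambda>k. c k z) n (a z))"
proof -
  have "continuous_map X (one_param_power n) (\<lambda>z. \<lambda>k\<in>{..<n}. c k z)"
    unfolding one_param_power_def continuous_map_componentwise
    by (auto intro: continuous_map_eq[OF c])
  then have "continuous_map X (deriv_domain U n) (\<lambda>z. (a z, \<lambda>k\<in>{..<n}. c k z))"
    using a by (simp add: deriv_domain_def continuous_map_paired)
  from continuous_map_compose[OF this continuous_map_deriv_map[OF f]]
  show ?thesis
  proof (rule continuous_map_eq)
    fix z assume z: "z \<in> topspace X"
    have "c k z \<in> \<LL>" if "k < n" for k
      using continuous_map_funspace[OF c[OF that]] z by auto
    moreover have "a z \<in> U"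
      using continuous_map_funspace[OF a] z by auto
    moreover have "iter_deriv F f (\<lambda>k\<in>{..<n}. c k z) n = iter_deriv F f (\<lambda>k. c k z) n"
      by (rule iter_deriv_cong) simp
    ultimately show "(deriv_map U F n f \<circ> (\<lambda>z. (a z, \<lambda>k\<in>{..<n}. c k z))) z =
        iter_deriv F f (\<lambda>k. c k z) n (a z)"
      by (auto simp: deriv_map_def topspace_deriv_domain)
  qed
qed

lemma continuous_map_iter_deriv_base:
  assumes f: "f \<in> smooth_maps U F" and "\<And>k. k < n \<Longrightarrow> \<gamma>s k \<in> \<LL>"
  shows "continuous_map (top_of_set U) F (iter_deriv F f \<gamma>s n)"
  using continuous_map_iter_deriv[OF f, of "top_of_set U" "\<lambda>x. x" n "\<lambda>k _. \<gamma>s k"] assms(2)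
  by (simp add: continuous_map_id[unfolded id_def])

lemma iter_deriv_in_topspace:
  assumes "f \<in> smooth_maps U F" "x \<in> U" "\<And>k. k < n \<Longrightarrow> \<gamma>s k \<in> \<LL>"
  shows "iter_deriv F f \<gamma>s n x \<in> topspace F"
proof -
  have "continuous_map (top_of_set U) F (iter_deriv F f \<gamma>s n)"
    by (rule continuous_map_iter_deriv_base[OF assms(1)]) (rule assms(3))
  from continuous_map_funspace[OF this] show ?thesis using assms(2) by auto
qed

lemma smooth_maps_lincomb:
  assumes F: "seminorm_space F" and U: "open U" and f: "f \<in> smooth_maps U F" and g: "g \<in> smooth_maps U F"
  shows "a *\<^sub>R f + b *\<^sub>R g \<in> smooth_maps U F"
    and "\<And>i x \<gamma>s. x \<in> U \<Longrightarrow> (\<And>k. k < i \<Longrightarrow> \<gamma>s k \<in> \<LL>) \<Longrightarrow>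
      iter_deriv F (a *\<^sub>R f + b *\<^sub>R g) \<gamma>s i x = a *\<^sub>R iter_deriv F f \<gamma>s i x + b *\<^sub>R iter_deriv F g \<gamma>s i x"
proof -
  let ?D = "\<lambda>i \<gamma>s x. a *\<^sub>R iter_deriv F f \<gamma>s i x + b *\<^sub>R iter_deriv F g \<gamma>s i x"
  have c: "continuous_map (deriv_domain U i) F (\<lambda>(x, \<gamma>s). ?D i \<gamma>s x)" for i
    by (rule continuous_map_eq[OF continuous_map_add_seminorm[OF F
            continuous_map_scaleR_seminorm[OF F continuous_map_deriv_map[OF f]]
            continuous_map_scaleR_seminorm[OF F continuous_map_deriv_map[OF g]]]]) (auto simp: deriv_map_def)
  have d: "has_dir_deriv F (\<gamma>s i) (?D i \<gamma>s) x (?D (Suc i) \<gamma>s x)"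
    if "x \<in> U" "\<And>k. k \<le> i \<Longrightarrow> \<gamma>s k \<in> \<LL>" for i x \<gamma>s
    by (intro has_dir_deriv_add[OF F] has_dir_deriv_scaleR[OF F] smooth_maps_deriv[OF F f]
        smooth_maps_deriv[OF F g] that)
  note * = smooth_mapsI_family[of F U "a *\<^sub>R f + b *\<^sub>R g" ?D, OF F U _ _ d c]
  show "a *\<^sub>R f + b *\<^sub>R g \<in> smooth_maps U F"
    by (rule *(1)) (simp_all add: smooth_maps_zero[OF f] smooth_maps_zero[OF g] scaleR_fun_def)
  show "\<And>i x \<gamma>s. x \<in> U \<Longrightarrow> (\<And>k. k < i \<Longrightarrow> \<gamma>s k \<in> \<LL>) \<Longrightarrow> iter_deriv F (a *\<^sub>R f + b *\<^sub>R g) \<gamma>s i x = ?D i \<gamma>s x"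
    by (rule *(2)) (simp_all add: smooth_maps_zero[OF f] smooth_maps_zero[OF g] scaleR_fun_def)
qed

lemma subspace_smooth_maps:
  assumes F: "seminorm_space F" and U: "open U"
  shows "subspace (smooth_maps U F)"
proof -
  have S0: "0 \<in> topspace F" by (rule subspace_0[OF seminorm_space_subspace[OF F]])
  have "0 \<in> smooth_maps U F"
    by (rule smooth_mapsI_family(1)[OF F U, where D = "\<lambda>_ _ _. 0"])
      (auto simp: has_dir_deriv_def S0 case_prod_unfold)
  moreover have "f + g \<in> smooth_maps U F" if "f \<in> smooth_maps U F" "g \<in> smooth_maps U F" for f g
    using smooth_maps_lincomb(1)[OF F U that, of 1 1] by simp
  moreover have "c *\<^sub>R f \<in> smooth_maps U F" if "f \<in> smooth_maps U F" for f c
    using smooth_maps_lincomb(1)[OF F U that that, of c 0] by simp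
  ultimately show ?thesis
    unfolding subspace_def by blast
qed

section \<open>Mean value estimates\<close>

text \<open>Bisection takes the place of linear functionals: the estimate with slope
  \<open>M + e\<close> holds on short intervals about each point by differentiability, and it is
  preserved when adjacent intervals are joined. The fixed vector \<open>v\<close> is subtracted
  throughout, so that a difference quotient can be compared directly with a derivative at one
  point.\<close>

lemma seminorm_mean_value:
  fixes \<phi> :: "real \<Rightarrow> 'f::real_vector"
  assumes F: "seminorm_space F" and p: "continuous_seminorm F p" and ab: "a \<le> b"
    and \<phi>: "\<And>s. a \<le> s \<Longrightarrow> s \<le> b \<Longrightarrow> \<phi> s \<in> topspace F"
    and d: "\<And>s. a \<le> s \<Longrightarrow> s \<le> b \<Longrightarrow> limitin F (\<lambda>u. (1 / u) *\<^sub>R (\<phi> (s + u) - \<phi> s)) (\<phi>' s) (at 0)"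
    and v: "v \<in> topspace F" and M: "\<And>s. a \<le> s \<Longrightarrow> s \<le> b \<Longrightarrow> p (\<phi>' s - v) \<le> M"
  shows "p (\<phi> b - \<phi> a - (b - a) *\<^sub>R v) \<le> M * (b - a)"
proof -
  note S = seminorm_space_subspace[OF F] and s = continuous_seminorm_on[OF p]
  \<comment> \<open>Membership of the end values in \<open>F\<close> is carried along, because the
    seminorm laws hold only on the carrier.\<close>
  define P where "P e x y \<longleftrightarrow> \<phi> x \<in> topspace F \<and> \<phi> y \<in> topspace F \<and>
      p (\<phi> y - \<phi> x - (y - x) *\<^sub>R v) \<le> (M + e) * (y - x)" for e x y
  have "P e a b" if e: "0 < e" for e
    using ab
  proof (induction rule: Bolzano)
    case (trans x y z)
    have "p ((\<phi> z - \<phi> y - (z - y) *\<^sub>R v) + (\<phi> y - \<phi> x - (y - x) *\<^sub>R v)) \<le>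
        p (\<phi> z - \<phi> y - (z - y) *\<^sub>R v) + p (\<phi> y - \<phi> x - (y - x) *\<^sub>R v)"
      using trans(1,2) by (intro seminorm_on_add[OF s] subspace_diff[OF S] subspace_scale[OF S] v)
        (auto simp: P_def)
    also have "\<dots> \<le> (M + e) * (z - y) + (M + e) * (y - x)"
      using trans(1,2) by (intro add_mono) (auto simp: P_def)
    also have "\<dots> = (M + e) * (z - x)" by (simp add: algebra_simps)
    also have "(\<phi> z - \<phi> y - (z - y) *\<^sub>R v) + (\<phi> y - \<phi> x - (y - x) *\<^sub>R v) = \<phi> z - \<phi> x - (z - x) *\<^sub>R v"
      by (simp add: algebra_simps)
    finally show ?case using trans(1,2) by (simp add: P_def)
  next
    case (local x)
    define q where "q u = (1 / u) *\<^sub>R (\<phi> (x + u) - \<phi> x)" for u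
    have x: "\<phi> x \<in> topspace F" "\<phi>' x \<in> topspace F"
      using \<phi>[OF local] limitin_topspace[OF d[OF local]] by auto
    obtain \<delta> where \<delta>: "0 < \<delta>" "\<And>u. u \<noteq> 0 \<Longrightarrow> \<bar>u\<bar> < \<delta> \<Longrightarrow> q u \<in> topspace F \<and> p (q u - \<phi>' x) < e"
      using limitin_seminormD[OF F d[OF local] p e] unfolding eventually_at q_def[symmetric]
      by (auto simp: dist_real_def)
    have near: "\<phi> (x + u) \<in> topspace F \<and> p (\<phi> (x + u) - \<phi> x - u *\<^sub>R v) \<le> (M + e) * \<bar>u\<bar>"
      if u: "\<bar>u\<bar> < \<delta>" for u
    proof (cases "u = 0")
      case True
      then show ?thesis using x seminorm_on_zero[OF s S] by simp
    next
      case False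
      have qu: "q u \<in> topspace F" "p (q u - \<phi>' x) < e" using \<delta>(2)[OF False u] by auto
      \<comment> \<open>The point \<open>x + u\<close> may lie outside \<open>[a, b]\<close>, where
        nothing is assumed about \<open>\<phi>\<close>. That its value lies in \<open>F\<close> is
        read off from the difference quotient.\<close>
      have eq: "\<phi> (x + u) = \<phi> x + u *\<^sub>R q u" using False by (simp add: q_def)
      have eq': "\<phi> (x + u) - \<phi> x - u *\<^sub>R v = u *\<^sub>R (q u - v)"
        unfolding eq by (simp add: scaleR_diff_right)
      have "p (q u - v) \<le> p (q u - \<phi>' x) + p (\<phi>' x - v)"
        by (intro seminorm_on_triangle[OF s S] qu x v)
      then have "p (q u - v) \<le> M + e" using qu(2) M[OF local] by linarith
      then have "\<bar>u\<bar> * p (q u - v) \<le> (M + e) * \<bar>u\<bar>"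
        using mult_left_mono[of "p (q u - v)" "M + e" "\<bar>u\<bar>"] by (simp add: mult.commute)
      moreover have "p (u *\<^sub>R (q u - v)) = \<bar>u\<bar> * p (q u - v)"
        by (intro seminorm_on_scaleR[OF s] subspace_diff[OF S] qu v)
      moreover have "\<phi> (x + u) \<in> topspace F"
        unfolding eq by (intro subspace_add[OF S] subspace_scale[OF S] x qu)
      ultimately show ?thesis unfolding eq' by simp
    qed
    \<comment> \<open>Both ends are compared with the centre \<open>x\<close>; the lengths
      \<open>z - x\<close> and \<open>x - y\<close> add up to \<open>z - y\<close>.\<close>
    have "P e y z" if yz: "y \<le> x" "x \<le> z" "z - y < \<delta>" for y z
    proof -
      have y: "\<phi> y \<in> topspace F" "p (\<phi> y - \<phi> x - (y - x) *\<^sub>R v) \<le> (M + e) * (x - y)"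
        using near[of "y - x"] yz by auto
      have z: "\<phi> z \<in> topspace F" "p (\<phi> z - \<phi> x - (z - x) *\<^sub>R v) \<le> (M + e) * (z - x)"
        using near[of "z - x"] yz by auto
      have eq: "\<phi> z - \<phi> y - (z - y) *\<^sub>R v = (\<phi> z - \<phi> x - (z - x) *\<^sub>R v) - (\<phi> y - \<phi> x - (y - x) *\<^sub>R v)"
        by (simp add: algebra_simps)
      have "p (\<phi> z - \<phi> y - (z - y) *\<^sub>R v) \<le> p (\<phi> z - \<phi> x - (z - x) *\<^sub>R v) + p (\<phi> y - \<phi> x - (y - x) *\<^sub>R v)"
        unfolding eq by (intro seminorm_on_diff[OF s S] subspace_diff[OF S] subspace_scale[OF S] x y z v)
      also have "\<dots> \<le> (M + e) * (z - x) + (M + e) * (x - y)"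
        using y z by (intro add_mono)
      also have "\<dots> = (M + e) * (z - y)" by (simp add: algebra_simps)
      finally show ?thesis using y z by (simp add: P_def)
    qed
    then show ?case using \<delta>(1) by blast
  qed
  then have *: "p (\<phi> b - \<phi> a - (b - a) *\<^sub>R v) \<le> (M + e) * (b - a)" if "0 < e" for e
    using that by (simp add: P_def)
  show ?thesis
  proof (rule field_le_epsilon)
    fix e :: real assume e: "0 < e"
    \<comment> \<open>The slack is chosen so that it contributes at most \<open>e\<close>; the
      summand 1 avoids a vanishing denominator for \<open>a = b\<close>.\<close>
    have "p (\<phi> b - \<phi> a - (b - a) *\<^sub>R v) \<le> (M + e / (b - a + 1)) * (b - a)"
      using ab e by (intro *) auto
    also have "\<dots> = M * (b - a) + e * ((b - a) / (b - a + 1))"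
      by (simp add: algebra_simps)
    also have "\<dots> \<le> M * (b - a) + e * 1"
      using ab e by (intro add_left_mono mult_left_mono) auto
    finally show "p (\<phi> b - \<phi> a - (b - a) *\<^sub>R v) \<le> M * (b - a) + e" by simp
  qed
qed

text \<open>Since \<open>\<gamma>\<close> is a homomorphism, the difference quotients of
  \<open>\<lambda>s. f (x + \<gamma> s)\<close> at \<open>s\<close> are those of \<open>f\<close> at
  \<open>x + \<gamma> s\<close>. For negative \<open>t\<close> the interval is
  \<open>[t, 0]\<close>, and the reversed sign is invisible to \<open>p\<close>.\<close>

lemma dir_deriv_mean_value:
  assumes F: "seminorm_space F" and p: "continuous_seminorm F p" and \<gamma>: "\<gamma> \<in> \<LL>" and t: "t \<noteq> 0"
    and f: "\<And>s. \<bar>s\<bar> \<le> \<bar>t\<bar> \<Longrightarrow> f (x + \<gamma> s) \<in> topspace F"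
    and d: "\<And>s. \<bar>s\<bar> \<le> \<bar>t\<bar> \<Longrightarrow> has_dir_deriv F \<gamma> f (x + \<gamma> s) (f' (x + \<gamma> s))"
    and v: "v \<in> topspace F" and M: "\<And>s. \<bar>s\<bar> \<le> \<bar>t\<bar> \<Longrightarrow> p (f' (x + \<gamma> s) - v) \<le> M"
  shows "p ((1 / t) *\<^sub>R (f (x + \<gamma> t) - f x) - v) \<le> M"
proof -
  note S = seminorm_space_subspace[OF F] and s = continuous_seminorm_on[OF p]
  let ?\<phi> = "\<lambda>s. f (x + \<gamma> s)"
  have lim: "limitin F (\<lambda>u. (1 / u) *\<^sub>R (?\<phi> (s + u) - ?\<phi> s)) (f' (x + \<gamma> s)) (at 0)" if "\<bar>s\<bar> \<le> \<bar>t\<bar>" for s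
    using d[OF that] by (simp add: has_dir_deriv_def one_param_add[OF \<gamma>] add.assoc)
  have f0: "f x \<in> topspace F" using f[of 0] \<gamma> by simp
  have ft: "?\<phi> t \<in> topspace F" using f[of t] by simp
  have "p (?\<phi> t - f x - t *\<^sub>R v) \<le> M * \<bar>t\<bar>"
  proof (cases "0 < t")
    case True
    have "p (?\<phi> t - ?\<phi> 0 - (t - 0) *\<^sub>R v) \<le> M * (t - 0)"
      by (rule seminorm_mean_value[OF F p _ _ _ v, where \<phi>' = "\<lambda>s. f' (x + \<gamma> s)"])
        (use True in \<open>auto intro: f lim M\<close>)
    then show ?thesis using True \<gamma> by simp
  next
    case False
    have "p (?\<phi> 0 - ?\<phi> t - (0 - t) *\<^sub>R v) \<le> M * (0 - t)"
      by (rule seminorm_mean_value[OF F p _ _ _ v, where \<phi>' = "\<lambda>s. f' (x + \<gamma> s)"])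
        (use False in \<open>auto intro: f lim M\<close>)
    moreover have "p (?\<phi> 0 - ?\<phi> t - (0 - t) *\<^sub>R v) = p (- (?\<phi> 0 - ?\<phi> t - (0 - t) *\<^sub>R v))"
      using \<gamma> by (intro seminorm_on_minus[OF s, symmetric] subspace_diff[OF S] subspace_scale[OF S] v)
        (simp_all add: f0 ft)
    ultimately show ?thesis using False \<gamma> by (simp add: algebra_simps)
  qed
  moreover have "p ((1 / t) *\<^sub>R (?\<phi> t - f x - t *\<^sub>R v)) = \<bar>1 / t\<bar> * p (?\<phi> t - f x - t *\<^sub>R v)"
    by (intro seminorm_on_scaleR[OF s] subspace_diff[OF S] subspace_scale[OF S] v f0 ft)
  moreover have "(1 / t) *\<^sub>R (?\<phi> t - f x - t *\<^sub>R v) = (1 / t) *\<^sub>R (f (x + \<gamma> t) - f x) - v"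
    using t by (simp add: scaleR_diff_right)
  ultimately have "p ((1 / t) *\<^sub>R (f (x + \<gamma> t) - f x) - v) \<le> \<bar>1 / t\<bar> * (M * \<bar>t\<bar>)"
    by (metis abs_ge_zero mult_left_mono)
  then show ?thesis
    using t by simp
qed

section \<open>Commuting directions\<close>

lemma continuous_map_open_nbhd:
  assumes F: "seminorm_space F" and W: "open W" and f: "continuous_map (top_of_set W) F f"
    and x: "x \<in> W" and p: "continuous_seminorm F p" and e: "0 < e"
  obtains N where "open N" "N \<subseteq> W" "x \<in> N" "\<And>y. y \<in> N \<Longrightarrow> p (f y - f x) < e"
proof -
  obtain N where N: "openin (top_of_set W) N" "x \<in> N" "\<And>y. y \<in> N \<Longrightarrow> p (f y - f x) < e"
    using f x p e unfolding continuous_map_seminorm[OF F] by (metis topspace_euclidean_subtopology)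
  then show thesis
    using W that by (auto simp: openin_open_eq)
qed

text \<open>The difference quotient along \<open>\<gamma>\<close> with step \<open>s\<close> of the
  difference quotient along \<open>\<eta>\<close> with step \<open>t\<close>. For commuting
  subgroups it is unchanged when \<open>(\<gamma>, s)\<close> and \<open>(\<eta>, t)\<close> are
  exchanged.\<close>

definition second_difference :: "('g::plus \<Rightarrow> 'f::real_vector) \<Rightarrow> (real \<Rightarrow> 'g) \<Rightarrow> (real \<Rightarrow> 'g) \<Rightarrow> real \<Rightarrow> real \<Rightarrow> 'g \<Rightarrow> 'f"
  where "second_difference B \<gamma> \<eta> s t x =
    (1 / s) *\<^sub>R ((1 / t) *\<^sub>R (B (x + \<gamma> s + \<eta> t) - B (x + \<gamma> s)) - (1 / t) *\<^sub>R (B (x + \<eta> t) - B x))"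

text \<open>The mean value estimate is used twice: along \<open>\<gamma>\<close> for the quotient of
  \<open>B\<close> in direction \<open>\<eta>\<close>, whose derivative is the same quotient of
  \<open>B1\<close>, and then along \<open>\<eta>\<close> for \<open>B1\<close>. All intermediate
  points lie in a neighbourhood where \<open>B12\<close> is within \<open>e\<close> of its value at
  \<open>x\<close>.\<close>

lemma second_difference_estimate:
  assumes F: "seminorm_space F" and p: "continuous_seminorm F p" and e: "0 < e"
    and W: "open W" and \<gamma>: "\<gamma> \<in> \<LL>" and \<eta>: "\<eta> \<in> \<LL>" and comm: "\<And>s t. \<gamma> s + \<eta> t = \<eta> t + \<gamma> s"
    and x: "x \<in> W" and B: "B \<in> W \<rightarrow> topspace F" and B1: "B1 \<in> W \<rightarrow> topspace F"
    and d1: "\<And>w. w \<in> W \<Longrightarrow> has_dir_deriv F \<gamma> B w (B1 w)"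
    and d12: "\<And>w. w \<in> W \<Longrightarrow> has_dir_deriv F \<eta> B1 w (B12 w)"
    and cont: "continuous_map (top_of_set W) F B12"
  obtains \<delta> where "0 < \<delta>"
    "\<And>s t. 0 < \<bar>s\<bar> \<Longrightarrow> \<bar>s\<bar> < \<delta> \<Longrightarrow> 0 < \<bar>t\<bar> \<Longrightarrow> \<bar>t\<bar> < \<delta> \<Longrightarrow>
      p (second_difference B \<gamma> \<eta> s t x - B12 x) \<le> e"
proof -
  note S = seminorm_space_subspace[OF F] and sn = continuous_seminorm_on[OF p]
  have B12: "B12 \<in> W \<rightarrow> topspace F" using continuous_map_funspace[OF cont] by simp
  then have B12x: "B12 x \<in> topspace F" using x by blast
  obtain N where oN: "open N" "N \<subseteq> W" and N: "x \<in> N" "\<And>y. y \<in> N \<Longrightarrow> p (B12 y - B12 x) < e"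
    using continuous_map_open_nbhd[OF F W cont x p e] by blast
  obtain \<delta> where \<delta>: "0 < \<delta>" "\<And>s t. \<bar>s\<bar> < \<delta> \<Longrightarrow> \<bar>t\<bar> < \<delta> \<Longrightarrow> x + \<gamma> s + \<eta> t \<in> N"
    using one_param_nbhd2[OF \<gamma> \<eta> oN(1) N(1)] by blast
  have W0: "x + \<gamma> s \<in> W" if "\<bar>s\<bar> < \<delta>" for s
    using \<delta>(2)[OF that, of 0] \<delta>(1) oN \<eta> by auto
  have W1: "x + \<gamma> s + \<eta> t \<in> W" if "\<bar>s\<bar> < \<delta>" "\<bar>t\<bar> < \<delta>" for s t
    using \<delta>(2)[OF that] oN by auto
  show thesis
  proof (rule that[OF \<delta>(1)])
    fix s t assume st: "0 < \<bar>s\<bar>" "\<bar>s\<bar> < \<delta>" "0 < \<bar>t\<bar>" "\<bar>t\<bar> < \<delta>"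
    let ?\<psi> = "\<lambda>w. (1 / t) *\<^sub>R (B (w + \<eta> t) - B w)"
    let ?\<psi>' = "\<lambda>w. (1 / t) *\<^sub>R (B1 (w + \<eta> t) - B1 w)"
    \<comment> \<open>Here commutativity enters: translation by \<open>\<eta> t\<close> carries the
      curve along \<open>\<gamma>\<close> through \<open>w\<close> to the one through
      \<open>w + \<eta> t\<close>.\<close>
    have shift: "has_dir_deriv F \<gamma> (\<lambda>w. B (w + \<eta> t)) w (B1 (w + \<eta> t))" if "w + \<eta> t \<in> W" for w
    proof -
      have "w + \<gamma> u + \<eta> t = w + \<eta> t + \<gamma> u" for u
        by (metis add.assoc comm)
      then show ?thesis using d1[OF that] by (simp add: has_dir_deriv_def)
    qed
    have "p ((1 / s) *\<^sub>R (?\<psi> (x + \<gamma> s) - ?\<psi> x) - B12 x) \<le> e"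
    proof (rule dir_deriv_mean_value[OF F p \<gamma> _ _ _ B12x, where f = ?\<psi> and f' = ?\<psi>'])
      fix r :: real assume r: "\<bar>r\<bar> \<le> \<bar>s\<bar>"
      then have r': "\<bar>r\<bar> < \<delta>" using st by simp
      let ?w = "x + \<gamma> r"
      have w: "?w \<in> W" "?w + \<eta> t \<in> W" using W0[OF r'] W1[OF r' st(4)] by auto
      show "?\<psi> ?w \<in> topspace F"
        using B w by (intro subspace_scale[OF S] subspace_diff[OF S]) auto
      have "has_dir_deriv F \<gamma> (\<lambda>w. (1 / t) *\<^sub>R (B (w + \<eta> t) + (-1) *\<^sub>R B w)) ?w
          ((1 / t) *\<^sub>R (B1 (?w + \<eta> t) + (-1) *\<^sub>R B1 ?w))"
        by (intro has_dir_deriv_scaleR[OF F] has_dir_deriv_add[OF F] shift d1 w)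
      then show "has_dir_deriv F \<gamma> ?\<psi> ?w (?\<psi>' ?w)" by simp
      show "p (?\<psi>' ?w - B12 x) \<le> e"
      proof (rule dir_deriv_mean_value[OF F p \<eta> _ _ _ B12x, where f' = B12])
        fix q :: real assume "\<bar>q\<bar> \<le> \<bar>t\<bar>"
        then have q: "\<bar>q\<bar> < \<delta>" using st by simp
        show "B1 (?w + \<eta> q) \<in> topspace F" using B1 W1[OF r' q] by blast
        show "has_dir_deriv F \<eta> B1 (?w + \<eta> q) (B12 (?w + \<eta> q))" by (rule d12[OF W1[OF r' q]])
        show "p (B12 (?w + \<eta> q) - B12 x) \<le> e" using N(2)[OF \<delta>(2)[OF r' q]] by simp
      qed (use st in auto)
    qed (use st in auto)
    then show "p (second_difference B \<gamma> \<eta> s t x - B12 x) \<le> e"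
      unfolding second_difference_def .
  qed
qed

text \<open>Both mixed derivatives are approximated by one and the same second difference, by its
  symmetry.\<close>

lemma dir_deriv_commute:
  assumes F: "seminorm_space F"
    and W: "open W" and \<gamma>: "\<gamma> \<in> \<LL>" and \<eta>: "\<eta> \<in> \<LL>" and comm: "\<And>s t. \<gamma> s + \<eta> t = \<eta> t + \<gamma> s"
    and x: "x \<in> W" and B: "B \<in> W \<rightarrow> topspace F"
    and B1: "B1 \<in> W \<rightarrow> topspace F" and B2: "B2 \<in> W \<rightarrow> topspace F"
    and d1: "\<And>w. w \<in> W \<Longrightarrow> has_dir_deriv F \<gamma> B w (B1 w)"
    and d2: "\<And>w. w \<in> W \<Longrightarrow> has_dir_deriv F \<eta> B w (B2 w)"
    and d12: "\<And>w. w \<in> W \<Longrightarrow> has_dir_deriv F \<eta> B1 w (B12 w)"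
    and d21: "\<And>w. w \<in> W \<Longrightarrow> has_dir_deriv F \<gamma> B2 w (B21 w)"
    and c12: "continuous_map (top_of_set W) F B12"
    and c21: "continuous_map (top_of_set W) F B21"
  shows "B12 x = B21 x"
proof (rule seminorm_space_eqI[OF F])
  note S = seminorm_space_subspace[OF F]
  show t12: "B12 x \<in> topspace F" and t21: "B21 x \<in> topspace F"
    using continuous_map_funspace[OF c12] continuous_map_funspace[OF c21] x by auto
  fix p and e :: real assume p: "continuous_seminorm F p" and e: "0 < e"
  note sn = continuous_seminorm_on[OF p]
  obtain \<delta> where \<delta>: "0 < \<delta>"
    "\<And>s t. 0 < \<bar>s\<bar> \<Longrightarrow> \<bar>s\<bar> < \<delta> \<Longrightarrow> 0 < \<bar>t\<bar> \<Longrightarrow> \<bar>t\<bar> < \<delta> \<Longrightarrow> p (second_difference B \<gamma> \<eta> s t x - B12 x) \<le> e / 2"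
    using second_difference_estimate[OF F p half_gt_zero[OF e] W \<gamma> \<eta> comm x B B1 d1 d12 c12] by blast
  obtain \<epsilon> where \<epsilon>: "0 < \<epsilon>"
    "\<And>s t. 0 < \<bar>s\<bar> \<Longrightarrow> \<bar>s\<bar> < \<epsilon> \<Longrightarrow> 0 < \<bar>t\<bar> \<Longrightarrow> \<bar>t\<bar> < \<epsilon> \<Longrightarrow> p (second_difference B \<eta> \<gamma> s t x - B21 x) \<le> e / 2"
    using second_difference_estimate[OF F p half_gt_zero[OF e] W \<eta> \<gamma> comm[symmetric] x B B2 d2 d21 c21] by blast
  obtain \<rho> where \<rho>: "0 < \<rho>" "\<And>s t. \<bar>s\<bar> < \<rho> \<Longrightarrow> \<bar>t\<bar> < \<rho> \<Longrightarrow> x + \<gamma> s + \<eta> t \<in> W"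
    using one_param_nbhd2[OF \<gamma> \<eta> W x] by blast
  \<comment> \<open>A common step for both directions: below \<open>\<delta>\<close> and
    \<open>\<epsilon>\<close> for the two estimates, below \<open>\<rho>\<close> so that all four
    points of the second difference lie in \<open>W\<close>.\<close>
  define t where "t = min \<rho> (min \<delta> \<epsilon>) / 2"
  have t: "0 < t" "t < \<delta>" "t < \<epsilon>" "t < \<rho>" using \<delta>(1) \<epsilon>(1) \<rho>(1) by (auto simp: t_def)
  let ?Q = "second_difference B \<gamma> \<eta> t t x"
  have "x + \<gamma> t + \<eta> t = x + \<eta> t + \<gamma> t" by (metis add.assoc comm)
  then have Q: "?Q = second_difference B \<eta> \<gamma> t t x"
    by (simp add: second_difference_def algebra_simps)
  have in_W: "x + \<gamma> t + \<eta> t \<in> W" "x + \<gamma> t \<in> W" "x + \<eta> t \<in> W"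
    using \<rho>(2)[of t t] \<rho>(2)[of t 0] \<rho>(2)[of 0 t] \<rho>(1) t \<gamma> \<eta> by auto
  have QF: "?Q \<in> topspace F"
    unfolding second_difference_def using B in_W x by (intro subspace_scale[OF S] subspace_diff[OF S]) auto
  have "p (?Q - B12 x) \<le> e / 2" using \<delta>(2)[of t t] t by simp
  moreover have "p (?Q - B21 x) \<le> e / 2" unfolding Q using \<epsilon>(2)[of t t] t by simp
  moreover have "p (B12 x - B21 x) \<le> p (B12 x - ?Q) + p (?Q - B21 x)" "p (B12 x - ?Q) = p (?Q - B12 x)"
    by (intro seminorm_on_triangle[OF sn S] seminorm_on_commute[OF sn S] QF t12 t21)+
  ultimately show "p (B12 x - B21 x) \<le> e" by linarith
qed

text \<open>The increment is split at the moving point \<open>x + \<eta> t\<close>. The step from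
  \<open>x\<close> to there contributes \<open>l\<close> by \<open>d2\<close>. The remaining step is
  along \<open>\<gamma>\<close> from a varying base point, and the mean value estimate with
  continuity of \<open>B1\<close> shows that its quotient tends to \<open>B1 x\<close>.\<close>

lemma has_dir_deriv_sum_directions:
  assumes F: "seminorm_space F"
    and W: "open W" and \<gamma>: "\<gamma> \<in> \<LL>" and \<eta>: "\<eta> \<in> \<LL>" and comm: "\<And>s t. \<gamma> s + \<eta> t = \<eta> t + \<gamma> s"
    and x: "x \<in> W" and B: "B \<in> W \<rightarrow> topspace F"
    and d1: "\<And>w. w \<in> W \<Longrightarrow> has_dir_deriv F \<gamma> B w (B1 w)"
    and cont: "continuous_map (top_of_set W) F B1"
    and d2: "has_dir_deriv F \<eta> B x l"
  shows "has_dir_deriv F (\<lambda>t. \<gamma> t + \<eta> t) B x (B1 x + l)"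
proof -
  note S = seminorm_space_subspace[OF F]
  let ?q = "\<lambda>t. (1 / t) *\<^sub>R (B (x + \<eta> t + \<gamma> t) - B (x + \<eta> t))"
  have B1: "B1 \<in> W \<rightarrow> topspace F" using continuous_map_funspace[OF cont] by simp
  have "limitin F ?q (B1 x) (at 0)"
    unfolding limitin_seminorm[OF F]
  proof (intro conjI allI impI)
    show B1x: "B1 x \<in> topspace F" using B1 x by blast
    obtain \<rho> where \<rho>: "0 < \<rho>" "\<And>s t. \<bar>s\<bar> < \<rho> \<Longrightarrow> \<bar>t\<bar> < \<rho> \<Longrightarrow> x + \<eta> s + \<gamma> t \<in> W"
      using one_param_nbhd2[OF \<eta> \<gamma> W x] by blast
    have "?q t \<in> topspace F" if "\<bar>t\<bar> < \<rho>" for t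
      using \<rho>(2)[OF that that] \<rho>(2)[OF that, of 0] \<rho>(1) B \<gamma>
      by (intro subspace_scale[OF S] subspace_diff[OF S]) auto
    then show "\<forall>\<^sub>F t in at 0. ?q t \<in> topspace F"
      using \<rho>(1) by (auto simp: eventually_at dist_real_def)
    fix p and e :: real assume p: "continuous_seminorm F p" and e: "0 < e"
    obtain N where oN: "open N" "N \<subseteq> W" and N: "x \<in> N" "\<And>y. y \<in> N \<Longrightarrow> p (B1 y - B1 x) < e / 2"
      using continuous_map_open_nbhd[OF F W cont x p half_gt_zero[OF e]] by blast
    obtain \<delta> where \<delta>: "0 < \<delta>" "\<And>s t. \<bar>s\<bar> < \<delta> \<Longrightarrow> \<bar>t\<bar> < \<delta> \<Longrightarrow> x + \<eta> s + \<gamma> t \<in> N"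
      using one_param_nbhd2[OF \<eta> \<gamma> oN(1) N(1)] by blast
    have "p (?q t - B1 x) \<le> e / 2" if t: "t \<noteq> 0" "\<bar>t\<bar> < \<delta>" for t
    proof (rule dir_deriv_mean_value[OF F p \<gamma> t(1) _ _ B1x, where f' = B1])
      fix s assume "\<bar>s\<bar> \<le> \<bar>t\<bar>"
      then have N': "x + \<eta> t + \<gamma> s \<in> N" using \<delta>(2) t by simp
      then have W': "x + \<eta> t + \<gamma> s \<in> W" using oN by blast
      show "B (x + \<eta> t + \<gamma> s) \<in> topspace F" using B W' by blast
      show "has_dir_deriv F \<gamma> B (x + \<eta> t + \<gamma> s) (B1 (x + \<eta> t + \<gamma> s))" by (rule d1[OF W'])
      show "p (B1 (x + \<eta> t + \<gamma> s) - B1 x) \<le> e / 2" using N(2)[OF N'] by simp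
    qed
    then have "p (?q t - B1 x) < e" if "t \<noteq> 0" "\<bar>t\<bar> < \<delta>" for t
      using that e by fastforce
    then show "\<forall>\<^sub>F t in at 0. p (?q t - B1 x) < e"
      using \<delta>(1) by (auto simp: eventually_at dist_real_def)
  qed
  from limitin_add_seminorm[OF F this d2[unfolded has_dir_deriv_def]]
  have "limitin F (\<lambda>t. (1 / t) *\<^sub>R (B (x + \<eta> t + \<gamma> t) - B x)) (B1 x + l) (at 0)"
    by (simp add: scaleR_diff_right)
  moreover have "x + \<eta> t + \<gamma> t = x + (\<gamma> t + \<eta> t)" for t by (simp add: add.assoc comm)
  ultimately show ?thesis
    by (simp add: has_dir_deriv_def)
qed

section \<open>The topology on smooth maps\<close>

lemma deriv_map_in_topspace:
  "f \<in> smooth_maps U F \<Longrightarrow> z \<in> topspace (deriv_domain U i) \<Longrightarrow> deriv_map U F i f z \<in> topspace F"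
  using continuous_map_funspace[OF continuous_map_deriv_map[of f U F i]] by blast

lemma deriv_map_linear:
  assumes F: "seminorm_space F" and U: "open U" and f: "f \<in> smooth_maps U F" and g: "g \<in> smooth_maps U F"
    and z: "z \<in> topspace (deriv_domain U i)"
  shows "deriv_map U F i (f + g) z = deriv_map U F i f z + deriv_map U F i g z"
    and "deriv_map U F i (f - g) z = deriv_map U F i f z - deriv_map U F i g z"
    and "deriv_map U F i (c *\<^sub>R f) z = c *\<^sub>R deriv_map U F i f z"
proof -
  obtain x \<gamma>s where z': "z = (x, \<gamma>s)" "x \<in> U" and top: "\<gamma>s \<in> topspace (one_param_power i)"
    and \<gamma>s: "\<forall>k<i. \<gamma>s k \<in> \<LL>"
    using z by (rule deriv_domainE)
  note \<gamma>s = \<gamma>s[rule_format]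
  have lin: "iter_deriv F (a *\<^sub>R h + b *\<^sub>R k) \<gamma>s i x = a *\<^sub>R iter_deriv F h \<gamma>s i x + b *\<^sub>R iter_deriv F k \<gamma>s i x"
    if "h \<in> smooth_maps U F" "k \<in> smooth_maps U F" for a b h k
    by (rule smooth_maps_lincomb(2)[OF F U that z'(2) \<gamma>s])
  note d = deriv_map_apply[OF z'(2) top]
  show "deriv_map U F i (f + g) z = deriv_map U F i f z + deriv_map U F i g z"
    using lin[OF f g, where a = 1 and b = 1] by (simp add: z'(1) d)
  show "deriv_map U F i (f - g) z = deriv_map U F i f z - deriv_map U F i g z"
    using lin[OF f g, where a = 1 and b = "- 1"] by (simp add: z'(1) d)
  show "deriv_map U F i (c *\<^sub>R f) z = c *\<^sub>R deriv_map U F i f z"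
    using lin[OF f f, where a = c and b = 0] by (simp add: z'(1) d)
qed

lemma deriv_map_scaleR_diff:
  assumes F: "seminorm_space F" and U: "open U" and f: "f \<in> smooth_maps U F" and g: "g \<in> smooth_maps U F"
    and z: "z \<in> topspace (deriv_domain U i)"
  shows "deriv_map U F i (c *\<^sub>R (f - g)) z = c *\<^sub>R (deriv_map U F i f z - deriv_map U F i g z)"
proof -
  have "f - g \<in> smooth_maps U F" by (rule subspace_diff[OF subspace_smooth_maps[OF F U] f g])
  from deriv_map_linear(3)[OF F U this this z] show ?thesis
    using deriv_map_linear(2)[OF F U f g z] by metis
qed

text \<open>A subbasic set constrains one order of derivative through a compact-open neighbourhood.
  Intersections are absorbed by the larger bound on the order, unions of compact sets and sums of
  seminorms.\<close>

lemma openin_smooth_topology_seminorm: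
  assumes F: "seminorm_space F" and T: "openin (smooth_topology U F) T" and fT: "f \<in> T"
  obtains N K p where "\<And>i. compactin (deriv_domain U i) (K i)" "continuous_seminorm F p"
    "\<And>g. g \<in> smooth_maps U F \<Longrightarrow>
      \<forall>i<N. \<forall>z\<in>K i. p (deriv_map U F i g z - deriv_map U F i f z) < 1 \<Longrightarrow> g \<in> T"
proof -
  note S = seminorm_space_subspace[OF F]
  let ?C = "\<lambda>N K p g. \<forall>i<N::nat. \<forall>z\<in>K i. p (deriv_map U F i g z - deriv_map U F i f z) < 1"
  let ?Q = "\<lambda>T N K p. (\<forall>i. compactin (deriv_domain U i) (K i)) \<and> continuous_seminorm F p \<and>
    (\<forall>g\<in>smooth_maps U F. ?C N K p g \<longrightarrow> g \<in> T)"
  have f: "f \<in> smooth_maps U F"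
    using openin_subset[OF T] fT by auto
  have "\<exists>N K p. ?Q T N K p"
  proof (rule topology_generated_by_nbhd[OF T[unfolded smooth_topology_def] fT, where P = "\<lambda>T. \<exists>N K p. ?Q T N K p"])
    fix s assume "s \<in> {{f \<in> smooth_maps U F. deriv_map U F i f \<in> W} | i W.
        openin (compact_open_topology (deriv_domain U i) F) W}" and fs: "f \<in> s"
    then obtain i W where s: "s = {f \<in> smooth_maps U F. deriv_map U F i f \<in> W}"
      and W: "openin (compact_open_topology (deriv_domain U i) F) W" by blast
    have "deriv_map U F i f \<in> W" using fs unfolding s by blast
    then obtain K p where K: "compactin (deriv_domain U i) K" "continuous_seminorm F p"
      "\<And>g. g \<in> topspace (compact_open_topology (deriv_domain U i) F) \<Longrightarrow>
        (\<And>z. z \<in> K \<Longrightarrow> p (g z - deriv_map U F i f z) < 1) \<Longrightarrow> g \<in> W"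
      using openin_compact_open_seminorm[OF F W] by blast
    \<comment> \<open>The bound \<open>Suc i\<close> admits order \<open>i\<close>; the empty sets
      impose nothing in the other orders.\<close>
    have "?Q s (Suc i) (\<lambda>j. if j = i then K else {}) p"
    proof (intro conjI allI ballI impI K)
      show "compactin (deriv_domain U j) (if j = i then K else {})" for j
        using K by simp
      fix g assume g: "g \<in> smooth_maps U F" and less: "?C (Suc i) (\<lambda>j. if j = i then K else {}) p g"
      have "deriv_map U F i g \<in> W"
        by (rule K(3)[OF deriv_map_in_compact_open[OF g]]) (use less in auto)
      then show "g \<in> s" using g s by blast
    qed
    then show "\<exists>N K p. ?Q s N K p" by (intro exI)
  next
    fix a b assume "\<exists>N K p. ?Q a N K p" "\<exists>N K p. ?Q b N K p"
    then obtain N K p M L q where Q: "?Q a N K p" "?Q b M L q" by blast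
    have "?Q (a \<inter> b) (max N M) (\<lambda>i. K i \<union> L i) (\<lambda>x. p x + q x)"
    proof (intro conjI allI ballI impI)
      show "compactin (deriv_domain U i) (K i \<union> L i)" for i
        using Q by (intro compactin_Un) auto
      show "continuous_seminorm F (\<lambda>x. p x + q x)"
        using Q by (intro continuous_seminorm_add[OF S]) auto
      fix g assume g: "g \<in> smooth_maps U F"
        and less: "?C (max N M) (\<lambda>i. K i \<union> L i) (\<lambda>x. p x + q x) g"
      have nn: "0 \<le> p (deriv_map U F i g z - deriv_map U F i f z) \<and>
          0 \<le> q (deriv_map U F i g z - deriv_map U F i f z)" if "z \<in> K i \<union> L i" for i z
      proof -
        have "K i \<union> L i \<subseteq> topspace (deriv_domain U i)"
          using Q by (intro Un_least compactin_subset_topspace) auto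
        then have "z \<in> topspace (deriv_domain U i)" using that by blast
        then have "deriv_map U F i g z - deriv_map U F i f z \<in> topspace F"
          by (intro subspace_diff[OF S] deriv_map_in_topspace f g)
        then show ?thesis
          using Q by (simp add: seminorm_on_nonneg[OF continuous_seminorm_on S])
      qed
      have "?C N K p g"
      proof (intro allI impI ballI)
        fix i z assume "i < N" "z \<in> K i"
        then show "p (deriv_map U F i g z - deriv_map U F i f z) < 1"
          using less[rule_format, of i z] nn[of z i] by (simp add: less_max_iff_disj)
      qed
      moreover have "?C M L q g"
      proof (intro allI impI ballI)
        fix i z assume "i < M" "z \<in> L i"
        then show "q (deriv_map U F i g z - deriv_map U F i f z) < 1"
          using less[rule_format, of i z] nn[of z i] by (simp add: less_max_iff_disj)
      qed
      ultimately show "g \<in> a \<inter> b" using Q g by simp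
    qed
    then show "\<exists>N K p. ?Q (a \<inter> b) N K p" by (intro exI)
  next
    fix a b assume "\<exists>N K p. ?Q a N K p" and ab: "a \<subseteq> b"
    then obtain N K p where "?Q a N K p" by blast
    then have "?Q b N K p" using ab by blast
    then show "\<exists>N K p. ?Q b N K p" by (intro exI)
  qed
  then obtain N K p where "?Q T N K p" by blast
  then show thesis by (intro that[of K p N]) blast+
qed

lemma smooth_topology_nbhd_seminorm:
  assumes F: "seminorm_space F" and f: "f \<in> smooth_maps U F"
    and K: "compactin (deriv_domain U i) K" and p: "continuous_seminorm F p" and e: "0 < e"
  obtains T where "openin (smooth_topology U F) T" "f \<in> T"
    "\<And>g z. g \<in> T \<Longrightarrow> z \<in> K \<Longrightarrow> p (deriv_map U F i g z - deriv_map U F i f z) < e"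
proof -
  obtain W where W: "openin (compact_open_topology (deriv_domain U i) F) W" "deriv_map U F i f \<in> W"
    "\<And>g z. g \<in> W \<Longrightarrow> z \<in> K \<Longrightarrow> p (g z - deriv_map U F i f z) < e"
    by (rule compact_open_nbhd_seminorm[OF F deriv_map_in_compact_open[OF f] K p e]) (rule that)
  show thesis
  proof (rule that[of "{g \<in> smooth_maps U F. deriv_map U F i g \<in> W}"])
    show "openin (smooth_topology U F) {g \<in> smooth_maps U F. deriv_map U F i g \<in> W}"
      unfolding smooth_topology_def using W(1) by (intro topology_generated_by_Basis) blast
  qed (use W f in auto)
qed

text \<open>The \<open>0\<close> keeps the supremum meaningful when all \<open>K i\<close> are empty.\<close>

definition smooth_seminorm ::
    "'g::topological_group_add set \<Rightarrow> 'f::real_vector topology \<Rightarrow> ('f \<Rightarrow> real) \<Rightarrow> nat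
      \<Rightarrow> (nat \<Rightarrow> ('g \<times> (nat \<Rightarrow> real \<Rightarrow> 'g)) set) \<Rightarrow> ('g \<Rightarrow> 'f) \<Rightarrow> real"
  where "smooth_seminorm U F p N K f =
    Sup (insert 0 (\<Union>i<N. (\<lambda>z. p (deriv_map U F i f z)) ` K i))"

lemma smooth_seminorm_least:
  assumes "0 \<le> c" "\<And>i z. i < N \<Longrightarrow> z \<in> K i \<Longrightarrow> p (deriv_map U F i f z) \<le> c"
  shows "smooth_seminorm U F p N K f \<le> c"
  unfolding smooth_seminorm_def using assms by (intro cSup_least) auto

lemma smooth_seminorm_bdd:
  assumes F: "seminorm_space F" and p: "continuous_seminorm F p" and f: "f \<in> smooth_maps U F"
    and K: "\<And>i. compactin (deriv_domain U i) (K i)"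
  shows "bdd_above (insert 0 (\<Union>i<N. (\<lambda>z. p (deriv_map U F i f z)) ` K i))"
proof -
  have "bdd_above ((\<lambda>z. p (deriv_map U F i f z)) ` K i)" for i
  proof -
    have "continuous_map (deriv_domain U i) euclideanreal (\<lambda>z. p (deriv_map U F i f z))"
      using continuous_map_compose[OF continuous_map_deriv_map[OF f]
          continuous_map_seminorm_diff[OF F p subspace_0[OF seminorm_space_subspace[OF F]]]]
      by (simp add: o_def)
    from image_compactin[OF K this] have "compact ((\<lambda>z. p (deriv_map U F i f z)) ` K i)" by simp
    then show ?thesis by (simp add: bounded_imp_bdd_above compact_imp_bounded)
  qed
  then show ?thesis by (simp add: bdd_above_UN)
qed

lemma smooth_seminorm_upper:
  assumes F: "seminorm_space F" and p: "continuous_seminorm F p" and f: "f \<in> smooth_maps U F"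
    and K: "\<And>i. compactin (deriv_domain U i) (K i)" and "i < N" "z \<in> K i"
  shows "p (deriv_map U F i f z) \<le> smooth_seminorm U F p N K f"
  unfolding smooth_seminorm_def using assms(5,6)
  by (intro cSup_upper smooth_seminorm_bdd[OF F p f K]) auto

lemma smooth_seminorm_nonneg:
  assumes F: "seminorm_space F" and p: "continuous_seminorm F p" and f: "f \<in> smooth_maps U F"
    and K: "\<And>i. compactin (deriv_domain U i) (K i)"
  shows "0 \<le> smooth_seminorm U F p N K f"
  unfolding smooth_seminorm_def
  by (intro cSup_upper smooth_seminorm_bdd[OF F p f K]) auto

lemma continuous_seminorm_smooth_seminorm:
  assumes F: "seminorm_space F" and U: "open U" and p: "continuous_seminorm F p"
    and K: "\<And>i. compactin (deriv_domain U i) (K i)"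
  shows "continuous_seminorm (smooth_topology U F) (smooth_seminorm U F p N K)"
proof (rule continuous_seminormI)
  note S = seminorm_space_subspace[OF F] and s = continuous_seminorm_on[OF p]
  let ?\<sigma> = "smooth_seminorm U F p N K"
  note up = smooth_seminorm_upper[OF F p _ K] and nn = smooth_seminorm_nonneg[OF F p _ K]
  have Kt: "z \<in> topspace (deriv_domain U i)" if "z \<in> K i" for z i
    using compactin_subset_topspace[OF K] that by blast
  show subsp: "subspace (topspace (smooth_topology U F))"
    using subspace_smooth_maps[OF F U] by simp
  have scale_le: "?\<sigma> (c *\<^sub>R f) \<le> \<bar>c\<bar> * ?\<sigma> f" if f: "f \<in> smooth_maps U F" for c f
  proof (rule smooth_seminorm_least)
    show "0 \<le> \<bar>c\<bar> * ?\<sigma> f" using nn[OF f] by simp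
    fix i z assume i: "i < N" and z: "z \<in> K i"
    have "p (deriv_map U F i (c *\<^sub>R f) z) = \<bar>c\<bar> * p (deriv_map U F i f z)"
      unfolding deriv_map_linear(3)[OF F U f f Kt[OF z]]
      by (intro seminorm_on_scaleR[OF s] deriv_map_in_topspace f Kt z)
    then show "p (deriv_map U F i (c *\<^sub>R f) z) \<le> \<bar>c\<bar> * ?\<sigma> f"
      using up[OF f i z] by (simp add: mult_left_mono)
  qed
  have scale: "?\<sigma> (c *\<^sub>R f) = \<bar>c\<bar> * ?\<sigma> f" if f: "f \<in> smooth_maps U F" for c f
  proof (cases "c = 0")
    case True
    have "c *\<^sub>R f \<in> smooth_maps U F" by (rule subspace_scale[OF subspace_smooth_maps[OF F U] f])
    from nn[OF this, of N] show ?thesis using scale_le[OF f, of c] True by simp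
  next
    case False
    \<comment> \<open>The reverse inequality is \<open>scale_le\<close> for the factor
      \<open>1 / c\<close>.\<close>
    have "?\<sigma> ((1 / c) *\<^sub>R (c *\<^sub>R f)) \<le> \<bar>1 / c\<bar> * ?\<sigma> (c *\<^sub>R f)"
      by (rule scale_le[OF subspace_scale[OF subspace_smooth_maps[OF F U] f]])
    then have "?\<sigma> f \<le> \<bar>1 / c\<bar> * ?\<sigma> (c *\<^sub>R f)" using False by simp
    then have "\<bar>c\<bar> * ?\<sigma> f \<le> \<bar>c\<bar> * (\<bar>1 / c\<bar> * ?\<sigma> (c *\<^sub>R f))" by (rule mult_left_mono) simp
    also have "\<dots> = ?\<sigma> (c *\<^sub>R f)" using False by simp
    finally show ?thesis using scale_le[OF f, of c] by simp
  qed
  have add: "?\<sigma> (f + g) \<le> ?\<sigma> f + ?\<sigma> g" if f: "f \<in> smooth_maps U F" and g: "g \<in> smooth_maps U F" for f g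
  proof (rule smooth_seminorm_least)
    show "0 \<le> ?\<sigma> f + ?\<sigma> g" using nn[OF f] nn[OF g] by simp
    fix i z assume i: "i < N" and z: "z \<in> K i"
    have "p (deriv_map U F i (f + g) z) \<le> p (deriv_map U F i f z) + p (deriv_map U F i g z)"
      unfolding deriv_map_linear(1)[OF F U f g Kt[OF z]]
      by (intro seminorm_on_add[OF s] deriv_map_in_topspace f g Kt z)
    then show "p (deriv_map U F i (f + g) z) \<le> ?\<sigma> f + ?\<sigma> g"
      using up[OF f i z] up[OF g i z] by simp
  qed
  show "seminorm_on (topspace (smooth_topology U F)) ?\<sigma>"
    using add scale by (simp add: seminorm_on_def)
  fix f and e :: real assume "f \<in> topspace (smooth_topology U F)" and e: "0 < e"
  then have f: "f \<in> smooth_maps U F" by simp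
  let ?P = "\<lambda>i T. openin (smooth_topology U F) T \<and> f \<in> T \<and>
      (\<forall>g\<in>T. \<forall>z\<in>K i. p (deriv_map U F i g z - deriv_map U F i f z) < e / 2)"
  have "\<exists>T. ?P i T" for i
  proof (rule smooth_topology_nbhd_seminorm[OF F f K p half_gt_zero[OF e]])
    fix T assume "openin (smooth_topology U F) T" "f \<in> T"
      "\<And>g z. g \<in> T \<Longrightarrow> z \<in> K i \<Longrightarrow> p (deriv_map U F i g z - deriv_map U F i f z) < e / 2"
    then have "?P i T" by simp
    then show "\<exists>T. ?P i T" by (rule exI)
  qed
  then have "\<exists>T. \<forall>i. ?P i (T i)" by (intro choice allI)
  then obtain T where T': "\<And>i. ?P i (T i)" by blast
  have T: "openin (smooth_topology U F) (T i)" "f \<in> T i"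
    "g \<in> T i \<Longrightarrow> z \<in> K i \<Longrightarrow> p (deriv_map U F i g z - deriv_map U F i f z) < e / 2" for i g z
    using T'[of i] by auto
  \<comment> \<open>The index \<open>N\<close> is included so that the family is nonempty even for
    \<open>N = 0\<close>; membership in \<open>T 0\<close> then makes every element a smooth
    map.\<close>
  let ?T = "\<Inter>i\<in>{..N}. T i"
  have "openin (smooth_topology U F) ?T"
    using T(1) by (intro openin_Inter) auto
  moreover have "?\<sigma> (g - f) < e" if gT: "g \<in> ?T" for g
  proof -
    have g: "g \<in> smooth_maps U F"
      using gT openin_subset[OF T(1)[of 0]] by auto
    have "?\<sigma> (g - f) \<le> e / 2"
    proof (rule smooth_seminorm_least)
      fix i z assume i: "i < N" and z: "z \<in> K i"
      have "g \<in> T i" using gT i by simp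
      from T(3)[OF this z] show "p (deriv_map U F i (g - f) z) \<le> e / 2"
        unfolding deriv_map_linear(2)[OF F U g f Kt[OF z]] by simp
    qed (use e in simp)
    then show ?thesis using e by simp
  qed
  ultimately show "\<exists>T. openin (smooth_topology U F) T \<and> f \<in> T \<and> (\<forall>g\<in>T. ?\<sigma> (g - f) < e)"
    using T(2) by (intro exI[of _ ?T] conjI ballI) auto
qed

lemma smooth_seminorm_exists:
  assumes F: "seminorm_space F" and U: "open U" and p: "continuous_seminorm F p"
    and K: "compactin (deriv_domain U i) K"
  obtains r where "continuous_seminorm (smooth_topology U F) r"
    "\<And>f z. f \<in> smooth_maps U F \<Longrightarrow> z \<in> K \<Longrightarrow> p (deriv_map U F i f z) \<le> r f"
proof -
  let ?K = "\<lambda>j. if j = i then K else {}"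
  have K': "compactin (deriv_domain U j) (?K j)" for j using K by simp
  show thesis
  proof (rule that[OF continuous_seminorm_smooth_seminorm[OF F U p K', of "Suc i"]])
    fix f z assume "f \<in> smooth_maps U F" "z \<in> K"
    then show "p (deriv_map U F i f z) \<le> smooth_seminorm U F p (Suc i) ?K f"
      by (intro smooth_seminorm_upper[OF F p _ K']) auto
  qed
qed

text \<open>This closure property admits \<open>smooth_topology V E\<close> as a coefficient space.
  Neighbourhoods contain balls of \<open>smooth_seminorm\<close>, and values at single points, as
  derivatives of order 0, separate maps.\<close>

lemma seminorm_space_smooth_topology:
  assumes F: "seminorm_space F" and U: "open U"
  shows "seminorm_space (smooth_topology U F)"
proof -
  have nbhd: "\<exists>q. continuous_seminorm (smooth_topology U F) q \<and>
      {g \<in> topspace (smooth_topology U F). q (g - f) < 1} \<subseteq> T"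
    if T: "openin (smooth_topology U F) T" "f \<in> T" for T f
  proof -
    have f: "f \<in> smooth_maps U F" using openin_subset[OF T(1)] T(2) by auto
    obtain N K p where K: "\<And>i. compactin (deriv_domain U i) (K i)" and p: "continuous_seminorm F p"
      and KT: "\<And>g. g \<in> smooth_maps U F \<Longrightarrow>
        \<forall>i<N. \<forall>z\<in>K i. p (deriv_map U F i g z - deriv_map U F i f z) < 1 \<Longrightarrow> g \<in> T"
      by (rule openin_smooth_topology_seminorm[OF F T]) (rule that)
    let ?\<sigma> = "smooth_seminorm U F p N K"
    have "g \<in> T" if g: "g \<in> smooth_maps U F" and less: "?\<sigma> (g - f) < 1" for g
    proof (rule KT[OF g], intro allI impI ballI)
      fix i z assume i: "i < N" and z: "z \<in> K i"
      then have zt: "z \<in> topspace (deriv_domain U i)" using compactin_subset_topspace[OF K] by blast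
      have "g - f \<in> smooth_maps U F" by (rule subspace_diff[OF subspace_smooth_maps[OF F U] g f])
      then have "p (deriv_map U F i (g - f) z) \<le> ?\<sigma> (g - f)"
        by (rule smooth_seminorm_upper[OF F p _ K i z])
      then show "p (deriv_map U F i g z - deriv_map U F i f z) < 1"
        using less by (simp add: deriv_map_linear(2)[OF F U g f zt])
    qed
    then show ?thesis
      using continuous_seminorm_smooth_seminorm[OF F U p K, of N] by (intro exI[of _ ?\<sigma>]) auto
  qed
  have sep: "f = 0" if f: "f \<in> smooth_maps U F"
    and z: "\<And>q. continuous_seminorm (smooth_topology U F) q \<Longrightarrow> q f = 0" for f
  proof
    fix x
    show "f x = 0 x"
    proof (cases "x \<in> U")
      case False
      then show ?thesis using smooth_maps_zero[OF f] by simp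
    next
      case True
      let ?z = "(x, \<lambda>_. undefined)"
      have zt: "?z \<in> topspace (deriv_domain U 0)" using True by (simp add: topspace_deriv_domain)
      then have fz: "deriv_map U F 0 f ?z = f x" by (simp add: deriv_map_def)
      have fx: "f x \<in> topspace F" using deriv_map_in_topspace[OF f zt] fz by simp
      have "f x = 0"
      proof (rule seminorm_space_eqI[OF F fx subspace_0[OF seminorm_space_subspace[OF F]]])
        fix p and e :: real assume p: "continuous_seminorm F p" and e: "0 < e"
        have "compactin (deriv_domain U 0) {?z}" using zt by (intro finite_imp_compactin) auto
        then obtain r where r: "continuous_seminorm (smooth_topology U F) r"
          "\<And>f z. f \<in> smooth_maps U F \<Longrightarrow> z \<in> {?z} \<Longrightarrow> p (deriv_map U F 0 f z) \<le> r f"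
          by (rule smooth_seminorm_exists[OF F U p]) (rule that)
        show "p (f x - 0) \<le> e" using r(2)[OF f, of ?z] z[OF r(1)] fz e by simp
      qed
      then show ?thesis by simp
    qed
  qed
  have "subspace (topspace (smooth_topology U F))"
    using subspace_smooth_maps[OF F U] by simp
  then show ?thesis
    unfolding seminorm_space_def
    by (intro conjI allI impI ballI nbhd sep) (assumption | simp)+
qed

text \<open>Continuity of \<open>q\<close> at \<open>0\<close> gives control on a neighbourhood, and
  homogeneity turns it into a bound for all \<open>f\<close>. Stating it with a bound
  \<open>c\<close> avoids forming the maximum of the derivatives over the compact sets.\<close>

lemma smooth_seminorm_dominated:
  assumes F: "seminorm_space F" and U: "open U" and q: "continuous_seminorm (smooth_topology U F) q"
  obtains N K p where "\<And>i. compactin (deriv_domain U i) (K i)" "continuous_seminorm F p"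
    "\<And>f c. f \<in> smooth_maps U F \<Longrightarrow> 0 \<le> c \<Longrightarrow>
      \<forall>i<N. \<forall>z\<in>K i. p (deriv_map U F i f z) \<le> c \<Longrightarrow> q f \<le> c"
proof -
  note S = seminorm_space_subspace[OF F] and Ss = subspace_smooth_maps[OF F U]
  note sq = continuous_seminorm_on[OF q, simplified]
  have z0: "0 \<in> smooth_maps U F" by (rule subspace_0[OF Ss])
  have "openin (smooth_topology U F) {g \<in> topspace (smooth_topology U F). q (g - 0) < 1}"
    by (rule openin_seminorm_ball[OF q]) (use z0 in auto)
  moreover have "0 \<in> {g \<in> topspace (smooth_topology U F). q (g - 0) < 1}"
    using z0 seminorm_on_zero[OF sq Ss] by simp
  ultimately obtain N K p where K: "\<And>i. compactin (deriv_domain U i) (K i)" and p: "continuous_seminorm F p"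
    and KT: "\<And>g. g \<in> smooth_maps U F \<Longrightarrow>
      \<forall>i<N. \<forall>z\<in>K i. p (deriv_map U F i g z - deriv_map U F i 0 z) < 1 \<Longrightarrow>
      g \<in> {g \<in> topspace (smooth_topology U F). q (g - 0) < 1}"
    by (rule openin_smooth_topology_seminorm[OF F]) (rule that)
  show thesis
  proof (rule that[OF K p])
    fix f and c :: real assume f: "f \<in> smooth_maps U F" and c: "0 \<le> c"
      and le: "\<forall>i<N. \<forall>z\<in>K i. p (deriv_map U F i f z) \<le> c"
    show "q f \<le> c"
    proof (rule field_le_epsilon)
      fix e :: real assume e: "0 < e"
      \<comment> \<open>Scaled so that all relevant derivatives have seminorm at most
        \<open>c / (c + e) < 1\<close>; \<open>e\<close> keeps the factor meaningful for
        \<open>c = 0\<close>.\<close>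
      let ?g = "(1 / (c + e)) *\<^sub>R f"
      have "?g \<in> {g \<in> topspace (smooth_topology U F). q (g - 0) < 1}"
      proof (rule KT[OF subspace_scale[OF subspace_smooth_maps[OF F U] f]], intro allI impI ballI)
        fix i z assume i: "i < N" and z: "z \<in> K i"
        then have zt: "z \<in> topspace (deriv_domain U i)" using compactin_subset_topspace[OF K] by blast
        have "deriv_map U F i 0 z = 0"
          using deriv_map_linear(3)[OF F U f f zt, of 0] by simp
        moreover have "p (deriv_map U F i ?g z) = \<bar>1 / (c + e)\<bar> * p (deriv_map U F i f z)"
          unfolding deriv_map_linear(3)[OF F U f f zt]
          by (intro seminorm_on_scaleR[OF continuous_seminorm_on[OF p]] deriv_map_in_topspace f zt)
        moreover have "\<dots> < 1" using le[rule_format, OF i z] c e by simp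
        ultimately show "p (deriv_map U F i ?g z - deriv_map U F i 0 z) < 1" by simp
      qed
      then have "q ?g < 1" by simp
      moreover have "q ?g = \<bar>1 / (c + e)\<bar> * q f" by (rule seminorm_on_scaleR[OF sq f])
      ultimately show "q f \<le> c + e" using c e by (simp add: field_simps)
    qed
  qed
qed

text \<open>Domination reduces each seminorm of the space to finitely many derivatives on compact
  sets, so each order, compact set and seminorm of \<open>F\<close> can be treated by
  itself.\<close>

lemma limitin_smooth_topology:
  assumes F: "seminorm_space F" and U: "open U" and l: "l \<in> smooth_maps U F"
    and h: "eventually (\<lambda>t. h t \<in> smooth_maps U F) net"
    and lim: "\<And>i K p e. compactin (deriv_domain U i) K \<Longrightarrow> continuous_seminorm F p \<Longrightarrow> 0 < e \<Longrightarrow>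
      eventually (\<lambda>t. \<forall>z\<in>K. p (deriv_map U F i (h t) z - deriv_map U F i l z) < e) net"
  shows "limitin (smooth_topology U F) h l net"
  unfolding limitin_seminorm[OF seminorm_space_smooth_topology[OF F U]]
proof (intro conjI allI impI)
  show "l \<in> topspace (smooth_topology U F)" "\<forall>\<^sub>F t in net. h t \<in> topspace (smooth_topology U F)"
    using l h by simp_all
  fix q and e :: real assume q: "continuous_seminorm (smooth_topology U F) q" and e: "0 < e"
  obtain N K p where K: "\<And>i. compactin (deriv_domain U i) (K i)" and p: "continuous_seminorm F p"
    and dom: "\<And>f c. f \<in> smooth_maps U F \<Longrightarrow> 0 \<le> c \<Longrightarrow>
      \<forall>i<N. \<forall>z\<in>K i. p (deriv_map U F i f z) \<le> c \<Longrightarrow> q f \<le> c"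
    by (rule smooth_seminorm_dominated[OF F U q]) (rule that)
  have "eventually (\<lambda>t. \<forall>i\<in>{..<N}. \<forall>z\<in>K i. p (deriv_map U F i (h t) z - deriv_map U F i l z) < e / 2) net"
    using lim[OF K p half_gt_zero[OF e]] by (intro eventually_ball_finite) auto
  with h show "\<forall>\<^sub>F t in net. q (h t - l) < e"
  proof eventually_elim
    case (elim t)
    have "q (h t - l) \<le> e / 2"
    proof (rule dom[rule_format])
      show "h t - l \<in> smooth_maps U F" by (rule subspace_diff[OF subspace_smooth_maps[OF F U] elim(1) l])
      fix i z assume i: "i < N" and z: "z \<in> K i"
      then have zt: "z \<in> topspace (deriv_domain U i)" using compactin_subset_topspace[OF K] by blast
      show "p (deriv_map U F i (h t - l) z) \<le> e / 2"
        unfolding deriv_map_linear(2)[OF F U elim(1) l zt] using elim(2) i z by (simp add: less_imp_le)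
    qed (use e in simp)
    then show ?case using e by simp
  qed
qed

text \<open>Joint continuity of a derivative in the parameter and in its own arguments becomes, by
  the tube lemma, uniform on compact sets of arguments.\<close>

lemma continuous_map_into_smooth_topology:
  assumes F: "seminorm_space F" and U: "open U" and a: "a \<in> topspace X \<rightarrow> smooth_maps U F"
    and cont: "\<And>i. continuous_map (prod_topology X (deriv_domain U i)) F (\<lambda>(x, z). deriv_map U F i (a x) z)"
  shows "continuous_map X (smooth_topology U F) a"
  unfolding continuous_map_atin
proof
  fix x assume x: "x \<in> topspace X"
  show "limitin (smooth_topology U F) a (a x) (atin X x)"
  proof (rule limitin_smooth_topology[OF F U])
    show "a x \<in> smooth_maps U F" using a x by blast
    show "\<forall>\<^sub>F t in atin X x. a t \<in> smooth_maps U F"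
      unfolding eventually_atin using a by (intro disjI2 exI[of _ "topspace X"]) (use x in auto)
    fix i K p and e :: real
    assume K: "compactin (deriv_domain U i) K" and p: "continuous_seminorm F p" and e: "0 < e"
    obtain N where "openin X N" "x \<in> N"
      "\<And>x' y. x' \<in> N \<Longrightarrow> y \<in> K \<Longrightarrow> p (deriv_map U F i (a x') y - deriv_map U F i (a x) y) < e"
      using continuous_map_uniform_compact[OF F cont K x p e] by (simp only: prod.case) blast
    then show "\<forall>\<^sub>F t in atin X x. \<forall>z\<in>K. p (deriv_map U F i (a t) z - deriv_map U F i (a x) z) < e"
      unfolding eventually_atin by blast
  qed
qed

text \<open>A partial converse, yielding uniformity on compact sets instead of joint continuity.
  This is the form that \<open>continuous_on_compact_evaluation\<close> takes as input.\<close>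

lemma continuous_map_smooth_topology_uniform:
  assumes F: "seminorm_space F" and U: "open U" and a: "continuous_map X (smooth_topology U F) a"
    and x: "x \<in> topspace X" and K: "compactin (deriv_domain U i) K" and p: "continuous_seminorm F p" and e: "0 < e"
  shows "\<exists>N. openin X N \<and> x \<in> N \<and> (\<forall>x'\<in>N. \<forall>z\<in>K. p (deriv_map U F i (a x') z - deriv_map U F i (a x) z) < e)"
proof -
  have ax: "a x' \<in> smooth_maps U F" if "x' \<in> topspace X" for x'
    using continuous_map_funspace[OF a] that by auto
  obtain r where r: "continuous_seminorm (smooth_topology U F) r"
    "\<And>f z. f \<in> smooth_maps U F \<Longrightarrow> z \<in> K \<Longrightarrow> p (deriv_map U F i f z) \<le> r f"
    by (rule smooth_seminorm_exists[OF F U p K]) (rule that)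
  obtain N where N: "openin X N" "x \<in> N" "\<forall>x'\<in>N. r (a x' - a x) < e"
    using a[unfolded continuous_map_seminorm[OF seminorm_space_smooth_topology[OF F U]], THEN conjunct2,
        rule_format, OF x r(1) e] by blast
  have "p (deriv_map U F i (a x') z - deriv_map U F i (a x) z) < e" if x': "x' \<in> N" and z: "z \<in> K" for x' z
  proof -
    have zt: "z \<in> topspace (deriv_domain U i)" using compactin_subset_topspace[OF K] z by blast
    have x't: "x' \<in> topspace X" using openin_subset[OF N(1)] x' by blast
    have "a x' - a x \<in> smooth_maps U F"
      by (intro subspace_diff[OF subspace_smooth_maps[OF F U]] ax x x't)
    then show ?thesis
      using r(2)[OF _ z] N(3) x' by (fastforce simp: deriv_map_linear(2)[OF F U ax[OF x't] ax[OF x] zt, symmetric])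
  qed
  with N show ?thesis by blast
qed

text \<open>By additivity, continuity at \<open>f\<close> becomes a bound for the image of
  \<open>g - f\<close>, and it is enough to bound one derivative on one compact set at a time.
  Currying and uncurrying are both treated in this way.\<close>

lemma continuous_linear_map_into_smooth_topology:
  assumes F: "seminorm_space F" and U: "open U" and X: "seminorm_space X"
    and \<phi>: "\<phi> \<in> topspace X \<rightarrow> smooth_maps U F"
    and diff: "\<And>f g. f \<in> topspace X \<Longrightarrow> g \<in> topspace X \<Longrightarrow> \<phi> (f - g) = \<phi> f - \<phi> g"
    and bound: "\<And>i K p. compactin (deriv_domain U i) K \<Longrightarrow> continuous_seminorm F p \<Longrightarrow>
      \<exists>r. continuous_seminorm X r \<and> (\<forall>f\<in>topspace X. \<forall>z\<in>K. p (deriv_map U F i (\<phi> f) z) \<le> r f)"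
  shows "continuous_map X (smooth_topology U F) \<phi>"
  unfolding continuous_map_seminorm[OF seminorm_space_smooth_topology[OF F U]]
proof (intro conjI ballI allI impI)
  note S = seminorm_space_subspace[OF X]
  show "\<phi> \<in> topspace X \<rightarrow> topspace (smooth_topology U F)" using \<phi> by simp
  fix f q and e :: real
  assume f: "f \<in> topspace X" and q: "continuous_seminorm (smooth_topology U F) q" and e: "0 < e"
  obtain N K p where K: "\<And>i. compactin (deriv_domain U i) (K i)" and p: "continuous_seminorm F p"
    and dom: "\<And>f c. f \<in> smooth_maps U F \<Longrightarrow> 0 \<le> c \<Longrightarrow>
      \<forall>i<N. \<forall>z\<in>K i. p (deriv_map U F i f z) \<le> c \<Longrightarrow> q f \<le> c"
    by (rule smooth_seminorm_dominated[OF F U q]) (rule that)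
  have "\<exists>r. \<forall>i. continuous_seminorm X (r i) \<and> (\<forall>f\<in>topspace X. \<forall>z\<in>K i. p (deriv_map U F i (\<phi> f) z) \<le> r i f)"
    using bound[OF K p] by (intro choice allI)
  then obtain r where r: "\<And>i. continuous_seminorm X (r i)"
    "\<And>i f z. f \<in> topspace X \<Longrightarrow> z \<in> K i \<Longrightarrow> p (deriv_map U F i (\<phi> f) z) \<le> r i f"
    by blast
  define R where "R g = (\<Sum>i<N. r i g)" for g
  have R: "continuous_seminorm X R"
    unfolding R_def by (intro continuous_seminorm_sum[OF S] r) simp
  let ?B = "{g \<in> topspace X. R (g - f) < e}"
  have "q (\<phi> g - \<phi> f) < e" if g: "g \<in> ?B" for g
  proof -
    have gf: "g - f \<in> topspace X" using g f by (intro subspace_diff[OF S]) auto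
    have "q (\<phi> (g - f)) \<le> R (g - f)"
    proof (rule dom[rule_format])
      show "\<phi> (g - f) \<in> smooth_maps U F" using \<phi> gf by blast
      show "0 \<le> R (g - f)" by (rule seminorm_on_nonneg[OF continuous_seminorm_on[OF R] S gf])
      fix i z assume i: "i < N" and z: "z \<in> K i"
      have "p (deriv_map U F i (\<phi> (g - f)) z) \<le> r i (g - f)" by (rule r(2)[OF gf z])
      also have "\<dots> \<le> R (g - f)"
        unfolding R_def using i
        by (intro member_le_sum seminorm_on_nonneg[OF continuous_seminorm_on[OF r(1)] S gf]) auto
      finally show "p (deriv_map U F i (\<phi> (g - f)) z) \<le> R (g - f)" .
    qed
    then show ?thesis using g f by (simp add: diff)
  qed
  moreover have "openin X ?B" by (rule openin_seminorm_ball[OF R f e])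
  moreover have "f \<in> ?B" using f e seminorm_on_zero[OF continuous_seminorm_on[OF R] S] by simp
  ultimately show "\<exists>T. openin X T \<and> f \<in> T \<and> (\<forall>g\<in>T. q (\<phi> g - \<phi> f) < e)" by blast
qed

section \<open>Maps between spaces of one-parameter subgroups\<close>

lemma one_param_compose:
  assumes "continuous_on UNIV f" "\<And>x y. f (x + y) = f x + f y" "\<gamma> \<in> \<LL>"
  shows "(\<lambda>t. f (\<gamma> t)) \<in> \<LL>"
  using assms by (auto simp: one_param_subgroups_def intro: continuous_on_compose2)

text \<open>Under composition with a continuous homomorphism \<open>f\<close>, the subbasic set
  given by \<open>K\<close> and \<open>W\<close> pulls back to the one given by \<open>K\<close> and
  the preimage of \<open>W\<close>.\<close>

lemma continuous_map_one_param_compose: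
  fixes f :: "'g::topological_group_add \<Rightarrow> 'k::topological_group_add"
  assumes f: "continuous_on UNIV f" and add: "\<And>x y. f (x + y) = f x + f y"
  shows "continuous_map one_param_topology one_param_topology (\<lambda>\<gamma> t. f (\<gamma> t))"
proof -
  let ?X = "compact_open_topology (euclidean :: real topology) (euclidean :: 'g topology)"
  let ?Y = "compact_open_topology (euclidean :: real topology) (euclidean :: 'k topology)"
  have topX: "topspace ?X = {\<gamma>. continuous_on UNIV \<gamma>}" and topY: "topspace ?Y = {\<gamma>. continuous_on UNIV \<gamma>}"
    by (auto simp: topspace_compact_open_topology)
  have cf: "continuous_on UNIV (\<lambda>t. f (\<gamma> t))" if "continuous_on UNIV \<gamma>" for \<gamma> :: "real \<Rightarrow> 'g"
    by (rule continuous_on_compose2[OF f that]) auto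
  have "continuous_map ?X ?Y (\<lambda>\<gamma> t. f (\<gamma> t))"
    unfolding compact_open_topology_def[of euclidean "euclidean :: 'k topology"]
  proof (rule continuous_on_generated_topo)
    fix T :: "(real \<Rightarrow> 'k) set"
    assume "T \<in> {{\<gamma> \<in> extensional (topspace euclidean). continuous_map euclidean euclidean \<gamma> \<and> \<gamma> ` K \<subseteq> W} | K W.
      compactin euclidean K \<and> openin euclidean W}"
    then obtain K W where
      T: "T = {\<gamma> \<in> extensional (topspace euclidean). continuous_map euclidean euclidean \<gamma> \<and> \<gamma> ` K \<subseteq> W}"
      and K: "compactin euclidean K" and W: "openin euclidean W" by blast
    have "open (f -` W)" using f W by (simp add: continuous_on_open_vimage)
    then have "openin ?X {\<gamma> \<in> extensional (topspace euclidean). continuous_map euclidean euclidean \<gamma> \<and> \<gamma> ` K \<subseteq> f -` W}"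
      unfolding compact_open_topology_def using K by (intro topology_generated_by_Basis) auto
    moreover have "(\<lambda>\<gamma> t. f (\<gamma> t)) -` T \<inter> topspace ?X =
        {\<gamma> \<in> extensional (topspace euclidean). continuous_map euclidean euclidean \<gamma> \<and> \<gamma> ` K \<subseteq> f -` W}"
      unfolding topX by (auto simp: T cf)
    ultimately show "openin ?X ((\<lambda>\<gamma> t. f (\<gamma> t)) -` T \<inter> topspace ?X)"
      by simp
  next
    show "(\<lambda>\<gamma> t. f (\<gamma> t)) ` topspace ?X \<subseteq>
        \<Union>{{\<gamma> \<in> extensional (topspace euclidean). continuous_map euclidean euclidean \<gamma> \<and> \<gamma> ` K \<subseteq> W} | K W.
          compactin euclidean K \<and> openin euclidean W}"
      unfolding topology_generated_by_topspace[symmetric] compact_open_topology_def[symmetric] topX topY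
      by (auto simp: cf)
  qed
  then have "continuous_map (subtopology ?X \<LL>) ?Y (\<lambda>\<gamma> t. f (\<gamma> t))"
    by (rule continuous_map_from_subtopology)
  moreover have "(\<lambda>\<gamma> t. f (\<gamma> t)) \<in> topspace (subtopology ?X \<LL>) \<rightarrow> \<LL>"
    using one_param_compose[OF f add] by auto
  ultimately show ?thesis
    unfolding one_param_topology_def continuous_map_in_subtopology by blast
qed

lemma continuous_map_one_param_component:
  "k < i \<Longrightarrow> continuous_map (one_param_power i) one_param_topology (\<lambda>\<gamma>s. \<gamma>s k)"
  unfolding one_param_power_def by (rule continuous_map_product_projection) simp

lemma continuous_map_fst':
    "continuous_map Z (prod_topology X Y) f \<Longrightarrow> continuous_map Z X (\<lambda>z. fst (f z))"
  and continuous_map_snd':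
    "continuous_map Z (prod_topology X Y) f \<Longrightarrow> continuous_map Z Y (\<lambda>z. snd (f z))"
  by (simp_all add: continuous_map_pairwise o_def)

lemma continuous_map_deriv_domain_base:
  "continuous_map X (deriv_domain V j) h \<Longrightarrow> continuous_map X (top_of_set V) (\<lambda>z. fst (h z))"
  unfolding deriv_domain_def by (rule continuous_map_fst')

lemma continuous_map_deriv_domain_component:
  assumes "continuous_map X (deriv_domain V j) h" "k < j"
  shows "continuous_map X one_param_topology (\<lambda>z. snd (h z) k)"
  using continuous_map_compose[OF continuous_map_snd'[OF assms(1)[unfolded deriv_domain_def]]
      continuous_map_one_param_component[OF assms(2)]] by (simp add: o_def)

lemma continuous_map_into_deriv_domain:
  assumes "continuous_map X (top_of_set U) a" "\<And>k. k < n \<Longrightarrow> continuous_map X one_param_topology (c k)"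
  shows "continuous_map X (deriv_domain U n) (\<lambda>z. (a z, \<lambda>k\<in>{..<n}. c k z))"
proof -
  have "continuous_map X (one_param_power n) (\<lambda>z. \<lambda>k\<in>{..<n}. c k z)"
    unfolding one_param_power_def continuous_map_componentwise
    by (auto intro: continuous_map_eq[OF assms(2)])
  then show ?thesis
    using assms(1) by (simp add: deriv_domain_def continuous_map_paired)
qed

section \<open>Currying a smooth map\<close>

definition dir_fst :: "(real \<Rightarrow> 'g) \<Rightarrow> real \<Rightarrow> 'g \<times> 'h::zero"
  where "dir_fst \<gamma> t = (\<gamma> t, 0)"

definition dir_snd :: "(real \<Rightarrow> 'h) \<Rightarrow> real \<Rightarrow> 'g::zero \<times> 'h"
  where "dir_snd \<eta> t = (0, \<eta> t)"

lemma dir_fst_one_param: "\<gamma> \<in> \<LL> \<Longrightarrow> dir_fst \<gamma> \<in> \<LL>"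
  unfolding dir_fst_def[abs_def]
  by (rule one_param_compose[where f = "\<lambda>x. (x, 0)"]) (auto intro!: continuous_on_Pair continuous_on_fst continuous_on_snd)

lemma dir_snd_one_param: "\<eta> \<in> \<LL> \<Longrightarrow> dir_snd \<eta> \<in> \<LL>"
  unfolding dir_snd_def[abs_def]
  by (rule one_param_compose[where f = "\<lambda>y. (0, y)"]) (auto intro!: continuous_on_Pair continuous_on_fst continuous_on_snd)

lemma fst_one_param: "\<zeta> \<in> \<LL> \<Longrightarrow> (\<lambda>t. fst (\<zeta> t)) \<in> \<LL>"
  by (rule one_param_compose) (auto intro!: continuous_on_Pair continuous_on_fst continuous_on_snd)

lemma snd_one_param: "\<zeta> \<in> \<LL> \<Longrightarrow> (\<lambda>t. snd (\<zeta> t)) \<in> \<LL>"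
  by (rule one_param_compose) (auto intro!: continuous_on_Pair continuous_on_fst continuous_on_snd)

lemma continuous_map_dir_fst: "continuous_map one_param_topology one_param_topology dir_fst"
  unfolding dir_fst_def[abs_def]
  by (rule continuous_map_one_param_compose[where f = "\<lambda>x. (x, 0)"]) (auto intro!: continuous_on_Pair continuous_on_fst continuous_on_snd)

lemma continuous_map_dir_snd: "continuous_map one_param_topology one_param_topology dir_snd"
  unfolding dir_snd_def[abs_def]
  by (rule continuous_map_one_param_compose[where f = "\<lambda>y. (0, y)"]) (auto intro!: continuous_on_Pair continuous_on_fst continuous_on_snd)

lemma continuous_map_fst_one_param:
  "continuous_map one_param_topology one_param_topology (\<lambda>\<zeta> t. fst (\<zeta> t))"
  by (rule continuous_map_one_param_compose) (auto intro!: continuous_on_Pair continuous_on_fst continuous_on_snd)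

lemma continuous_map_snd_one_param:
  "continuous_map one_param_topology one_param_topology (\<lambda>\<zeta> t. snd (\<zeta> t))"
  by (rule continuous_map_one_param_compose) (auto intro!: continuous_on_Pair continuous_on_fst continuous_on_snd)

lemma add_dir_fst: "(x, y :: 'h::group_add) + dir_fst \<gamma> t = (x + \<gamma> t, y)"
  by (simp add: dir_fst_def)

lemma add_dir_snd: "(x :: 'g::group_add, y) + dir_snd \<eta> t = (x, y + \<eta> t)"
  by (simp add: dir_snd_def)

lemma dir_fst_snd_commute:
  "dir_fst \<gamma> s + dir_snd \<eta> t = dir_snd \<eta> t + (dir_fst \<gamma> s :: 'g::group_add \<times> 'h::group_add)"
  by (simp add: dir_fst_def dir_snd_def)

definition mixed_dirs ::
    "nat \<Rightarrow> (nat \<Rightarrow> real \<Rightarrow> 'g::zero) \<Rightarrow> (nat \<Rightarrow> real \<Rightarrow> 'h::zero) \<Rightarrow> nat \<Rightarrow> real \<Rightarrow> 'g \<times> 'h"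
  where "mixed_dirs i \<gamma>s \<eta>s k = (if k < i then dir_fst (\<gamma>s k) else dir_snd (\<eta>s (k - i)))"

text \<open>\<open>iter_deriv\<close> applies the direction with index 0 first, so this is the
  normal form: \<open>i\<close> derivatives along \<open>G\<close>, followed by \<open>j\<close>
  along \<open>H\<close>. At \<open>(x, y)\<close> it will be the derivative of order
  \<open>j\<close> at \<open>y\<close> of the derivative of order \<open>i\<close> at
  \<open>x\<close> of the curried map.\<close>

definition mixed_deriv ::
    "'e::real_vector topology \<Rightarrow> ('g \<times> 'h \<Rightarrow> 'e) \<Rightarrow> nat \<Rightarrow> nat
      \<Rightarrow> (nat \<Rightarrow> real \<Rightarrow> 'g::topological_group_add) \<Rightarrow> (nat \<Rightarrow> real \<Rightarrow> 'h::topological_group_add) \<Rightarrow> 'g \<times> 'h \<Rightarrow> 'e"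
  where "mixed_deriv E f i j \<gamma>s \<eta>s = iter_deriv E f (mixed_dirs i \<gamma>s \<eta>s) (i + j)"

lemma mixed_dirs_one_param:
  assumes "\<And>k. k < i \<Longrightarrow> \<gamma>s k \<in> \<LL>" "\<And>k. k < j \<Longrightarrow> \<eta>s k \<in> \<LL>" "k < i + j"
  shows "mixed_dirs i \<gamma>s \<eta>s k \<in> \<LL>"
  using assms by (simp add: mixed_dirs_def dir_fst_one_param dir_snd_one_param)

lemma continuous_map_mixed_dirs:
  assumes c: "\<And>k. k < i \<Longrightarrow> continuous_map X one_param_topology (c k)"
    and d: "\<And>k. k < j \<Longrightarrow> continuous_map X one_param_topology (d k)" and k: "k < i + j"
  shows "continuous_map X one_param_topology (\<lambda>z. mixed_dirs i (\<lambda>k. c k z) (\<lambda>k. d k z) k)"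
proof (cases "k < i")
  case True
  then show ?thesis
    using continuous_map_compose[OF c continuous_map_dir_fst] by (simp add: mixed_dirs_def o_def)
next
  case False
  then have "k - i < j" using k by simp
  from continuous_map_compose[OF d[OF this] continuous_map_dir_snd] False show ?thesis
    by (simp add: mixed_dirs_def o_def)
qed

lemma continuous_map_mixed_deriv:
  assumes f: "f \<in> smooth_maps (U \<times> V) E"
    and a: "continuous_map X (top_of_set U) a" and b: "continuous_map X (top_of_set V) b"
    and c: "\<And>k. k < i \<Longrightarrow> continuous_map X one_param_topology (c k)"
    and d: "\<And>k. k < j \<Longrightarrow> continuous_map X one_param_topology (d k)"
  shows "continuous_map X E (\<lambda>z. mixed_deriv E f i j (\<lambda>k. c k z) (\<lambda>k. d k z) (a z, b z))"
proof -
  have ab: "continuous_map X (top_of_set (U \<times> V)) (\<lambda>z. (a z, b z))"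
    using continuous_map_pairedI[OF a b] by simp
  show ?thesis
    unfolding mixed_deriv_def
    by (rule continuous_map_iter_deriv[OF f ab continuous_map_mixed_dirs[OF c d]])
qed

lemma continuous_map_mixed_deriv_base:
  assumes f: "f \<in> smooth_maps (U \<times> V) E"
    and "\<And>k. k < i \<Longrightarrow> \<gamma>s k \<in> \<LL>" "\<And>k. k < j \<Longrightarrow> \<eta>s k \<in> \<LL>"
  shows "continuous_map (top_of_set (U \<times> V)) E (mixed_deriv E f i j \<gamma>s \<eta>s)"
  unfolding mixed_deriv_def
  by (rule continuous_map_iter_deriv_base[OF f]) (rule mixed_dirs_one_param[OF assms(2,3)])

lemma mixed_deriv_in_topspace:
  assumes "f \<in> smooth_maps (U \<times> V) E" "\<And>k. k < i \<Longrightarrow> \<gamma>s k \<in> \<LL>" "\<And>k. k < j \<Longrightarrow> \<eta>s k \<in> \<LL>"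
  shows "mixed_deriv E f i j \<gamma>s \<eta>s \<in> U \<times> V \<rightarrow> topspace E"
  using continuous_map_funspace[OF continuous_map_mixed_deriv_base[OF assms]] by simp

lemma has_dir_deriv_mixed_snd:
  assumes E: "seminorm_space E" and f: "f \<in> smooth_maps (U \<times> V) E" and w: "w \<in> U \<times> V"
    and \<gamma>s: "\<And>k. k < i \<Longrightarrow> \<gamma>s k \<in> \<LL>" and \<eta>s: "\<And>k. k \<le> j \<Longrightarrow> \<eta>s k \<in> \<LL>"
  shows "has_dir_deriv E (dir_snd (\<eta>s j)) (mixed_deriv E f i j \<gamma>s \<eta>s) w (mixed_deriv E f i (Suc j) \<gamma>s \<eta>s w)"
proof -
  have "mixed_dirs i \<gamma>s \<eta>s k \<in> \<LL>" if "k \<le> i + j" for k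
    by (rule mixed_dirs_one_param[where j = "Suc j"]) (use \<gamma>s \<eta>s that in auto)
  from smooth_maps_deriv[OF E f w, of "i + j" "mixed_dirs i \<gamma>s \<eta>s", OF this] show ?thesis
    by (simp add: mixed_deriv_def mixed_dirs_def[of i \<gamma>s \<eta>s "i + j"] del: iter_deriv.simps)
qed

text \<open>By Schwarz' theorem a derivative in the first variable, taken last, can be moved in front of all
  derivatives in the second variable.\<close>

lemma has_dir_deriv_mixed_fst:
  fixes U :: "'g::topological_group_add set" and V :: "'h::topological_group_add set"
  assumes E: "seminorm_space E" and U: "open U" and V: "open V" and f: "f \<in> smooth_maps (U \<times> V) E"
    and \<gamma>s: "\<And>k. k \<le> i \<Longrightarrow> \<gamma>s k \<in> \<LL>" and \<eta>s: "\<And>k. k < j \<Longrightarrow> \<eta>s k \<in> \<LL>" and w: "w \<in> U \<times> V"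
  shows "has_dir_deriv E (dir_fst (\<gamma>s i)) (mixed_deriv E f i j \<gamma>s \<eta>s) w (mixed_deriv E f (Suc i) j \<gamma>s \<eta>s w)"
  using \<eta>s w
proof (induction j arbitrary: w)
  case 0
  have "mixed_dirs (Suc i) \<gamma>s \<eta>s k \<in> \<LL>" if "k \<le> i" for k
    by (rule mixed_dirs_one_param[where j = 0]) (use \<gamma>s that in auto)
  from smooth_maps_deriv[OF E f 0(2), of i "mixed_dirs (Suc i) \<gamma>s \<eta>s", OF this]
  have "has_dir_deriv E (dir_fst (\<gamma>s i)) (iter_deriv E f (mixed_dirs (Suc i) \<gamma>s \<eta>s) i) w
      (mixed_deriv E f (Suc i) 0 \<gamma>s \<eta>s w)"
    by (simp add: mixed_deriv_def mixed_dirs_def[of "Suc i" \<gamma>s \<eta>s i] del: iter_deriv.simps)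
  moreover have "iter_deriv E f (mixed_dirs (Suc i) \<gamma>s \<eta>s) i = iter_deriv E f (mixed_dirs i \<gamma>s \<eta>s) i"
    by (rule iter_deriv_cong) (simp add: mixed_dirs_def)
  ultimately show ?case by (simp add: mixed_deriv_def)
next
  case (Suc j)
  let ?W = "U \<times> V" and ?\<gamma> = "dir_fst (\<gamma>s i) :: real \<Rightarrow> 'g \<times> 'h" and ?\<eta> = "dir_snd (\<eta>s j) :: real \<Rightarrow> 'g \<times> 'h"
  \<comment> \<open>With the direction along \<open>G\<close> appended in the last place, smoothness
    of \<open>f\<close> on the product provides the derivative \<open>?X\<close>. It remains to
    identify \<open>?X\<close> with the normal form.\<close>
  let ?\<zeta>s = "\<lambda>k. if k < i + Suc j then mixed_dirs i \<gamma>s \<eta>s k else ?\<gamma>"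
  let ?X = "iter_deriv E f ?\<zeta>s (Suc (i + Suc j))"
  have \<gamma>: "?\<gamma> \<in> \<LL>" by (intro dir_fst_one_param \<gamma>s) simp
  have \<eta>: "?\<eta> \<in> \<LL>" by (intro dir_snd_one_param Suc.prems(1)) simp
  have \<zeta>s: "?\<zeta>s k \<in> \<LL>" for k
    using \<gamma> mixed_dirs_one_param[of i \<gamma>s "Suc j" \<eta>s k] \<gamma>s Suc.prems(1) by simp
  have eq: "iter_deriv E f ?\<zeta>s (i + Suc j) = mixed_deriv E f i (Suc j) \<gamma>s \<eta>s"
    unfolding mixed_deriv_def by (rule iter_deriv_cong) simp
  have dX: "has_dir_deriv E ?\<gamma> (mixed_deriv E f i (Suc j) \<gamma>s \<eta>s) v (?X v)" if "v \<in> ?W" for v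
    using smooth_maps_deriv[OF E f that, of "i + Suc j" ?\<zeta>s] \<zeta>s unfolding eq by simp
  have top: "mixed_deriv E f i' j' \<gamma>s \<eta>s \<in> ?W \<rightarrow> topspace E" if "i' \<le> Suc i" "j' \<le> Suc j" for i' j'
    by (rule mixed_deriv_in_topspace[OF f]) (use that \<gamma>s Suc.prems(1) in auto)
  have cX: "continuous_map (top_of_set ?W) E ?X"
    by (rule continuous_map_iter_deriv_base[OF f]) (rule \<zeta>s)
  have c12: "continuous_map (top_of_set ?W) E (mixed_deriv E f (Suc i) (Suc j) \<gamma>s \<eta>s)"
    by (rule continuous_map_mixed_deriv_base[OF f]) (use \<gamma>s Suc.prems(1) in auto)
  \<comment> \<open>Schwarz' theorem for \<open>mixed_deriv E f i j \<gamma>s \<eta>s\<close>. Its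
    derivative along \<open>?\<gamma>\<close> is the induction hypothesis, and a further derivative
    along \<open>?\<eta>\<close> gives the left-hand side; in the other order the result is
    \<open>?X\<close>.\<close>
  have "mixed_deriv E f (Suc i) (Suc j) \<gamma>s \<eta>s w = ?X w"
  proof (rule dir_deriv_commute[OF E open_Times[OF U V] \<gamma> \<eta> dir_fst_snd_commute Suc.prems(2)
        top[of i j] top[of "Suc i" j] top[of i "Suc j"]])
    fix v assume v: "v \<in> ?W"
    show "has_dir_deriv E ?\<gamma> (mixed_deriv E f i j \<gamma>s \<eta>s) v (mixed_deriv E f (Suc i) j \<gamma>s \<eta>s v)"
      by (rule Suc.IH) (use Suc.prems(1) v in auto)
    show "has_dir_deriv E ?\<eta> (mixed_deriv E f i j \<gamma>s \<eta>s) v (mixed_deriv E f i (Suc j) \<gamma>s \<eta>s v)"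
      by (rule has_dir_deriv_mixed_snd[OF E f v]) (use \<gamma>s Suc.prems(1) in auto)
    show "has_dir_deriv E ?\<eta> (mixed_deriv E f (Suc i) j \<gamma>s \<eta>s) v (mixed_deriv E f (Suc i) (Suc j) \<gamma>s \<eta>s v)"
      by (rule has_dir_deriv_mixed_snd[OF E f v]) (use \<gamma>s Suc.prems(1) in auto)
    show "has_dir_deriv E ?\<gamma> (mixed_deriv E f i (Suc j) \<gamma>s \<eta>s) v (?X v)"
      by (rule dX[OF v])
  qed (use c12 cX in simp_all)
  then show ?case using dX[OF Suc.prems(2)] by simp
qed

text \<open>The proposed derivative of order \<open>i\<close> of the curried map at
  \<open>x\<close>, as a function on \<open>V\<close> extended by zero. With \<open>j = 0\<close> no
  direction along \<open>H\<close> is read, so the constant 0 is only a placeholder.\<close>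

definition partial_slice ::
    "'e::real_vector topology \<Rightarrow> 'h set \<Rightarrow> ('g \<times> 'h \<Rightarrow> 'e) \<Rightarrow> nat
      \<Rightarrow> (nat \<Rightarrow> real \<Rightarrow> 'g::topological_group_add) \<Rightarrow> 'g \<Rightarrow> 'h::topological_group_add \<Rightarrow> 'e"
  where "partial_slice E V f i \<gamma>s x y = (if y \<in> V then mixed_deriv E f i 0 \<gamma>s (\<lambda>_ _. 0) (x, y) else 0)"

lemma partial_slice_smooth:
  assumes E: "seminorm_space E" and V: "open V" and f: "f \<in> smooth_maps (U \<times> V) E"
    and x: "x \<in> U" and \<gamma>s: "\<And>k. k < i \<Longrightarrow> \<gamma>s k \<in> \<LL>"
  shows "partial_slice E V f i \<gamma>s x \<in> smooth_maps V E"
    and "\<And>j y \<eta>s. y \<in> V \<Longrightarrow> (\<And>k. k < j \<Longrightarrow> \<eta>s k \<in> \<LL>) \<Longrightarrow>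
      iter_deriv E (partial_slice E V f i \<gamma>s x) \<eta>s j y = mixed_deriv E f i j \<gamma>s \<eta>s (x, y)"
proof -
  let ?D = "\<lambda>j \<eta>s y. mixed_deriv E f i j \<gamma>s \<eta>s (x, y)"
  have zero: "partial_slice E V f i \<gamma>s x y = 0" if "y \<notin> V" for y
    using that by (simp add: partial_slice_def)
  have D0: "?D 0 \<eta>s y = partial_slice E V f i \<gamma>s x y" if "y \<in> V" for y \<eta>s
  proof -
    have "iter_deriv E f (mixed_dirs i \<gamma>s \<eta>s) i = iter_deriv E f (mixed_dirs i \<gamma>s (\<lambda>_ _. 0)) i"
      by (rule iter_deriv_cong) (simp add: mixed_dirs_def)
    then show ?thesis using that by (simp add: partial_slice_def mixed_deriv_def)
  qed
  have d: "has_dir_deriv E (\<eta>s j) (?D j \<eta>s) y (?D (Suc j) \<eta>s y)"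
    if "y \<in> V" "\<And>k. k \<le> j \<Longrightarrow> \<eta>s k \<in> \<LL>" for j y \<eta>s
    using has_dir_deriv_mixed_snd[OF E f, of "(x, y)" i \<gamma>s j \<eta>s] x that \<gamma>s
    by (simp add: has_dir_deriv_def add_dir_snd)
  have c: "continuous_map (deriv_domain V j) E (\<lambda>(y, \<eta>s). ?D j \<eta>s y)" for j
  proof -
    have "continuous_map (deriv_domain V j) E (\<lambda>z. mixed_deriv E f i j (\<lambda>k. \<gamma>s k) (\<lambda>k. snd z k) (x, fst z))"
      by (rule continuous_map_mixed_deriv[OF f _ continuous_map_deriv_domain_base[OF continuous_map_id[unfolded id_def]]
            _ continuous_map_deriv_domain_component[OF continuous_map_id[unfolded id_def]]])
        (use x \<gamma>s in auto)
    then show ?thesis by (simp add: case_prod_unfold)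
  qed
  note * = smooth_mapsI_family[of E V "partial_slice E V f i \<gamma>s x" ?D, OF E V zero D0 d c]
  show "partial_slice E V f i \<gamma>s x \<in> smooth_maps V E" by (rule *(1))
  show "\<And>j y \<eta>s. y \<in> V \<Longrightarrow> (\<And>k. k < j \<Longrightarrow> \<eta>s k \<in> \<LL>) \<Longrightarrow>
      iter_deriv E (partial_slice E V f i \<gamma>s x) \<eta>s j y = ?D j \<eta>s y" by (rule *(2))
qed

lemma deriv_map_partial_slice:
  assumes E: "seminorm_space E" and V: "open V" and f: "f \<in> smooth_maps (U \<times> V) E"
    and x: "x \<in> U" and \<gamma>s: "\<And>k. k < i \<Longrightarrow> \<gamma>s k \<in> \<LL>" and z: "z \<in> topspace (deriv_domain V j)"
  shows "deriv_map V E j (partial_slice E V f i \<gamma>s x) z = mixed_deriv E f i j \<gamma>s (snd z) (x, fst z)"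
proof -
  obtain y \<eta>s where z': "z = (y, \<eta>s)" "y \<in> V" and top: "\<eta>s \<in> topspace (one_param_power j)"
    and \<eta>s: "\<forall>k<j. \<eta>s k \<in> \<LL>"
    using z by (rule deriv_domainE)
  show ?thesis
    using partial_slice_smooth(2)[OF E V f x \<gamma>s z'(2) \<eta>s[rule_format]]
    by (simp add: z'(1) deriv_map_apply[OF z'(2) top])
qed

lemma has_dir_deriv_partial_slice:
  assumes E: "seminorm_space E" and U: "open U" and V: "open V" and f: "f \<in> smooth_maps (U \<times> V) E"
    and x: "x \<in> U" and \<gamma>s: "\<And>k. k \<le> i \<Longrightarrow> \<gamma>s k \<in> \<LL>"
  shows "has_dir_deriv (smooth_topology V E) (\<gamma>s i) (partial_slice E V f i \<gamma>s) x
    (partial_slice E V f (Suc i) \<gamma>s x)"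
  unfolding has_dir_deriv_def
proof (rule limitin_smooth_topology[OF E V])
  let ?A = "partial_slice E V f i \<gamma>s"
  let ?q = "\<lambda>t. (1 / t) *\<^sub>R (?A (x + \<gamma>s i t) - ?A x)"
  note Ss = subspace_smooth_maps[OF E V]
  have \<gamma>: "\<gamma>s i \<in> \<LL>" using \<gamma>s by simp
  have A: "?A x' \<in> smooth_maps V E" if "x' \<in> U" for x'
    by (rule partial_slice_smooth(1)[OF E V f that]) (use \<gamma>s in simp)
  show l: "partial_slice E V f (Suc i) \<gamma>s x \<in> smooth_maps V E"
    by (rule partial_slice_smooth(1)[OF E V f x]) (use \<gamma>s in simp)
  show "\<forall>\<^sub>F t in at 0. ?q t \<in> smooth_maps V E"
    using eventually_one_param[OF \<gamma> U x]
    by (rule eventually_mono) (intro subspace_scale[OF Ss] subspace_diff[OF Ss] A x)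
  fix j K p and e :: real
  assume K: "compactin (deriv_domain V j) K" and p: "continuous_seminorm E p" and e: "0 < e"
  let ?h = "\<lambda>z. mixed_deriv E f (Suc i) j \<gamma>s (snd (snd z)) (fst z, fst (snd z))"
  have h: "continuous_map (prod_topology (top_of_set U) (deriv_domain V j)) E ?h"
    by (rule continuous_map_mixed_deriv[OF f continuous_map_fst continuous_map_deriv_domain_base[OF continuous_map_snd]
          _ continuous_map_deriv_domain_component[OF continuous_map_snd], where c = "\<lambda>k z. \<gamma>s k"])
      (use \<gamma>s in simp)
  have xt: "x \<in> topspace (top_of_set U)" using x by simp
  obtain N where N: "openin (top_of_set U) N" "x \<in> N"
    "\<And>x' z. x' \<in> N \<Longrightarrow> z \<in> K \<Longrightarrow> p (?h (x', z) - ?h (x, z)) < e / 2"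
    using continuous_map_uniform_compact[OF E h K xt p half_gt_zero[OF e]] by blast
  have oN: "open N" "N \<subseteq> U"
    using N(1) U by (auto simp: openin_open_eq)
  \<comment> \<open>\<open>N\<close>, and hence \<open>\<delta>\<close>, depends on
    \<open>K\<close>, \<open>p\<close> and \<open>e\<close> but not on the point of
    \<open>K\<close>. This uniformity is what convergence in \<open>smooth_topology V E\<close>
    demands.\<close>
  obtain \<delta> where \<delta>: "0 < \<delta>" "\<And>s. \<bar>s\<bar> < \<delta> \<Longrightarrow> x + \<gamma>s i s \<in> N"
    using one_param_nbhd[OF \<gamma> oN(1) N(2)] by blast
  have "p (deriv_map V E j (?q t) z - deriv_map V E j (partial_slice E V f (Suc i) \<gamma>s x) z) < e"
    if t: "t \<noteq> 0" "\<bar>t\<bar> < \<delta>" and z: "z \<in> K" for t z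
  proof -
    have zt: "z \<in> topspace (deriv_domain V j)" using compactin_subset_topspace[OF K] z by blast
    obtain y \<eta>s where z': "z = (y, \<eta>s)" "y \<in> V" and \<eta>s: "\<forall>k<j. \<eta>s k \<in> \<LL>"
      using zt by (rule deriv_domainE)
    have xt: "x + \<gamma>s i s \<in> U" if "\<bar>s\<bar> < \<delta>" for s using \<delta>(2)[OF that] oN by blast
    \<comment> \<open>Evaluated at \<open>(y, \<eta>s)\<close>, the difference quotient of functions
      on \<open>V\<close> becomes a difference quotient of \<open>?B\<close> along
      \<open>dir_fst (\<gamma>s i)\<close>, to which the mean value estimate applies with derivative
      \<open>?B'\<close>.\<close>
    let ?B = "mixed_deriv E f i j \<gamma>s \<eta>s" and ?B' = "mixed_deriv E f (Suc i) j \<gamma>s \<eta>s"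
    have B: "?B \<in> U \<times> V \<rightarrow> topspace E"
      by (rule mixed_deriv_in_topspace[OF f]) (use \<gamma>s \<eta>s in auto)
    have "?B' \<in> U \<times> V \<rightarrow> topspace E"
      by (rule mixed_deriv_in_topspace[OF f]) (use \<gamma>s \<eta>s in auto)
    then have B': "?B' (x, y) \<in> topspace E" using x z'(2) by auto
    have dA: "deriv_map V E j (?A x') z = ?B (x', y)" if "x' \<in> U" for x'
      using deriv_map_partial_slice[OF E V f that _ zt, of i \<gamma>s] \<gamma>s z'(1) by simp
    have "deriv_map V E j (?q t) z = (1 / t) *\<^sub>R (?B ((x, y) + dir_fst (\<gamma>s i) t) - ?B (x, y))"
      unfolding deriv_map_scaleR_diff[OF E V A[OF xt[OF t(2)]] A[OF x] zt] dA[OF x] dA[OF xt[OF t(2)]] add_dir_fst ..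
    moreover have "deriv_map V E j (partial_slice E V f (Suc i) \<gamma>s x) z = ?B' (x, y)"
      using deriv_map_partial_slice[OF E V f x _ zt, of "Suc i" \<gamma>s] \<gamma>s z'(1) by simp
    moreover have "p ((1 / t) *\<^sub>R (?B ((x, y) + dir_fst (\<gamma>s i) t) - ?B (x, y)) - ?B' (x, y)) \<le> e / 2"
    proof (rule dir_deriv_mean_value[OF E p dir_fst_one_param[OF \<gamma>] t(1) _ _ B', where f' = ?B'])
      fix s assume "\<bar>s\<bar> \<le> \<bar>t\<bar>"
      then have s: "\<bar>s\<bar> < \<delta>" using t by simp
      have W: "(x, y) + dir_fst (\<gamma>s i) s \<in> U \<times> V" using xt[OF s] z'(2) by (simp add: add_dir_fst)
      show "?B ((x, y) + dir_fst (\<gamma>s i) s) \<in> topspace E" by (rule funcset_mem[OF B W])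
      show "has_dir_deriv E (dir_fst (\<gamma>s i)) ?B ((x, y) + dir_fst (\<gamma>s i) s) (?B' ((x, y) + dir_fst (\<gamma>s i) s))"
        by (rule has_dir_deriv_mixed_fst[OF E U V f _ _ W]) (use \<gamma>s \<eta>s in auto)
      show "p (?B' ((x, y) + dir_fst (\<gamma>s i) s) - ?B' (x, y)) \<le> e / 2"
        using N(3)[OF \<delta>(2)[OF s] z] z'(1) by (simp add: add_dir_fst)
    qed
    ultimately show ?thesis using e by simp
  qed
  then show "\<forall>\<^sub>F t in at 0. \<forall>z\<in>K.
      p (deriv_map V E j (?q t) z - deriv_map V E j (partial_slice E V f (Suc i) \<gamma>s x) z) < e"
    using \<delta>(1) unfolding eventually_at by (intro exI[of _ \<delta>]) (simp add: dist_real_def)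
qed

text \<open>The family is \<open>partial_slice E V f\<close>. Its continuity into the function space
  reduces to joint continuity of mixed derivatives of \<open>f\<close> in base points and directions
  of both factors.\<close>

lemma curry_smooth:
  assumes E: "seminorm_space E" and U: "open U" and V: "open V" and f: "f \<in> smooth_maps (U \<times> V) E"
  shows "(\<lambda>x y. f (x, y)) \<in> smooth_maps U (smooth_topology V E)"
    and "\<And>i x \<gamma>s. x \<in> U \<Longrightarrow> (\<And>k. k < i \<Longrightarrow> \<gamma>s k \<in> \<LL>) \<Longrightarrow>
      iter_deriv (smooth_topology V E) (\<lambda>x y. f (x, y)) \<gamma>s i x = partial_slice E V f i \<gamma>s x"
proof -
  let ?F = "smooth_topology V E" and ?D = "partial_slice E V f"
  have zero: "(\<lambda>y. f (x, y)) = 0" if "x \<notin> U" for x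
    using smooth_maps_zero[OF f] that by (simp add: fun_eq_iff)
  have D0: "?D 0 \<gamma>s x = (\<lambda>y. f (x, y))" for x \<gamma>s
    using smooth_maps_zero[OF f] by (simp add: partial_slice_def mixed_deriv_def fun_eq_iff)
  have c: "continuous_map (deriv_domain U i) ?F (\<lambda>(x, \<gamma>s). ?D i \<gamma>s x)" for i
  proof (rule continuous_map_into_smooth_topology[OF E V])
    let ?X = "deriv_domain U i"
    have mem: "fst u \<in> U \<and> (\<forall>k<i. snd u k \<in> \<LL>)" if "u \<in> topspace ?X" for u
      using that by (rule deriv_domainE) simp
    show "(\<lambda>(x, \<gamma>s). ?D i \<gamma>s x) \<in> topspace ?X \<rightarrow> smooth_maps V E"
    proof
      fix u assume "u \<in> topspace ?X"
      then show "(\<lambda>(x, \<gamma>s). ?D i \<gamma>s x) u \<in> smooth_maps V E"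
        using partial_slice_smooth(1)[OF E V f, of "fst u" i "snd u"] mem[of u] by (simp add: case_prod_unfold)
    qed
    fix j
    have "continuous_map (prod_topology ?X (deriv_domain V j)) E
        (\<lambda>z. mixed_deriv E f i j (\<lambda>k. snd (fst z) k) (\<lambda>k. snd (snd z) k) (fst (fst z), fst (snd z)))"
      by (rule continuous_map_mixed_deriv[OF f continuous_map_deriv_domain_base[OF continuous_map_fst]
            continuous_map_deriv_domain_base[OF continuous_map_snd]
            continuous_map_deriv_domain_component[OF continuous_map_fst]
            continuous_map_deriv_domain_component[OF continuous_map_snd]])
    then show "continuous_map (prod_topology ?X (deriv_domain V j)) E
        (\<lambda>(u, z). deriv_map V E j ((\<lambda>(x, \<gamma>s). ?D i \<gamma>s x) u) z)"
    proof (rule continuous_map_eq)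
      fix z assume z: "z \<in> topspace (prod_topology ?X (deriv_domain V j))"
      then have "fst z \<in> topspace ?X" "snd z \<in> topspace (deriv_domain V j)" by auto
      then show "mixed_deriv E f i j (\<lambda>k. snd (fst z) k) (\<lambda>k. snd (snd z) k) (fst (fst z), fst (snd z)) =
          (\<lambda>(u, z). deriv_map V E j ((\<lambda>(x, \<gamma>s). ?D i \<gamma>s x) u) z) z"
        using deriv_map_partial_slice[OF E V f, of "fst (fst z)" i "snd (fst z)" "snd z" j] mem[of "fst z"]
        by (simp add: case_prod_unfold)
    qed
  qed
  note d = has_dir_deriv_partial_slice[OF E U V f]
  note * = smooth_mapsI_family[of ?F U "\<lambda>x y. f (x, y)" ?D,
      OF seminorm_space_smooth_topology[OF E V] U zero D0 d c]
  show "(\<lambda>x y. f (x, y)) \<in> smooth_maps U ?F" by (rule *(1))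
  show "\<And>i x \<gamma>s. x \<in> U \<Longrightarrow> (\<And>k. k < i \<Longrightarrow> \<gamma>s k \<in> \<LL>) \<Longrightarrow>
      iter_deriv ?F (\<lambda>x y. f (x, y)) \<gamma>s i x = ?D i \<gamma>s x" by (rule *(2))
qed

section \<open>Uncurrying a smooth map\<close>

text \<open>A point is a compact set, so evaluating the derivative of order \<open>j\<close> at
  \<open>z\<close> is bounded by a continuous seminorm of the space of smooth maps.\<close>

lemma limitin_deriv_map:
  assumes E: "seminorm_space E" and V: "open V" and q: "limitin (smooth_topology V E) q l net"
    and z: "z \<in> topspace (deriv_domain V j)"
  shows "limitin E (\<lambda>t. deriv_map V E j (q t) z) (deriv_map V E j l z) net"
  unfolding limitin_seminorm[OF E]
proof (intro conjI allI impI)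
  note sF = seminorm_space_smooth_topology[OF E V] and Ss = subspace_smooth_maps[OF E V]
  have l: "l \<in> smooth_maps V E" using limitin_topspace[OF q] by simp
  have ev: "\<forall>\<^sub>F t in net. q t \<in> smooth_maps V E" using q by (simp add: limitin_seminorm[OF sF])
  show "deriv_map V E j l z \<in> topspace E" by (rule deriv_map_in_topspace[OF l z])
  show "\<forall>\<^sub>F t in net. deriv_map V E j (q t) z \<in> topspace E"
    using ev by (rule eventually_mono) (rule deriv_map_in_topspace[OF _ z])
  fix p and e :: real assume p: "continuous_seminorm E p" and e: "0 < e"
  have "compactin (deriv_domain V j) {z}" using z by (intro finite_imp_compactin) auto
  then obtain r where r: "continuous_seminorm (smooth_topology V E) r"
    "\<And>f y. f \<in> smooth_maps V E \<Longrightarrow> y \<in> {z} \<Longrightarrow> p (deriv_map V E j f y) \<le> r f"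
    using smooth_seminorm_exists[OF E V p] by blast
  show "\<forall>\<^sub>F t in net. p (deriv_map V E j (q t) z - deriv_map V E j l z) < e"
    using limitin_seminormD[OF sF q r(1) e]
  proof (rule eventually_mono)
    fix t assume t: "q t \<in> topspace (smooth_topology V E) \<and> r (q t - l) < e"
    then have qt: "q t \<in> smooth_maps V E" by simp
    have "p (deriv_map V E j (q t - l) z) \<le> r (q t - l)"
      by (rule r(2)[OF subspace_diff[OF Ss qt l]]) simp
    then show "p (deriv_map V E j (q t) z - deriv_map V E j l z) < e"
      using t unfolding deriv_map_linear(2)[OF E V qt l z] by linarith
  qed
qed

lemma deriv_map_restrict:
  assumes "y \<in> V" "\<And>k. k < j \<Longrightarrow> \<eta>s k \<in> \<LL>"
  shows "(y, \<lambda>k\<in>{..<j}. \<eta>s k) \<in> topspace (deriv_domain V j)"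
    and "deriv_map V E j h (y, \<lambda>k\<in>{..<j}. \<eta>s k) = iter_deriv E h \<eta>s j y"
proof -
  show z: "(y, \<lambda>k\<in>{..<j}. \<eta>s k) \<in> topspace (deriv_domain V j)"
    using assms by (simp add: topspace_deriv_domain)
  have "iter_deriv E h (\<lambda>k\<in>{..<j}. \<eta>s k) j = iter_deriv E h \<eta>s j"
    by (rule iter_deriv_cong) simp
  then show "deriv_map V E j h (y, \<lambda>k\<in>{..<j}. \<eta>s k) = iter_deriv E h \<eta>s j y"
    using z by (simp add: deriv_map_def)
qed

text \<open>The counterpart of \<open>mixed_deriv\<close> for a map into a function space:
  \<open>i\<close> derivatives are taken with values in \<open>smooth_topology V E\<close>, and the
  resulting function on \<open>V\<close> is then differentiated \<open>j\<close> times.\<close>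

definition nested_deriv ::
    "'e::real_vector topology \<Rightarrow> 'h set \<Rightarrow> ('g \<Rightarrow> 'h \<Rightarrow> 'e) \<Rightarrow> nat \<Rightarrow> nat
      \<Rightarrow> (nat \<Rightarrow> real \<Rightarrow> 'g::topological_group_add) \<Rightarrow> (nat \<Rightarrow> real \<Rightarrow> 'h::topological_group_add) \<Rightarrow> 'g \<times> 'h \<Rightarrow> 'e"
  where "nested_deriv E V g i j \<gamma>s \<eta>s w =
    iter_deriv E (iter_deriv (smooth_topology V E) g \<gamma>s i (fst w)) \<eta>s j (snd w)"

lemma nested_deriv_cong:
  assumes "\<And>k. k < i \<Longrightarrow> \<gamma>s k = \<gamma>s' k" "\<And>k. k < j \<Longrightarrow> \<eta>s k = \<eta>s' k"
  shows "nested_deriv E V g i j \<gamma>s \<eta>s = nested_deriv E V g i j \<gamma>s' \<eta>s'"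
proof -
  have 1: "iter_deriv (smooth_topology V E) g \<gamma>s i = iter_deriv (smooth_topology V E) g \<gamma>s' i"
    by (rule iter_deriv_cong[OF assms(1)])
  have 2: "iter_deriv E h \<eta>s j = iter_deriv E h \<eta>s' j" for h
    by (rule iter_deriv_cong[OF assms(2)])
  show ?thesis by (rule ext) (simp only: nested_deriv_def 1 2)
qed

lemma has_dir_deriv_nested_snd:
  assumes E: "seminorm_space E" and V: "open V"
    and g: "g \<in> smooth_maps U (smooth_topology V E)" and w: "w \<in> U \<times> V"
    and \<gamma>s: "\<And>k. k < i \<Longrightarrow> \<gamma>s k \<in> \<LL>" and \<eta>s: "\<And>k. k \<le> j \<Longrightarrow> \<eta>s k \<in> \<LL>"
  shows "has_dir_deriv E (dir_snd (\<eta>s j)) (nested_deriv E V g i j \<gamma>s \<eta>s) w (nested_deriv E V g i (Suc j) \<gamma>s \<eta>s w)"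
proof -
  obtain x y where xy: "w = (x, y)" "x \<in> U" "y \<in> V" using w by blast
  have "iter_deriv (smooth_topology V E) g \<gamma>s i x \<in> topspace (smooth_topology V E)"
    by (rule iter_deriv_in_topspace[OF g xy(2) \<gamma>s])
  then have "iter_deriv (smooth_topology V E) g \<gamma>s i x \<in> smooth_maps V E" by simp
  from smooth_maps_deriv[OF E this xy(3), of j \<eta>s, OF \<eta>s] show ?thesis
    by (simp add: has_dir_deriv_def nested_deriv_def xy(1) add_dir_snd del: iter_deriv.simps)
qed

text \<open>Taking the derivative of order \<open>j\<close> at a fixed point is continuous and
  linear on \<open>smooth_topology V E\<close>, hence passes through the limit of difference
  quotients along \<open>G\<close>. The new derivative thereby joins those taken before the
  derivatives along \<open>H\<close>.\<close>

lemma has_dir_deriv_nested_fst: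
  assumes E: "seminorm_space E" and U: "open U" and V: "open V"
    and g: "g \<in> smooth_maps U (smooth_topology V E)" and w: "w \<in> U \<times> V"
    and \<gamma>s: "\<And>k. k \<le> i \<Longrightarrow> \<gamma>s k \<in> \<LL>" and \<eta>s: "\<And>k. k < j \<Longrightarrow> \<eta>s k \<in> \<LL>"
  shows "has_dir_deriv E (dir_fst (\<gamma>s i)) (nested_deriv E V g i j \<gamma>s \<eta>s) w (nested_deriv E V g (Suc i) j \<gamma>s \<eta>s w)"
proof -
  let ?F = "smooth_topology V E"
  note sF = seminorm_space_smooth_topology[OF E V]
  obtain x y where xy: "w = (x, y)" "x \<in> U" "y \<in> V" using w by blast
  let ?G = "iter_deriv ?F g \<gamma>s i" and ?z = "(y, \<lambda>k\<in>{..<j}. \<eta>s k)"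
  have G: "?G x' \<in> smooth_maps V E" if "x' \<in> U" for x'
    using iter_deriv_in_topspace[OF g that, of i \<gamma>s] \<gamma>s by simp
  have z: "?z \<in> topspace (deriv_domain V j)"
    by (rule deriv_map_restrict(1)[OF xy(3) \<eta>s])
  have dz: "deriv_map V E j h ?z = iter_deriv E h \<eta>s j y" for h
    by (rule deriv_map_restrict(2)[OF xy(3) \<eta>s])
  have "limitin E (\<lambda>t. deriv_map V E j ((1 / t) *\<^sub>R (?G (x + \<gamma>s i t) - ?G x)) ?z)
      (deriv_map V E j (iter_deriv ?F g \<gamma>s (Suc i) x) ?z) (at 0)"
    by (rule limitin_deriv_map[OF E V _ z])
      (use smooth_maps_deriv[OF sF g xy(2), of i \<gamma>s, OF \<gamma>s] in
        \<open>simp add: has_dir_deriv_def del: iter_deriv.simps\<close>)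
  moreover have "\<forall>\<^sub>F t in at 0. deriv_map V E j ((1 / t) *\<^sub>R (?G (x + \<gamma>s i t) - ?G x)) ?z =
      (1 / t) *\<^sub>R (deriv_map V E j (?G (x + \<gamma>s i t)) ?z - deriv_map V E j (?G x) ?z)"
    using eventually_one_param[OF \<gamma>s[OF order_refl] U xy(2)]
  proof (rule eventually_mono)
    fix t assume t: "x + \<gamma>s i t \<in> U"
    show "deriv_map V E j ((1 / t) *\<^sub>R (?G (x + \<gamma>s i t) - ?G x)) ?z =
      (1 / t) *\<^sub>R (deriv_map V E j (?G (x + \<gamma>s i t)) ?z - deriv_map V E j (?G x) ?z)"
      by (rule deriv_map_scaleR_diff[OF E V G[OF t] G[OF xy(2)] z])
  qed
  ultimately have "limitin E (\<lambda>t. (1 / t) *\<^sub>R (deriv_map V E j (?G (x + \<gamma>s i t)) ?z - deriv_map V E j (?G x) ?z))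
      (deriv_map V E j (iter_deriv ?F g \<gamma>s (Suc i) x) ?z) (at 0)"
    by (rule limitin_transform_eventually[rotated])
  then show ?thesis
    unfolding dz has_dir_deriv_def nested_deriv_def xy(1) add_dir_fst fst_conv snd_conv .
qed

section \<open>Joint continuity of nested derivatives from the k_R property\<close>

definition kR_products :: "'g::topological_group_add set \<Rightarrow> 'h::topological_group_add set \<Rightarrow> bool"
  where "kR_products U V \<longleftrightarrow> (\<forall>i j. kR_space (prod_topology (top_of_set U) (prod_topology (top_of_set V)
    (prod_topology (one_param_power i :: (nat \<Rightarrow> real \<Rightarrow> 'g) topology)
      (one_param_power j :: (nat \<Rightarrow> real \<Rightarrow> 'h) topology)))))"

text \<open>On a compact set the claim is \<open>continuous_on_compact_evaluation\<close>: fact 1 is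
  smoothness of a single value of the derivative of \<open>g\<close>, fact 2 is continuity of that
  derivative into the function space.\<close>

lemma continuous_map_nested_deriv_map:
  fixes U :: "'g::topological_group_add set" and V :: "'h::topological_group_add set"
  assumes E: "seminorm_space E" and V: "open V"
    and g: "g \<in> smooth_maps U (smooth_topology V E)"
    and kR: "kR_products U V"
  shows "continuous_map (prod_topology (deriv_domain U i) (deriv_domain V j)) E
    (\<lambda>(u, z). deriv_map V E j (deriv_map U (smooth_topology V E) i g u) z)"
proof -
  let ?F = "smooth_topology V E"
  let ?X = "deriv_domain U i" and ?Y = "deriv_domain V j"
  let ?Z = "prod_topology (top_of_set U) (prod_topology (top_of_set V)
    (prod_topology (one_param_power i :: (nat \<Rightarrow> real \<Rightarrow> 'g) topology)
      (one_param_power j :: (nat \<Rightarrow> real \<Rightarrow> 'h) topology)))"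
  have kR_Z: "kR_space ?Z" using kR unfolding kR_products_def by blast
  let ?h = "\<lambda>(u, z). deriv_map V E j (deriv_map U ?F i g u) z"
  \<comment> \<open>The hypothesis orders the factors as base points followed by directions, whereas
    the map is defined on a product of two derivative domains. \<open>?\<sigma>\<close> and
    \<open>?\<tau>\<close> are the two rearrangements.\<close>
  let ?\<sigma> = "\<lambda>(x, y, \<gamma>s, \<eta>s). ((x, \<gamma>s), (y, \<eta>s))"
  let ?\<tau> = "\<lambda>((x, \<gamma>s), (y, \<eta>s)). (x, y, \<gamma>s, \<eta>s)"
  note dU = continuous_map_deriv_map[OF g, of i]
  have dg: "deriv_map U ?F i g u \<in> smooth_maps V E" if "u \<in> topspace ?X" for u
    using deriv_map_in_topspace[OF g that] by simp
  have 1: "continuous_map ?Y E (\<lambda>z. ?h (u, z))" if "u \<in> topspace ?X" for u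
    using continuous_map_deriv_map[OF dg[OF that], of j] by simp
  have 2: "\<exists>N. openin ?X N \<and> u \<in> N \<and> (\<forall>x'\<in>N. \<forall>y\<in>L. p (?h (x', y) - ?h (u, y)) < e)"
    if "u \<in> topspace ?X" "compactin ?Y L" "continuous_seminorm E p" "0 < e" for u L p e
    using continuous_map_smooth_topology_uniform[OF E V dU that] by simp
  have \<sigma>: "continuous_map ?Z (prod_topology ?X ?Y) ?\<sigma>"
    unfolding deriv_domain_def case_prod_unfold
    by (intro continuous_map_pairedI)
      (rule continuous_map_fst continuous_map_fst'[OF continuous_map_snd]
        continuous_map_fst'[OF continuous_map_snd'[OF continuous_map_snd]]
        continuous_map_snd'[OF continuous_map_snd'[OF continuous_map_snd]])+
  have \<tau>: "continuous_map (prod_topology ?X ?Y) ?Z ?\<tau>"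
    unfolding deriv_domain_def case_prod_unfold
    by (intro continuous_map_pairedI)
      (rule continuous_map_fst'[OF continuous_map_fst] continuous_map_fst'[OF continuous_map_snd]
        continuous_map_snd'[OF continuous_map_fst] continuous_map_snd'[OF continuous_map_snd])+
  have "continuous_map ?Z E (?h \<circ> ?\<sigma>)"
  proof (rule kR_space_continuous_map[OF kR_Z E])
    show "?h \<circ> ?\<sigma> \<in> topspace ?Z \<rightarrow> topspace E"
    proof
      fix w assume "w \<in> topspace ?Z"
      then have "?\<sigma> w \<in> topspace (prod_topology ?X ?Y)"
        using continuous_map_funspace[OF \<sigma>] by blast
      then show "(?h \<circ> ?\<sigma>) w \<in> topspace E"
        using deriv_map_in_topspace[OF dg] by (auto simp: case_prod_unfold)
    qed
    fix K assume K: "compactin ?Z K"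
    have \<sigma>K: "continuous_map (subtopology ?Z K) (subtopology (prod_topology ?X ?Y) (?\<sigma> ` K)) ?\<sigma>"
      using \<sigma> by (simp add: continuous_map_in_subtopology continuous_map_from_subtopology image_subset_iff)
    have "continuous_map (subtopology (prod_topology ?X ?Y) (?\<sigma> ` K)) E ?h"
      by (rule continuous_on_compact_evaluation[OF E 1 2 image_compactin[OF K \<sigma>]])
    from continuous_map_compose[OF \<sigma>K this] show "continuous_map (subtopology ?Z K) E (?h \<circ> ?\<sigma>)" .
  qed
  from continuous_map_compose[OF \<tau> this] show ?thesis
    by (simp add: o_def case_prod_unfold)
qed

lemma continuous_map_nested_deriv:
  fixes U :: "'g::topological_group_add set" and V :: "'h::topological_group_add set"
  assumes E: "seminorm_space E" and V: "open V"
    and g: "g \<in> smooth_maps U (smooth_topology V E)"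
    and kR: "kR_products U V"
    and a: "continuous_map X (top_of_set U) a" and b: "continuous_map X (top_of_set V) b"
    and c: "\<And>k. k < i \<Longrightarrow> continuous_map X one_param_topology (c k)"
    and d: "\<And>k. k < j \<Longrightarrow> continuous_map X one_param_topology (d k)"
  shows "continuous_map X E (\<lambda>z. nested_deriv E V g i j (\<lambda>k. c k z) (\<lambda>k. d k z) (a z, b z))"
proof -
  let ?u = "\<lambda>z. (a z, \<lambda>k\<in>{..<i}. c k z)" and ?v = "\<lambda>z. (b z, \<lambda>k\<in>{..<j}. d k z)"
  have "continuous_map X (prod_topology (deriv_domain U i) (deriv_domain V j)) (\<lambda>z. (?u z, ?v z))"
    using continuous_map_into_deriv_domain[OF a c] continuous_map_into_deriv_domain[OF b d]
    by (intro continuous_map_pairedI)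
  from continuous_map_compose[OF this continuous_map_nested_deriv_map[OF E V g kR]]
  show ?thesis
  proof (rule continuous_map_eq)
    fix z assume z: "z \<in> topspace X"
    have cz: "c k z \<in> \<LL>" if "k < i" for k using continuous_map_funspace[OF c[OF that]] z by auto
    have dz: "d k z \<in> \<LL>" if "k < j" for k using continuous_map_funspace[OF d[OF that]] z by auto
    have az: "a z \<in> U" "b z \<in> V" using continuous_map_funspace[OF a] continuous_map_funspace[OF b] z by auto
    have 1: "deriv_map U (smooth_topology V E) i g (?u z) =
        iter_deriv (smooth_topology V E) g (\<lambda>k. c k z) i (a z)"
      by (rule deriv_map_restrict(2)[OF az(1) cz])
    have 2: "deriv_map V E j h (?v z) = iter_deriv E h (\<lambda>k. d k z) j (b z)" for h
      by (rule deriv_map_restrict(2)[OF az(2) dz])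
    show "((\<lambda>(u, z). deriv_map V E j (deriv_map U (smooth_topology V E) i g u) z) \<circ> (\<lambda>z. (?u z, ?v z))) z =
        nested_deriv E V g i j (\<lambda>k. c k z) (\<lambda>k. d k z) (a z, b z)"
      unfolding o_apply prod.case nested_deriv_def fst_conv snd_conv 1 2 ..
  qed
qed

text \<open>Expanding \<open>D\<^bsub>(\<gamma>,\<eta>)\<^esub> = D\<^bsub>(\<gamma>,0)\<^esub> + D\<^bsub>(0,\<eta>)\<^esub>\<close> in an iterated derivative gives one summand for
  each way to distribute the positions of the directions, in order, over the two factors.\<close>

primrec splits :: "nat \<Rightarrow> (nat list \<times> nat list) list" where
  "splits 0 = [([], [])]"
| "splits (Suc n) = concat (map (\<lambda>(xs, ys). [(xs @ [n], ys), (xs, ys @ [n])]) (splits n))"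

lemma splits_less: "(xs, ys) \<in> set (splits n) \<Longrightarrow> set xs \<subseteq> {..<n} \<and> set ys \<subseteq> {..<n}"
  by (induction n arbitrary: xs ys) (auto, (force dest: less_SucI)+)

lemma continuous_map_split_components:
  fixes U :: "'g::topological_group_add set" and V :: "'h::topological_group_add set"
  assumes xs: "set xs \<subseteq> {..<n}"
  shows "continuous_map (deriv_domain (U \<times> V) n) (top_of_set U) (\<lambda>z. fst (fst z))"
    and "continuous_map (deriv_domain (U \<times> V) n) (top_of_set V) (\<lambda>z. snd (fst z))"
    and "\<And>k. k < length xs \<Longrightarrow>
      continuous_map (deriv_domain (U \<times> V) n) one_param_topology (\<lambda>z t. fst (snd z (xs ! k) t))"
    and "\<And>k. k < length xs \<Longrightarrow>
      continuous_map (deriv_domain (U \<times> V) n) one_param_topology (\<lambda>z t. snd (snd z (xs ! k) t))"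
proof -
  have D: "deriv_domain (U \<times> V) n = prod_topology (prod_topology (top_of_set U) (top_of_set V)) (one_param_power n)"
    unfolding deriv_domain_def prod_topology_subtopology_eu ..
  show "continuous_map (deriv_domain (U \<times> V) n) (top_of_set U) (\<lambda>z. fst (fst z))"
    "continuous_map (deriv_domain (U \<times> V) n) (top_of_set V) (\<lambda>z. snd (fst z))"
    unfolding D
    by (rule continuous_map_fst'[OF continuous_map_fst], rule continuous_map_snd'[OF continuous_map_fst])
  fix k assume "k < length xs"
  then have "xs ! k < n" using xs nth_mem by blast
  note comp = continuous_map_deriv_domain_component[OF continuous_map_id[unfolded id_def] this, of "U \<times> V"]
  show "continuous_map (deriv_domain (U \<times> V) n) one_param_topology (\<lambda>z t. fst (snd z (xs ! k) t))"
    using continuous_map_compose[OF comp continuous_map_fst_one_param] by (simp add: o_def)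
  show "continuous_map (deriv_domain (U \<times> V) n) one_param_topology (\<lambda>z t. snd (snd z (xs ! k) t))"
    using continuous_map_compose[OF comp continuous_map_snd_one_param] by (simp add: o_def)
qed

definition split_deriv ::
    "'e::real_vector topology \<Rightarrow> 'h set \<Rightarrow> ('g \<Rightarrow> 'h \<Rightarrow> 'e) \<Rightarrow> nat list \<Rightarrow> nat list
      \<Rightarrow> (nat \<Rightarrow> real \<Rightarrow> 'g::topological_group_add \<times> 'h::topological_group_add) \<Rightarrow> 'g \<times> 'h \<Rightarrow> 'e"
  where "split_deriv E V g xs ys \<zeta>s = nested_deriv E V g (length xs) (length ys)
    (\<lambda>k t. fst (\<zeta>s (xs ! k) t)) (\<lambda>k t. snd (\<zeta>s (ys ! k) t))"

text \<open>\<open>\<zeta>s n\<close> is the sum of its two coordinate directions. The one along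
  \<open>G\<close> records the position \<open>n\<close> in \<open>xs\<close>, the one along
  \<open>H\<close> records it in \<open>ys\<close>.\<close>

lemma has_dir_deriv_split_deriv:
  fixes U :: "'g::topological_group_add set" and V :: "'h::topological_group_add set"
  assumes E: "seminorm_space E" and U: "open U" and V: "open V"
    and g: "g \<in> smooth_maps U (smooth_topology V E)"
    and kR: "kR_products U V"
    and w: "w \<in> U \<times> V" and \<zeta>s: "\<And>k. k \<le> n \<Longrightarrow> \<zeta>s k \<in> \<LL>"
    and xs: "set xs \<subseteq> {..<n}" and ys: "set ys \<subseteq> {..<n}"
  shows "has_dir_deriv E (\<zeta>s n) (split_deriv E V g xs ys \<zeta>s) w
    (split_deriv E V g (xs @ [n]) ys \<zeta>s w + split_deriv E V g xs (ys @ [n]) \<zeta>s w)"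
proof -
  let ?W = "U \<times> V" and ?\<gamma> = "\<lambda>t. fst (\<zeta>s n t)" and ?\<eta> = "\<lambda>t. snd (\<zeta>s n t)"
  \<comment> \<open>The sequences with \<open>n\<close> already appended serve all three terms,
    since a derivative of lower order does not read the last entry.\<close>
  let ?\<gamma>s = "\<lambda>k t. fst (\<zeta>s ((xs @ [n]) ! k) t)" and ?\<eta>s = "\<lambda>k t. snd (\<zeta>s ((ys @ [n]) ! k) t)"
  let ?i = "length xs" and ?j = "length ys"
  have nth_le: "(zs @ [n]) ! k \<le> n" if "set zs \<subseteq> {..<n}" "k \<le> length zs" for zs k
  proof -
    have "(zs @ [n]) ! k \<in> set (zs @ [n])" using that(2) by (intro nth_mem) simp
    then show ?thesis using that(1) by auto
  qed
  have \<gamma>s: "?\<gamma>s k \<in> \<LL>" if "k \<le> ?i" for k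
    by (intro fst_one_param \<zeta>s nth_le xs that)
  have \<eta>s: "?\<eta>s k \<in> \<LL>" if "k \<le> ?j" for k
    by (intro snd_one_param \<zeta>s nth_le ys that)
  have A: "split_deriv E V g xs ys \<zeta>s = nested_deriv E V g ?i ?j ?\<gamma>s ?\<eta>s"
    unfolding split_deriv_def by (rule nested_deriv_cong) (simp_all add: nth_append)
  have B1: "split_deriv E V g (xs @ [n]) ys \<zeta>s = nested_deriv E V g (Suc ?i) ?j ?\<gamma>s ?\<eta>s"
    unfolding split_deriv_def length_append_singleton by (rule nested_deriv_cong) (simp_all add: nth_append)
  have B2: "split_deriv E V g xs (ys @ [n]) \<zeta>s = nested_deriv E V g ?i (Suc ?j) ?\<gamma>s ?\<eta>s"
    unfolding split_deriv_def length_append_singleton by (rule nested_deriv_cong) (simp_all add: nth_append)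
  have d1: "has_dir_deriv E (dir_fst ?\<gamma>) (nested_deriv E V g ?i ?j ?\<gamma>s ?\<eta>s) v (nested_deriv E V g (Suc ?i) ?j ?\<gamma>s ?\<eta>s v)"
    if "v \<in> ?W" for v
    using has_dir_deriv_nested_fst[OF E U V g that, of ?i ?\<gamma>s ?j ?\<eta>s, OF \<gamma>s \<eta>s] by simp
  have d2: "has_dir_deriv E (dir_snd ?\<eta>) (nested_deriv E V g ?i ?j ?\<gamma>s ?\<eta>s) w (nested_deriv E V g ?i (Suc ?j) ?\<gamma>s ?\<eta>s w)"
    using has_dir_deriv_nested_snd[OF E V g w, of ?i ?\<gamma>s ?j ?\<eta>s, OF \<gamma>s \<eta>s] by simp
  have cont: "continuous_map (top_of_set ?W) E (nested_deriv E V g i j ?\<gamma>s ?\<eta>s)"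
    if "i \<le> Suc ?i" "j \<le> Suc ?j" for i j
  proof -
    have fst: "continuous_map (top_of_set ?W) (top_of_set U) fst" and snd: "continuous_map (top_of_set ?W) (top_of_set V) snd"
      unfolding prod_topology_subtopology_eu[symmetric] by (rule continuous_map_fst continuous_map_snd)+
    have "continuous_map (top_of_set ?W) E (\<lambda>v. nested_deriv E V g i j (\<lambda>k. ?\<gamma>s k) (\<lambda>k. ?\<eta>s k) (fst v, snd v))"
      by (rule continuous_map_nested_deriv[OF E V g kR fst snd]) (use \<gamma>s \<eta>s that in auto)
    then show ?thesis by simp
  qed
  have top: "nested_deriv E V g ?i ?j ?\<gamma>s ?\<eta>s \<in> ?W \<rightarrow> topspace E"
    using continuous_map_funspace[OF cont[of ?i ?j]] by simp
  have "has_dir_deriv E (\<lambda>t. dir_fst ?\<gamma> t + dir_snd ?\<eta> t) (nested_deriv E V g ?i ?j ?\<gamma>s ?\<eta>s) w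
      (nested_deriv E V g (Suc ?i) ?j ?\<gamma>s ?\<eta>s w + nested_deriv E V g ?i (Suc ?j) ?\<gamma>s ?\<eta>s w)"
    by (rule has_dir_deriv_sum_directions[OF E open_Times[OF U V] _ _ dir_fst_snd_commute w top d1 cont d2])
      (auto intro!: dir_fst_one_param dir_snd_one_param fst_one_param snd_one_param \<zeta>s)
  moreover have "(\<lambda>t. dir_fst ?\<gamma> t + dir_snd ?\<eta> t) = \<zeta>s n"
    by (simp add: fun_eq_iff dir_fst_def dir_snd_def prod_eq_iff)
  ultimately show ?thesis by (simp add: A B1 B2)
qed

lemma uncurry_smooth:
  fixes U :: "'g::topological_group_add set" and V :: "'h::topological_group_add set"
  assumes E: "seminorm_space E" and U: "open U" and V: "open V"
    and g: "g \<in> smooth_maps U (smooth_topology V E)"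
    and kR: "kR_products U V"
  shows "(\<lambda>(x, y). g x y) \<in> smooth_maps (U \<times> V) E"
    and "\<And>n w \<zeta>s. w \<in> U \<times> V \<Longrightarrow> (\<And>k. k < n \<Longrightarrow> \<zeta>s k \<in> \<LL>) \<Longrightarrow>
      iter_deriv E (\<lambda>(x, y). g x y) \<zeta>s n w = (\<Sum>(xs, ys)\<leftarrow>splits n. split_deriv E V g xs ys \<zeta>s w)"
proof -
  let ?f = "\<lambda>(x, y). g x y"
  let ?D = "\<lambda>n \<zeta>s w. \<Sum>u\<leftarrow>splits n. split_deriv E V g (fst u) (snd u) \<zeta>s w"
  have gx: "g x \<in> smooth_maps V E" if "x \<in> U" for x
    using iter_deriv_in_topspace[OF g that, of 0] by simp
  have zero: "?f w = 0" if "w \<notin> U \<times> V" for w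
  proof (cases "fst w \<in> U")
    case True
    then show ?thesis using that smooth_maps_zero[OF gx] by (auto simp: case_prod_unfold mem_Times_iff)
  next
    case False
    then show ?thesis using smooth_maps_zero[OF g] by (simp add: case_prod_unfold)
  qed
  have D0: "?D 0 \<zeta>s w = ?f w" for w \<zeta>s
    by (simp add: split_deriv_def nested_deriv_def case_prod_unfold)
  have d: "has_dir_deriv E (\<zeta>s n) (?D n \<zeta>s) w (?D (Suc n) \<zeta>s w)"
    if w: "w \<in> U \<times> V" and \<zeta>s: "\<And>k. k \<le> n \<Longrightarrow> \<zeta>s k \<in> \<LL>" for n w \<zeta>s
  proof -
    have "has_dir_deriv E (\<zeta>s n) (?D n \<zeta>s) w
      (\<Sum>u\<leftarrow>splits n. split_deriv E V g (fst u @ [n]) (snd u) \<zeta>s w + split_deriv E V g (fst u) (snd u @ [n]) \<zeta>s w)"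
    proof (rule has_dir_deriv_sum_list[OF E])
      fix u assume "u \<in> set (splits n)"
      then have "set (fst u) \<subseteq> {..<n} \<and> set (snd u) \<subseteq> {..<n}" by (intro splits_less) simp
      then show "has_dir_deriv E (\<zeta>s n) (split_deriv E V g (fst u) (snd u) \<zeta>s) w
          (split_deriv E V g (fst u @ [n]) (snd u) \<zeta>s w + split_deriv E V g (fst u) (snd u @ [n]) \<zeta>s w)"
        by (intro has_dir_deriv_split_deriv[OF E U V g kR w \<zeta>s]) auto
    qed
    \<comment> \<open>Listing the two summands of each pair one after the other is the recursion
      defining \<open>splits (Suc n)\<close>; the list is arbitrary so that induction
      applies.\<close>
    also have "(\<Sum>u\<leftarrow>us. split_deriv E V g (fst u @ [n]) (snd u) \<zeta>s w + split_deriv E V g (fst u) (snd u @ [n]) \<zeta>s w) =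
        (\<Sum>u\<leftarrow>concat (map (\<lambda>(xs, ys). [(xs @ [n], ys), (xs, ys @ [n])]) us). split_deriv E V g (fst u) (snd u) \<zeta>s w)" for us
      by (induction us) (auto simp: add.assoc)
    finally show ?thesis by simp
  qed
  have c: "continuous_map (deriv_domain (U \<times> V) n) E (\<lambda>(w, \<zeta>s). ?D n \<zeta>s w)" for n
    unfolding case_prod_unfold
  proof (rule continuous_map_sum_list_seminorm[OF E])
    fix u assume "u \<in> set (splits n)"
    then have u: "set (fst u) \<subseteq> {..<n}" "set (snd u) \<subseteq> {..<n}" using splits_less[of "fst u" "snd u" n] by auto
    let ?X = "deriv_domain (U \<times> V) n"
    have "continuous_map ?X E (\<lambda>z. nested_deriv E V g (length (fst u)) (length (snd u))
        (\<lambda>k. (\<lambda>t. fst (snd z (fst u ! k) t))) (\<lambda>k. (\<lambda>t. snd (snd z (snd u ! k) t))) (fst (fst z), snd (fst z)))"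
      by (rule continuous_map_nested_deriv[OF E V g kR continuous_map_split_components(1)[OF u(1)]
            continuous_map_split_components(2)[OF u(1)]
            continuous_map_split_components(3)[OF u(1)] continuous_map_split_components(4)[OF u(2)]])
    then show "continuous_map ?X E (\<lambda>z. split_deriv E V g (fst u) (snd u) (snd z) (fst z))"
      by (simp add: split_deriv_def)
  qed
  note * = smooth_mapsI_family[of E "U \<times> V" ?f ?D, OF E open_Times[OF U V] zero D0 d c]
  show "?f \<in> smooth_maps (U \<times> V) E" by (rule *(1))
  fix n w and \<zeta>s :: "nat \<Rightarrow> real \<Rightarrow> 'g \<times> 'h"
  assume w: "w \<in> U \<times> V" and \<zeta>s: "\<And>k. k < n \<Longrightarrow> \<zeta>s k \<in> \<LL>"
  have "iter_deriv E ?f \<zeta>s n w = ?D n \<zeta>s w"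
    by (rule *(2)[OF _ _ _ w \<zeta>s])
  then show "iter_deriv E ?f \<zeta>s n w = (\<Sum>(xs, ys)\<leftarrow>splits n. split_deriv E V g xs ys \<zeta>s w)"
    unfolding case_prod_unfold .
qed

section \<open>The exponential law\<close>

lemma continuous_seminorm_sum_list:
  assumes "subspace (topspace F)" "\<And>i. i \<in> set is \<Longrightarrow> continuous_seminorm F (p i)"
  shows "continuous_seminorm F (\<lambda>x. \<Sum>i\<leftarrow>is. p i x)"
  using assms(2)
  by (induction "is") (simp_all add: continuous_seminorm_zero continuous_seminorm_add[OF assms(1)])

text \<open>The derivative of order \<open>j\<close> at \<open>z\<close> of the derivative of order
  \<open>i\<close> at \<open>u\<close> of the curried map is the derivative of \<open>f\<close> of
  order \<open>i + j\<close> at \<open>m j (u, z)\<close>. A seminorm of the target is thus bounded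
  by seminorms of \<open>f\<close> over the compact images of \<open>K \<times> L j\<close>.\<close>

lemma continuous_map_curry:
  fixes U :: "'g::topological_group_add set" and V :: "'h::topological_group_add set"
  assumes E: "seminorm_space E" and U: "open U" and V: "open V"
  shows "continuous_map (smooth_topology (U \<times> V) E) (smooth_topology U (smooth_topology V E)) (\<lambda>f x y. f (x, y))"
proof (rule continuous_linear_map_into_smooth_topology)
  let ?F = "smooth_topology V E" and ?X = "smooth_topology (U \<times> V) E" and ?\<Phi> = "\<lambda>f x y. f (x, y)"
  note UV = open_Times[OF U V]
  show F: "seminorm_space ?F" by (rule seminorm_space_smooth_topology[OF E V])
  show X: "seminorm_space ?X" by (rule seminorm_space_smooth_topology[OF E UV])
  show "open U" by (rule U)
  show "?\<Phi> \<in> topspace ?X \<rightarrow> smooth_maps U ?F"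
    using curry_smooth(1)[OF E U V] by simp
  show "?\<Phi> (f - g) = ?\<Phi> f - ?\<Phi> g" for f g
    by (simp add: fun_eq_iff)
  note S = seminorm_space_subspace[OF X]
  fix i K q assume K: "compactin (deriv_domain U i) K" and q: "continuous_seminorm ?F q"
  obtain N L p where L: "\<And>j. compactin (deriv_domain V j) (L j)" and p: "continuous_seminorm E p"
    and dom: "\<And>h c. h \<in> smooth_maps V E \<Longrightarrow> 0 \<le> c \<Longrightarrow>
      \<forall>j<N. \<forall>z\<in>L j. p (deriv_map V E j h z) \<le> c \<Longrightarrow> q h \<le> c"
    by (rule smooth_seminorm_dominated[OF E V q]) (rule that)
  \<comment> \<open>Collects base points and directions of both factors into a point of the
    derivative domain of \<open>U \<times> V\<close>; the restriction makes the tuple of directions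
    extensional.\<close>
  define m where "m j z = ((fst (fst z), fst (snd z)), \<lambda>k\<in>{..<i + j}. mixed_dirs i (snd (fst z)) (snd (snd z)) k)"
    for j and z :: "('g \<times> (nat \<Rightarrow> real \<Rightarrow> 'g)) \<times> 'h \<times> (nat \<Rightarrow> real \<Rightarrow> 'h)"
  have m: "continuous_map (prod_topology (deriv_domain U i) (deriv_domain V j)) (deriv_domain (U \<times> V) (i + j)) (m j)" for j
    unfolding m_def[abs_def]
  proof (rule continuous_map_into_deriv_domain)
    let ?P = "prod_topology (deriv_domain U i) (deriv_domain V j)"
    show "continuous_map ?P (top_of_set (U \<times> V)) (\<lambda>z. (fst (fst z), fst (snd z)))"
      using continuous_map_pairedI[OF continuous_map_deriv_domain_base[OF continuous_map_fst]
          continuous_map_deriv_domain_base[OF continuous_map_snd]] by simp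
    show "continuous_map ?P one_param_topology (\<lambda>z. mixed_dirs i (snd (fst z)) (snd (snd z)) k)" if "k < i + j" for k
      by (rule continuous_map_mixed_dirs[OF continuous_map_deriv_domain_component[OF continuous_map_fst]
            continuous_map_deriv_domain_component[OF continuous_map_snd] that])
  qed
  have "\<exists>r. continuous_seminorm ?X r \<and>
      (\<forall>f\<in>smooth_maps (U \<times> V) E. \<forall>z\<in>m j ` (K \<times> L j). p (deriv_map (U \<times> V) E (i + j) f z) \<le> r f)" for j
  proof -
    have "compactin (deriv_domain (U \<times> V) (i + j)) (m j ` (K \<times> L j))"
      using K L by (intro image_compactin[OF _ m]) (simp add: compactin_Times)
    then obtain r where "continuous_seminorm ?X r"
      "\<And>f z. f \<in> smooth_maps (U \<times> V) E \<Longrightarrow> z \<in> m j ` (K \<times> L j) \<Longrightarrow> p (deriv_map (U \<times> V) E (i + j) f z) \<le> r f"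
      by (rule smooth_seminorm_exists[OF E UV p]) (rule that)
    then show ?thesis by (intro exI[of _ r]) simp
  qed
  then obtain r where r: "\<And>j. continuous_seminorm ?X (r j)"
    and le_r: "\<And>j f z. f \<in> smooth_maps (U \<times> V) E \<Longrightarrow> z \<in> m j ` (K \<times> L j) \<Longrightarrow>
      p (deriv_map (U \<times> V) E (i + j) f z) \<le> r j f"
    by metis
  define R where "R f = (\<Sum>j<N. r j f)" for f
  have R: "continuous_seminorm ?X R"
    unfolding R_def by (intro continuous_seminorm_sum[OF S] r) simp
  have "q (deriv_map U ?F i (?\<Phi> f) u) \<le> R f" if f: "f \<in> smooth_maps (U \<times> V) E" and u: "u \<in> K" for f u
  proof -
    have fX: "f \<in> topspace ?X" using f by simp
    obtain x \<gamma>s where u': "u = (x, \<gamma>s)" "x \<in> U" "\<gamma>s \<in> topspace (one_param_power i)" "\<forall>k<i. \<gamma>s k \<in> \<LL>"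
      using subsetD[OF compactin_subset_topspace[OF K] u] by (rule deriv_domainE)
    note \<gamma>s = u'(4)[rule_format]
    have du: "deriv_map U ?F i (?\<Phi> f) u = partial_slice E V f i \<gamma>s x"
      unfolding u'(1) deriv_map_apply[OF u'(2,3)]
      by (rule curry_smooth(2)[OF E U V f u'(2) \<gamma>s])
    show ?thesis
      unfolding du
    proof (rule dom[rule_format])
      show "partial_slice E V f i \<gamma>s x \<in> smooth_maps V E"
        by (rule partial_slice_smooth(1)[OF E V f u'(2) \<gamma>s])
      show "0 \<le> R f" by (rule seminorm_on_nonneg[OF continuous_seminorm_on[OF R] S fX])
      fix j z assume j: "j < N" and z: "z \<in> L j"
      then have zt: "z \<in> topspace (deriv_domain V j)" using compactin_subset_topspace[OF L] by blast
      have "m j (u, z) \<in> topspace (deriv_domain (U \<times> V) (i + j))"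
        using continuous_map_funspace[OF m[of j]] zt u compactin_subset_topspace[OF K] by auto
      moreover have "iter_deriv E f (\<lambda>k\<in>{..<i + j}. mixed_dirs i \<gamma>s (snd z) k) (i + j) =
          iter_deriv E f (mixed_dirs i \<gamma>s (snd z)) (i + j)"
        by (rule iter_deriv_cong) simp
      ultimately have "deriv_map (U \<times> V) E (i + j) f (m j (u, z)) = mixed_deriv E f i j \<gamma>s (snd z) (x, fst z)"
        by (simp add: deriv_map_def m_def u'(1) mixed_deriv_def)
      moreover have "deriv_map V E j (partial_slice E V f i \<gamma>s x) z = mixed_deriv E f i j \<gamma>s (snd z) (x, fst z)"
        by (rule deriv_map_partial_slice[OF E V f u'(2) \<gamma>s zt])
      ultimately have "p (deriv_map V E j (partial_slice E V f i \<gamma>s x) z) \<le> r j f"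
        using le_r[OF f, of "m j (u, z)" j] u z by simp
      also have "\<dots> \<le> R f"
        unfolding R_def using j
        by (intro member_le_sum seminorm_on_nonneg[OF continuous_seminorm_on[OF r] S fX]) auto
      finally show "p (deriv_map V E j (partial_slice E V f i \<gamma>s x) z) \<le> R f" .
    qed
  qed
  with R show "\<exists>r. continuous_seminorm ?X r \<and> (\<forall>f\<in>topspace ?X. \<forall>u\<in>K. q (deriv_map U ?F i (?\<Phi> f) u) \<le> r f)"
    by (intro exI[of _ R]) simp
qed

text \<open>A derivative of order \<open>n\<close> of the uncurried map is the sum of
  \<open>split_deriv\<close> over \<open>splits n\<close>, so it suffices to bound each summand by a
  continuous seminorm of \<open>g\<close>.\<close>

lemma continuous_map_uncurry:
  fixes U :: "'g::topological_group_add set" and V :: "'h::topological_group_add set"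
  assumes E: "seminorm_space E" and U: "open U" and V: "open V"
    and kR: "kR_products U V"
  shows "continuous_map (smooth_topology U (smooth_topology V E)) (smooth_topology (U \<times> V) E) (\<lambda>g (x, y). g x y)"
proof (rule continuous_linear_map_into_smooth_topology)
  let ?F = "smooth_topology V E" and ?\<Psi> = "\<lambda>g (x, y). g x y"
  let ?Y = "smooth_topology U ?F"
  show "open (U \<times> V)" by (rule open_Times[OF U V])
  have F: "seminorm_space ?F" by (rule seminorm_space_smooth_topology[OF E V])
  show Y: "seminorm_space ?Y" by (rule seminorm_space_smooth_topology[OF F U])
  show "seminorm_space E" by (rule E)
  show "?\<Psi> \<in> topspace ?Y \<rightarrow> smooth_maps (U \<times> V) E"
    using uncurry_smooth(1)[OF E U V _ kR] by simp
  show "?\<Psi> (f - g) = ?\<Psi> f - ?\<Psi> g" for f g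
    by (simp add: fun_eq_iff)
  note S = seminorm_space_subspace[OF Y]
  fix n K p assume K: "compactin (deriv_domain (U \<times> V) n) K" and p: "continuous_seminorm E p"
  define A where "A xs z = (fst (fst z), \<lambda>k\<in>{..<length xs}. \<lambda>t. fst (snd z (xs ! k) t))"
    for xs and z :: "('g \<times> 'h) \<times> (nat \<Rightarrow> real \<Rightarrow> 'g \<times> 'h)"
  define B where "B ys z = (snd (fst z), \<lambda>k\<in>{..<length ys}. \<lambda>t. snd (snd z (ys ! k) t))"
    for ys and z :: "('g \<times> 'h) \<times> (nat \<Rightarrow> real \<Rightarrow> 'g \<times> 'h)"
  let ?D = "deriv_domain (U \<times> V) n"
  have A: "continuous_map ?D (deriv_domain U (length xs)) (A xs)" if xs: "set xs \<subseteq> {..<n}" for xs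
    unfolding A_def[abs_def]
    by (intro continuous_map_into_deriv_domain continuous_map_split_components[OF xs])
  have B: "continuous_map ?D (deriv_domain V (length ys)) (B ys)" if ys: "set ys \<subseteq> {..<n}" for ys
    unfolding B_def[abs_def]
    by (intro continuous_map_into_deriv_domain continuous_map_split_components[OF ys])
  \<comment> \<open>Membership in the carrier is recorded because subadditivity over the list of
    summands holds only there.\<close>
  let ?Q = "\<lambda>u r. continuous_seminorm ?Y r \<and> (\<forall>g\<in>smooth_maps U ?F. \<forall>z\<in>K.
      split_deriv E V g (fst u) (snd u) (snd z) (fst z) \<in> topspace E \<and>
      p (split_deriv E V g (fst u) (snd u) (snd z) (fst z)) \<le> r g)"
  have "\<exists>r. ?Q u r" if "u \<in> set (splits n)" for u
  proof -
    obtain xs ys where u: "u = (xs, ys)" by (cases u)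
    have xs: "set xs \<subseteq> {..<n}" and ys: "set ys \<subseteq> {..<n}" using splits_less[of xs ys n] that u by auto
    \<comment> \<open>The bound is found in two stages. Derivatives along \<open>H\<close> over the
      compact image of \<open>K\<close> under \<open>B ys\<close> are bounded by a seminorm
      \<open>q\<close> of the function space. For this \<open>q\<close>, derivatives along
      \<open>G\<close> over the image under \<open>A xs\<close> are bounded by \<open>r\<close>.
      Passing to the two images allows \<open>K\<close> to be any compact set, not only a
      product.\<close>
    obtain q where q: "continuous_seminorm ?F q"
      and le_q: "\<And>h v. h \<in> smooth_maps V E \<Longrightarrow> v \<in> B ys ` K \<Longrightarrow> p (deriv_map V E (length ys) h v) \<le> q h"
      by (rule smooth_seminorm_exists[OF E V p image_compactin[OF K B[OF ys]]]) (rule that)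
    obtain r where r: "continuous_seminorm ?Y r"
      and le_r: "\<And>g v. g \<in> smooth_maps U ?F \<Longrightarrow> v \<in> A xs ` K \<Longrightarrow> q (deriv_map U ?F (length xs) g v) \<le> r g"
      by (rule smooth_seminorm_exists[OF F U q image_compactin[OF K A[OF xs]]]) (rule that)
    have "split_deriv E V g xs ys (snd z) (fst z) \<in> topspace E \<and> p (split_deriv E V g xs ys (snd z) (fst z)) \<le> r g"
      if g: "g \<in> smooth_maps U ?F" and z: "z \<in> K" for g z
    proof -
      have zD: "z \<in> topspace ?D" using compactin_subset_topspace[OF K] z by blast
      have Az: "A xs z \<in> topspace (deriv_domain U (length xs))" and Bz: "B ys z \<in> topspace (deriv_domain V (length ys))"
        using continuous_map_funspace[OF A[OF xs]] continuous_map_funspace[OF B[OF ys]] zD by auto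
      let ?h = "deriv_map U ?F (length xs) g (A xs z)"
      have h: "?h \<in> smooth_maps V E" using deriv_map_in_topspace[OF g Az] by simp
      have h_eq: "?h = iter_deriv ?F g (\<lambda>k t. fst (snd z (xs ! k) t)) (length xs) (fst (fst z))"
      proof -
        have "iter_deriv ?F g (\<lambda>k\<in>{..<length xs}. \<lambda>t. fst (snd z (xs ! k) t)) (length xs) =
            iter_deriv ?F g (\<lambda>k t. fst (snd z (xs ! k) t)) (length xs)"
          by (rule iter_deriv_cong) simp
        then show ?thesis using Az by (simp add: deriv_map_def A_def)
      qed
      have "iter_deriv E h (\<lambda>k\<in>{..<length ys}. \<lambda>t. snd (snd z (ys ! k) t)) (length ys) =
          iter_deriv E h (\<lambda>k t. snd (snd z (ys ! k) t)) (length ys)" for h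
        by (rule iter_deriv_cong) simp
      then have "deriv_map V E (length ys) ?h (B ys z) =
          iter_deriv E ?h (\<lambda>k t. snd (snd z (ys ! k) t)) (length ys) (snd (fst z))"
        using Bz by (simp add: deriv_map_def[of V E] B_def)
      then have eq: "split_deriv E V g xs ys (snd z) (fst z) = deriv_map V E (length ys) ?h (B ys z)"
        unfolding split_deriv_def nested_deriv_def h_eq by simp
      have "p (deriv_map V E (length ys) ?h (B ys z)) \<le> q ?h" using le_q[OF h] z by blast
      also have "\<dots> \<le> r g" using le_r[OF g] z by blast
      finally show ?thesis
        unfolding eq using deriv_map_in_topspace[OF h Bz] by simp
    qed
    with r show ?thesis unfolding u fst_conv snd_conv by blast
  qed
  then obtain r where r: "\<And>u. u \<in> set (splits n) \<Longrightarrow> ?Q u (r u)"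
    using bchoice[of "set (splits n)" ?Q] by blast
  let ?R = "\<lambda>g. \<Sum>u\<leftarrow>splits n. r u g"
  have R: "continuous_seminorm ?Y ?R"
    using r by (intro continuous_seminorm_sum_list[OF S]) blast
  have "p (deriv_map (U \<times> V) E n (?\<Psi> g) z) \<le> ?R g" if g: "g \<in> smooth_maps U ?F" and z: "z \<in> K" for g z
  proof -
    obtain w \<zeta>s where z': "z = (w, \<zeta>s)" "w \<in> U \<times> V" "\<zeta>s \<in> topspace (one_param_power n)" "\<forall>k<n. \<zeta>s k \<in> \<LL>"
      using subsetD[OF compactin_subset_topspace[OF K] z] by (rule deriv_domainE)
    let ?s = "\<lambda>u. split_deriv E V g (fst u) (snd u) \<zeta>s w"
    have s: "?s u \<in> topspace E \<and> p (?s u) \<le> r u g" if "u \<in> set (splits n)" for u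
    proof -
      from r[OF that] have "\<forall>z\<in>K. split_deriv E V g (fst u) (snd u) (snd z) (fst z) \<in> topspace E \<and>
          p (split_deriv E V g (fst u) (snd u) (snd z) (fst z)) \<le> r u g"
        using g by blast
      from bspec[OF this z] show ?thesis by (simp add: z'(1))
    qed
    have "deriv_map (U \<times> V) E n (?\<Psi> g) z = iter_deriv E (?\<Psi> g) \<zeta>s n w"
      unfolding z'(1) by (rule deriv_map_apply[OF z'(2,3)])
    also have "\<dots> = (\<Sum>(xs, ys)\<leftarrow>splits n. split_deriv E V g xs ys \<zeta>s w)"
      by (rule uncurry_smooth(2)[OF E U V g kR z'(2) z'(4)[rule_format]])
    also have "\<dots> = (\<Sum>u\<leftarrow>splits n. ?s u)" by (simp add: case_prod_unfold)
    finally have eq: "deriv_map (U \<times> V) E n (?\<Psi> g) z = (\<Sum>u\<leftarrow>splits n. ?s u)" .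
    have "p (\<Sum>u\<leftarrow>splits n. ?s u) \<le> (\<Sum>u\<leftarrow>splits n. p (?s u))"
      using seminorm_on_sum_list[OF continuous_seminorm_on[OF p] seminorm_space_subspace[OF E],
          where ws = "splits n" and f = ?s] s by simp
    also have "\<dots> \<le> ?R g" using s by (intro sum_list_mono) blast
    finally show ?thesis unfolding eq .
  qed
  with R show "\<exists>r. continuous_seminorm ?Y r \<and> (\<forall>g\<in>topspace ?Y. \<forall>z\<in>K. p (deriv_map (U \<times> V) E n (?\<Psi> g) z) \<le> r g)"
    by (intro exI[of _ ?R]) simp
qed

theorem mainTheorem1:
  fixes U :: "'g::{topological_group_add, t2_space} set"
    and V :: "'h::{topological_group_add, t2_space} set"
    and E :: "'e::real_vector topology"
  assumes "open U" and "open V"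
    and "locally_convex_space E"
    and "\<And>i j. kR_space
           (prod_topology (top_of_set U)
             (prod_topology (top_of_set V)
               (prod_topology
                 (one_param_power i :: (nat \<Rightarrow> real \<Rightarrow> 'g) topology)
                 (one_param_power j :: (nat \<Rightarrow> real \<Rightarrow> 'h) topology))))"
  shows "tvs_isomorphism
           (smooth_topology (U \<times> V) E)
           (smooth_topology U (smooth_topology V E))
           (\<lambda>f x y. f (x, y))"
proof -
  note E = locally_convex_imp_seminorm_space[OF assms(3)]
  have kR: "kR_products U V" unfolding kR_products_def using assms(4) by blast
  let ?X = "smooth_topology (U \<times> V) E" and ?Y = "smooth_topology U (smooth_topology V E)"
  let ?\<Phi> = "\<lambda>f x y. f (x, y) :: 'e"
  \<comment> \<open>Continuity includes that each map sends one carrier into the other. By the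
    extension by zero, the inverse identities are those of plain currying.\<close>
  have "homeomorphic_maps ?X ?Y ?\<Phi> (\<lambda>g (x, y). g x y)"
    unfolding homeomorphic_maps_def
    using continuous_map_curry[OF E assms(1,2)] continuous_map_uncurry[OF E assms(1,2) kR]
    by (simp add: case_prod_unfold)
  then have hom: "homeomorphic_map ?X ?Y ?\<Phi>"
    by (rule homeomorphic_maps_map[THEN iffD1, THEN conjunct1])
  then have "bij_betw ?\<Phi> (topspace ?X) (topspace ?Y)"
    unfolding bij_betw_def using homeomorphic_imp_injective_map homeomorphic_imp_surjective_map by blast
  with hom show ?thesis
    unfolding tvs_isomorphism_def by (simp add: fun_eq_iff scaleR_fun_def)
qed

end
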